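(* Let $m$ be a positive integer and let $\mathcal{L}=\mathcal{L}_{3,2m+1}(m^9)$ be the linear system of surfaces of degree $2m+1$ in $\mathbb{P}^3$ with multiplicity at least $m$ at each of nine points in general position. Then $\mathcal{L}$ is special if and only if $m\ge 9$. In particular: (i) $\dim(\mathcal{L}_{3,2m+1}(m^9))=\operatorname{vdim}(\mathcal{L}_{3,2m+1}(m^9))$ for $m\le 8$; (ii) $\dim(\mathcal{L}_{3,2m+1}(m^9))=60$ for $m\ge 7$; (iii) the unique quadric surface $Q$ through the nine base points is in the base locus of $\mathcal{L}$ with multiplicity $m-7$, for any $m\ge 8$.
   Context: We work over the complex numbers. For $\mathcal{L}=\mathcal{L}_{3,d}(m_1,\dots,m_s)$, the linear system of degree $d$ surfaces in $\mathbb{P}^3$ with multiplicity at least $m_i$ at $p_i$ for points $p_1,\dots,p_s$ in general position, $\dim(\mathcal{L})$ is the affine (vector space) dimension, $$\operatorname{vdim}(\mathcal{L})=\binom{d+3}{3}-\sum_{i=1}^s\binom{m_i+2}{3},$$ $\operatorname{edim}(\mathcal{L})=\max(\operatorname{vdim}(\mathcal{L}),0)$, and $\mathcal{L}$ is special if $\dim(\mathcal{L})>\operatorname{edim}(\mathcal{L})$. The notation $m^k$ means that the multiplicity $m$ is repeated $k$ times. *)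

theory Defs
  imports "HOL-Analysis.Analysis" "HOL-Library.Poly_Mapping"
begin

type_synonym 'v cpoly = "('v \<Rightarrow>\<^sub>0 nat) \<Rightarrow>\<^sub>0 complex"

definition cpoly_scale :: "complex \<Rightarrow> 'v cpoly \<Rightarrow> 'v cpoly" where
  "cpoly_scale c f = Poly_Mapping.single 0 c * f"

interpretation cpoly: vector_space "cpoly_scale :: complex \<Rightarrow> 'v cpoly \<Rightarrow> 'v cpoly"
  by unfold_locales
    (simp_all add: cpoly_scale_def algebra_simps single_add mult_single flip: mult.assoc)

definition cpoly_eval :: "('v::finite \<Rightarrow> complex) \<Rightarrow> 'v cpoly \<Rightarrow> complex" where
  "cpoly_eval x f =
     (\<Sum>a\<in>Poly_Mapping.keys f. Poly_Mapping.lookup f a * (\<Prod>v\<in>UNIV. x v ^ Poly_Mapping.lookup a v))"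

definition cpoly_partial :: "'v \<Rightarrow> 'v cpoly \<Rightarrow> 'v cpoly" where
  "cpoly_partial v f =
     (\<Sum>a\<in>Poly_Mapping.keys f.
        Poly_Mapping.single (a - Poly_Mapping.single v 1)
          (of_nat (Poly_Mapping.lookup a v) * Poly_Mapping.lookup f a))"

text \<open>The zero polynomial is homogeneous of every degree.\<close>

definition homogeneous :: "nat \<Rightarrow> 'v::finite cpoly \<Rightarrow> bool" where
  "homogeneous d f \<longleftrightarrow>
     (\<forall>a\<in>Poly_Mapping.keys f. (\<Sum>v\<in>UNIV. Poly_Mapping.lookup a v) = d)"

text \<open>
  Points of projective 3-space are given by nonzero vectors of homogeneous coordinates.  A form
  has multiplicity at least \<open>m\<close> at a point iff all its partial derivatives of order less
  than \<open>m\<close> vanish there; for a form this does not depend on the chosen coordinate vector.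
\<close>

definition mult_at_least :: "nat \<Rightarrow> complex^4 \<Rightarrow> 4 cpoly \<Rightarrow> bool" where
  "mult_at_least m x f \<longleftrightarrow>
     (\<forall>vs. length vs < m \<longrightarrow> cpoly_eval (\<lambda>j. x $ j) (fold cpoly_partial vs f) = 0)"

definition linear_system ::
    "nat \<Rightarrow> ('s::finite \<Rightarrow> complex^4) \<Rightarrow> ('s \<Rightarrow> nat) \<Rightarrow> 4 cpoly set" where
  "linear_system d p m = {f. homogeneous d f \<and> (\<forall>i. mult_at_least (m i) (p i) f)}"

definition ls_dim :: "nat \<Rightarrow> ('s::finite \<Rightarrow> complex^4) \<Rightarrow> ('s \<Rightarrow> nat) \<Rightarrow> nat" where
  "ls_dim d p m = cpoly.dim (linear_system d p m)"

definition vdim :: "nat \<Rightarrow> ('s::finite \<Rightarrow> nat) \<Rightarrow> int" where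
  "vdim d m = int ((d + 3) choose 3) - (\<Sum>i\<in>UNIV. int ((m i + 2) choose 3))"

definition edim :: "nat \<Rightarrow> ('s::finite \<Rightarrow> nat) \<Rightarrow> int" where
  "edim d m = max (vdim d m) 0"

definition special :: "nat \<Rightarrow> ('s::finite \<Rightarrow> complex^4) \<Rightarrow> ('s \<Rightarrow> nat) \<Rightarrow> bool" where
  "special d p m \<longleftrightarrow> int (ls_dim d p m) > edim d m"

text \<open>
  The Zariski topology on a product of projective 3-spaces, one factor for each \<open>i\<close>.  Closed sets
  are the common zero loci of multihomogeneous polynomials in variables \<open>(i, j)\<close>, standing for
  the \<open>j\<close>-th coordinate of the \<open>i\<close>-th point.  Open sets are represented by the set of all their
  (nonzero) homogeneous coordinate vectors.
\<close>

definition multihomogeneous :: "('s::finite \<times> 4) cpoly \<Rightarrow> bool" where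
  "multihomogeneous g \<longleftrightarrow>
     (\<exists>e. \<forall>a\<in>Poly_Mapping.keys g. \<forall>i. (\<Sum>j\<in>UNIV. Poly_Mapping.lookup a (i, j)) = e i)"

definition zariski_open :: "('s::finite \<Rightarrow> complex^4) set \<Rightarrow> bool" where
  "zariski_open U \<longleftrightarrow>
     (\<exists>G. (\<forall>g\<in>G. multihomogeneous g) \<and>
          U = {p. (\<forall>i. p i \<noteq> 0) \<and> (\<exists>g\<in>G. cpoly_eval (\<lambda>(i, j). p i $ j) g \<noteq> 0)})"

definition for_general_points :: "(('s::finite \<Rightarrow> complex^4) \<Rightarrow> bool) \<Rightarrow> bool" where
  "for_general_points P \<longleftrightarrow> (\<exists>U. zariski_open U \<and> U \<noteq> {} \<and> (\<forall>p\<in>U. P p))"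

text \<open>A quadric surface is a nonzero quadratic form up to a scalar factor.\<close>

definition quadric_through :: "('s::finite \<Rightarrow> complex^4) \<Rightarrow> 4 cpoly \<Rightarrow> bool" where
  "quadric_through p q \<longleftrightarrow> q \<noteq> 0 \<and> homogeneous 2 q \<and> (\<forall>i. cpoly_eval (\<lambda>j. p i $ j) q = 0)"

definition unique_quadric_through :: "('s::finite \<Rightarrow> complex^4) \<Rightarrow> 4 cpoly \<Rightarrow> bool" where
  "unique_quadric_through p q \<longleftrightarrow>
     quadric_through p q \<and> (\<forall>q'. quadric_through p q' \<longrightarrow> (\<exists>c. q' = cpoly_scale c q))"

text \<open>
  The surface \<open>q = 0\<close> is in the base locus of the system \<open>V\<close> with multiplicity (exactly) \<open>k\<close>:
  \<open>k\<close> is the largest number such that every member of \<open>V\<close> contains the surface \<open>k\<close> times.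
\<close>

definition base_locus_mult :: "4 cpoly set \<Rightarrow> 4 cpoly \<Rightarrow> nat \<Rightarrow> bool" where
  "base_locus_mult V q k \<longleftrightarrow> (\<forall>f\<in>V. q ^ k dvd f) \<and> \<not> (\<forall>f\<in>V. q ^ Suc k dvd f)"

end

(* Restricting surfaces of degree 2m + 1 to the quadric Q through the nine points p_i gives
     dim L(m) <= dim L(m - 1) + dim M(m),
   where L(m) = L_{3,2m+1}(m^9) and M(m) consists of the curves of bidegree (2m+1, 2m+1) on
   Q = P^1 x P^1 with multiplicity m at the p_i.  If M(m) has the expected dimension
   max(0, (8 - m)(m + 1) / 2) for all m, then summing up bounds dim L(m) by vdim for m <= 8 and by 60
   for m >= 7.  Equality follows from the count of conditions for m <= 8 and from
   Q^{m-7} L(7) <= L(m) for m >= 7, and it forces L(m) = Q^{m-7} L(7), which is the statement on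
   the base locus.  By semicontinuity it suffices to bound the dimensions for one choice of points,
   and we take them on the Segre quadric, in its torus.

   For M(m) the points are let go to the boundary of the torus one after the other, p_i = (t^A, t^B)
   with t large.  Each point then disposes of a part of the grid of monomials x^a y^b,
   0 <= a, b <= 2m + 1: any set of exponents that can be separated, in the order given by the
   weight A a + B b, by plane curves of degree less than m.  The nine parts are given explicitly, for
   m <= 10 by lists and for m >= 11 by convex polygons that scale with m. *)

theory Submission
  imports Defs "HOL-Computational_Algebra.Polynomial"
begin

section \<open>Degeneration of fat points in the torus\<close>

text \<open>The lower bounds hold for every configuration, so everything about general points
  follows from finitely many upper bounds on dimensions, which are open conditions. This includes
  the smoothness of Q at the base points, phrased as the absence of quadrics through the nine points
  and singular at one of them; smoothness is what makes division by Q cost only one in multiplicity.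
  The multiplicity of Q in the base locus cannot exceed m - 7 because dim L(6) <= 56 < 60 = dim
  L(7). The obstacle is M(m) for unbounded m. At m = 8 the count is exact, 18^2 = 9 * 36, so the
  nine parts must tile the grid without loss. Only for larger m does the surplus 9 m (m + 1) / 2 -
  (2m + 2)^2, which grows like m^2 / 2, leave room for cuts in fixed proportions. Each decomposition
  produces its own nine points; one configuration that serves all levels up to m exists because
  every level is a nonempty open condition on the same points.\<close>

inductive polyfun :: "('a \<Rightarrow> complex) set \<Rightarrow> nat \<Rightarrow> ('a \<Rightarrow> complex) \<Rightarrow> bool" for X where
  const: "polyfun X d (\<lambda>_. c)"
| add: "polyfun X d P \<Longrightarrow> polyfun X d Q \<Longrightarrow> polyfun X d (\<lambda>a. P a + Q a)"
| mult: "x \<in> X \<Longrightarrow> polyfun X d P \<Longrightarrow> polyfun X (Suc d) (\<lambda>a. x a * P a)"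

lemma polyfun_mono: "polyfun X d P \<Longrightarrow> d \<le> e \<Longrightarrow> polyfun X e P"
proof (induction arbitrary: e rule: polyfun.induct)
  case (mult x d P)
  then obtain e' where "e = Suc e'" "d \<le> e'" by (cases e) auto
  with mult show ?case by (auto intro: polyfun.mult)
qed (auto intro: polyfun.intros)

lemma polyfun_scale: "polyfun X d P \<Longrightarrow> polyfun X d (\<lambda>a. c * P a)"
proof (induction rule: polyfun.induct)
  case (add d P Q)
  show ?case using polyfun.add[OF add.IH] by (simp add: distrib_left)
next
  case (mult x d P)
  show ?case using polyfun.mult[OF mult.hyps(1) mult.IH] by (simp add: mult.left_commute)
qed (auto intro: polyfun.const)

lemma polyfun_times:
  "polyfun X d P \<Longrightarrow> polyfun X e Q \<Longrightarrow> polyfun X (d + e) (\<lambda>a. P a * Q a)"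
proof (induction rule: polyfun.induct)
  case (const d c)
  show ?case by (rule polyfun_scale[OF polyfun_mono[OF const]]) simp
next
  case (add d P R)
  then show ?case by (simp add: distrib_right polyfun.add)
next
  case (mult x d P)
  show ?case using polyfun.mult[OF mult.hyps(1) mult.IH[OF mult.prems]] by (simp add: mult.assoc)
qed

abbreviation exponents :: "(nat \<times> nat \<Rightarrow> complex) set" where
  "exponents \<equiv> {\<lambda>a. of_nat (fst a), \<lambda>a. of_nat (snd a)}"

definition linform :: "int \<Rightarrow> int \<Rightarrow> nat \<times> nat \<Rightarrow> int" where
  "linform A B a = A * int (fst a) + B * int (snd a)"

lemma polyfun_linform: "polyfun exponents (Suc 0) (\<lambda>a. of_int (linform A B a - C))"
proof -
  have "polyfun exponents (Suc 0) (\<lambda>a. of_nat (fst a) * of_int A)"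
    "polyfun exponents (Suc 0) (\<lambda>a. of_nat (snd a) * of_int B)"
    by (auto intro: polyfun.mult[of "\<lambda>a. of_nat (fst a)"] polyfun.mult[of "\<lambda>a. of_nat (snd a)"] polyfun.const)
  from polyfun.add[OF polyfun.add[OF this] polyfun.const[of _ _ "- of_int C"]]
  show ?thesis by (simp add: linform_def mult.commute)
qed

lemma polyfun_prod_linform:
  "finite I \<Longrightarrow> polyfun exponents (card I) (\<lambda>a. \<Prod>i\<in>I. of_int (linform (A i) (B i) a - C i))"
proof (induction rule: finite_induct)
  case (insert i I)
  show ?case using polyfun_times[OF polyfun_linform insert.IH, of "A i" "B i" "C i"] insert.hyps by simp
qed (auto intro: polyfun.const)

definition mon :: "complex \<times> complex \<Rightarrow> nat \<times> nat \<Rightarrow> complex" where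
  "mon z a = fst z ^ fst a * snd z ^ snd a"

text \<open>The curve with coefficients \<open>f\<close> on the monomials in \<open>D\<close> has multiplicity above \<open>d\<close> at
  a point \<open>z\<close> of the torus iff \<open>\<Sum> f a P(a) z^a = 0\<close> for all polynomials \<open>P\<close> of degree at most
  \<open>d\<close>, because the Euler operators multiply \<open>z^a\<close> by the exponents.\<close>

definition unisolvent ::
    "nat \<Rightarrow> ('i \<Rightarrow> complex \<times> complex) \<Rightarrow> 'i set \<Rightarrow> (nat \<times> nat) set \<Rightarrow> bool" where
  "unisolvent d p I D \<longleftrightarrow>
     (\<forall>f. (\<forall>i\<in>I. \<forall>P. polyfun exponents d P \<longrightarrow> (\<Sum>a\<in>D. f a * (P a * mon (p i) a)) = 0) \<longrightarrow>
          (\<forall>a\<in>D. f a = 0))"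

text \<open>Finite duality: a space of functions without annihilator on \<open>D\<close> restricts
  onto all functions on \<open>D\<close>, so it contains a dual basis. One point \<open>c\<close> is
  split off at a time: some \<open>r\<close> in \<open>L\<close> has value 1 at \<open>c\<close>,
  and the functions of \<open>L\<close> vanishing at \<open>c\<close> inherit the hypothesis on the
  remaining points.\<close>

lemma dual_functions:
  fixes L :: "('a \<Rightarrow> complex) set"
  assumes "finite D"
    and add: "\<And>g h. g \<in> L \<Longrightarrow> h \<in> L \<Longrightarrow> (\<lambda>a. g a + h a) \<in> L"
    and scale: "\<And>c g. g \<in> L \<Longrightarrow> (\<lambda>a. c * g a) \<in> L"
    and inj: "\<And>f. (\<And>g. g \<in> L \<Longrightarrow> (\<Sum>a\<in>D. f a * g a) = 0) \<Longrightarrow> \<forall>a\<in>D. f a = 0"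
    and "a \<in> D"
  shows "\<exists>g\<in>L. \<forall>b\<in>D. g b = (if b = a then 1 else 0)"
  using assms
proof (induction D arbitrary: L a rule: finite_induct)
  case (insert c D)
  note add = insert.prems(1) and scale = insert.prems(2) and inj = insert.prems(3)
  obtain r0 where r0: "r0 \<in> L" "r0 c \<noteq> 0"
  proof (rule ccontr)
    assume "\<not> thesis"
    then have "\<And>g. g \<in> L \<Longrightarrow> g c = 0" using that by blast
    then have "\<forall>a\<in>insert c D. (\<lambda>a. if a = c then 1 else (0::complex)) a = 0"
      using insert.hyps by (intro inj) (simp add: sum.neutral)
    then show False by auto
  qed
  define r where "r = (\<lambda>a. (1 / r0 c) * r0 a)"
  have r: "r \<in> L" "r c = 1" using r0 scale[OF r0(1), of "1 / r0 c"] by (auto simp: r_def)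
  have lin: "(\<lambda>a. g a + s * h a) \<in> L" if "g \<in> L" "h \<in> L" for g h s
    using add[OF that(1) scale[OF that(2)]] .
  have "\<exists>g\<in>{g \<in> L. g c = 0}. \<forall>b\<in>D. g b = (if b = a then 1 else 0)" if "a \<in> D" for a
  proof (rule insert.IH)
    fix f assume f: "\<And>g. g \<in> {g \<in> L. g c = 0} \<Longrightarrow> (\<Sum>a\<in>D. f a * g a) = 0"
    \<comment> \<open>The value at \<open>c\<close> makes \<open>f'\<close> orthogonal to
      \<open>r\<close>. It is then orthogonal to every \<open>g\<close> in \<open>L\<close>, because
      \<open>g - g c * r\<close> vanishes at \<open>c\<close>.\<close>
    define f' where "f' = (\<lambda>a. if a = c then - (\<Sum>a\<in>D. f a * r a) else f a)"
    have "\<forall>a\<in>insert c D. f' a = 0"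
    proof (rule inj)
      fix g assume g: "g \<in> L"
      have "(\<Sum>a\<in>D. f a * (g a + (- g c) * r a)) = 0"
        using f[of "\<lambda>a. g a + (- g c) * r a"] lin[OF g r(1), of "- g c"] r(2) by auto
      then have "(\<Sum>a\<in>D. f a * g a) = g c * (\<Sum>a\<in>D. f a * r a)"
        by (simp add: algebra_simps sum.distrib sum_distrib_left sum_subtractf)
      moreover have "(\<Sum>a\<in>D. f' a * g a) = (\<Sum>a\<in>D. f a * g a)"
        using insert.hyps by (intro sum.cong) (auto simp: f'_def)
      ultimately show "(\<Sum>a\<in>insert c D. f' a * g a) = 0"
        using insert.hyps by (simp add: f'_def)
    qed
    then show "\<forall>a\<in>D. f a = 0" using insert.hyps by (auto simp: f'_def split: if_splits)
  qed (use add scale that in auto)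
  then have "\<forall>a\<in>D. \<exists>g. g \<in> L \<and> g c = 0 \<and> (\<forall>b\<in>D. g b = (if b = a then 1 else 0))" by blast
  then obtain G where G: "\<And>a. a \<in> D \<Longrightarrow> G a \<in> L" "\<And>a. a \<in> D \<Longrightarrow> G a c = 0"
      "\<And>a b. a \<in> D \<Longrightarrow> b \<in> D \<Longrightarrow> G a b = (if b = a then 1 else 0)" by metis
  show ?case
  proof (cases "a = c")
    case False
    then show ?thesis using G(1)[of a] G(2)[of a] G(3)[of a] insert.prems(4) insert.hyps by (intro bexI[of _ "G a"]) auto
  next
    case True
    \<comment> \<open>The dual function of \<open>c\<close> is \<open>r\<close> with its values at
      the other points removed by means of their dual functions.\<close>
    have *: "(\<lambda>b. r b + (\<Sum>a\<in>E. - r a * G a b)) \<in> L" if "E \<subseteq> D" for E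
      using finite_subset[OF that insert.hyps(1)] that
    proof (induction E rule: finite_induct)
      case (insert x E)
      then show ?case using lin[of "\<lambda>b. r b + (\<Sum>a\<in>E. - r a * G a b)" "G x" "- r x"] G(1)
        by (simp add: algebra_simps)
    qed (use r in auto)
    have "r b + (\<Sum>a\<in>D. - r a * G a b) = (if b = a then 1 else 0)" if "b \<in> insert c D" for b
    proof (cases "b = c")
      case False
      then have "(\<Sum>a\<in>D. - r a * G a b) = (\<Sum>a\<in>D. if a = b then - r a else 0)"
        using that by (intro sum.cong) (auto simp: G(3))
      then show ?thesis using False that True insert.hyps by simp
    qed (use True r G(2) in auto)
    then show ?thesis using *[of D] by (intro bexI[of _ "\<lambda>b. r b + (\<Sum>a\<in>D. - r a * G a b)"]) auto
  qed
qed auto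

text \<open>\<open>D\<close> are the exponents present, \<open>D'\<close> those left to the other
  points. At (t^A, t^B) with t large the heavier monomials dominate; \<open>P\<close> removes all
  terms at least as heavy as \<open>a\<close>, so that \<open>a\<close> leads. The heavier exponents
  of \<open>D'\<close> must be removed as well, since nothing is known about their coefficients
  yet.\<close>

definition eats :: "nat \<Rightarrow> (nat \<times> nat) set \<Rightarrow> (nat \<times> nat) set \<Rightarrow> bool" where
  "eats d D D' \<longleftrightarrow> D' \<subseteq> D \<and> (\<exists>A B. \<forall>a\<in>D - D'. \<exists>P. polyfun exponents d P \<and> P a \<noteq> 0 \<and>
     (\<forall>b\<in>D. b \<noteq> a \<longrightarrow> linform A B a \<le> linform A B b \<longrightarrow> P b = 0))"

lemma mon_power_int:
  assumes "t \<noteq> 0"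
  shows "mon (of_real (t powi A), of_real (t powi B)) a = of_real (t powi linform A B a)"
  using assms by (simp add: mon_def linform_def power_int_add power_int_mult del: of_real_power_int flip: of_real_power of_real_mult)

text \<open>Rescaled by the weights, the \<open>P\<close> of \<open>eats\<close> tend to the dual basis of the eaten exponents
  as \<open>t\<close> grows.\<close>

lemma unisolvent_degeneration:
  fixes p :: "'i \<Rightarrow> complex \<times> complex"
  assumes D: "finite D" and eats: "eats d D D'" and uni: "unisolvent d p I D'"
    and I: "finite I" "i \<notin> I"
  shows "\<exists>z. fst z \<noteq> 0 \<and> snd z \<noteq> 0 \<and> unisolvent d (p(i := z)) (insert i I) D"
proof -
  from eats obtain A B where sub: "D' \<subseteq> D" and ex: "\<forall>a\<in>D - D'. \<exists>P. polyfun exponents d P \<and> P a \<noteq> 0 \<and>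
     (\<forall>b\<in>D. b \<noteq> a \<longrightarrow> linform A B a \<le> linform A B b \<longrightarrow> P b = 0)" unfolding eats_def by blast
  define w where "w = linform A B"
  have "\<forall>a\<in>D - D'. \<exists>P. polyfun exponents d P \<and> P a = 1 \<and> (\<forall>b\<in>D. b \<noteq> a \<longrightarrow> w a \<le> w b \<longrightarrow> P b = 0)"
  proof
    fix a assume "a \<in> D - D'"
    then obtain P where "polyfun exponents d P" "P a \<noteq> 0" "\<forall>b\<in>D. b \<noteq> a \<longrightarrow> w a \<le> w b \<longrightarrow> P b = 0"
      using ex unfolding w_def by blast
    then show "\<exists>P. polyfun exponents d P \<and> P a = 1 \<and> (\<forall>b\<in>D. b \<noteq> a \<longrightarrow> w a \<le> w b \<longrightarrow> P b = 0)"
      by (intro exI[of _ "\<lambda>b. 1 / P a * P b"]) (auto intro: polyfun_scale[of _ _ _ "1 / P a", simplified])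
  qed
  then obtain P where P: "\<And>a. a \<in> D - D' \<Longrightarrow> polyfun exponents d (P a)" "\<And>a. a \<in> D - D' \<Longrightarrow> P a a = 1"
    "\<And>a b. a \<in> D - D' \<Longrightarrow> b \<in> D \<Longrightarrow> b \<noteq> a \<Longrightarrow> w a \<le> w b \<Longrightarrow> P a b = 0" by metis
  \<comment> \<open>The conditions imposed by the old points, seen as functions of the exponent. By
    unisolvence on \<open>D'\<close> they contain a dual basis \<open>G\<close> of the exponents in
    \<open>D'\<close>.\<close>
  define L where "L = {g. \<exists>Q. (\<forall>j. polyfun exponents d (Q j)) \<and> g = (\<lambda>a. \<Sum>j\<in>I. Q j a * mon (p j) a)}"
  have "\<exists>g\<in>L. \<forall>b\<in>D'. g b = (if b = a then 1 else 0)" if "a \<in> D'" for a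
  proof (rule dual_functions)
    show "finite D'" using D sub finite_subset by blast
    show "(\<lambda>a. g a + h a) \<in> L" if gh: "g \<in> L" "h \<in> L" for g h
    proof -
      obtain Q R where "\<forall>j. polyfun exponents d (Q j)" "g = (\<lambda>a. \<Sum>j\<in>I. Q j a * mon (p j) a)"
        "\<forall>j. polyfun exponents d (R j)" "h = (\<lambda>a. \<Sum>j\<in>I. R j a * mon (p j) a)"
        using gh unfolding L_def by blast
      then show ?thesis unfolding L_def
        by (intro CollectI exI[of _ "\<lambda>j a. Q j a + R j a"]) (auto intro: polyfun.add simp: distrib_right sum.distrib)
    qed
    show "(\<lambda>a. c * g a) \<in> L" if g: "g \<in> L" for c g
    proof -
      obtain Q where "\<forall>j. polyfun exponents d (Q j)" "g = (\<lambda>a. \<Sum>j\<in>I. Q j a * mon (p j) a)"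
        using g unfolding L_def by blast
      then show ?thesis unfolding L_def
        by (intro CollectI exI[of _ "\<lambda>j a. c * Q j a"]) (auto intro: polyfun_scale simp: sum_distrib_left mult.assoc)
    qed
    fix f assume f: "\<And>g. g \<in> L \<Longrightarrow> (\<Sum>a\<in>D'. f a * g a) = 0"
    have "(\<Sum>a\<in>D'. f a * (Q a * mon (p j) a)) = 0" if "j \<in> I" "polyfun exponents d Q" for j Q
    proof -
      have eq: "(\<Sum>j'\<in>I. (if j' = j then Q a else 0) * mon (p j') a) = Q a * mon (p j) a" for a
      proof -
        have "(\<Sum>j'\<in>I. (if j' = j then Q a else 0) * mon (p j') a) = (\<Sum>j'\<in>I. if j' = j then Q a * mon (p j') a else 0)"
          by (intro sum.cong) auto
        then show ?thesis using that I by simp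
      qed
      have "(\<lambda>a. \<Sum>j'\<in>I. (\<lambda>a. if j' = j then Q a else 0) a * mon (p j') a) \<in> L"
        unfolding L_def
      proof (intro CollectI exI conjI allI)
        show "polyfun exponents d (\<lambda>a. if j' = j then Q a else 0)" for j'
          using that(2) by (cases "j' = j") (auto intro: polyfun.const)
      qed auto
      from f[OF this] show ?thesis by (simp add: eq)
    qed
    then show "\<forall>a\<in>D'. f a = 0" using uni unfolding unisolvent_def by blast
  qed (use that in auto)
  then obtain G where G: "\<And>a. a \<in> D' \<Longrightarrow> G a \<in> L" "\<And>a b. a \<in> D' \<Longrightarrow> b \<in> D' \<Longrightarrow> G a b = (if b = a then 1 else 0)"
    by metis
  define C where "C = (\<Sum>a\<in>D. \<Sum>b\<in>D. cmod (P a b))"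
  define C' where "C' = (\<Sum>a\<in>D. \<Sum>b\<in>D. cmod (G a b))"
  have C0: "C \<ge> 0" "C' \<ge> 0" by (auto simp: C_def C'_def sum_nonneg)
  have C: "cmod (P a b) \<le> C" "cmod (G a b) \<le> C'" if "a \<in> D" "b \<in> D" for a b
  proof -
    have "cmod (P a b) \<le> (\<Sum>b\<in>D. cmod (P a b))" using D that by (intro member_le_sum) auto
    also have "\<dots> \<le> C" unfolding C_def using D that
      by (intro member_le_sum[of a D "\<lambda>a. \<Sum>b\<in>D. cmod (P a b)"]) (auto simp: sum_nonneg)
    finally show "cmod (P a b) \<le> C" .
    have "cmod (G a b) \<le> (\<Sum>b\<in>D. cmod (G a b))" using D that by (intro member_le_sum) auto
    also have "\<dots> \<le> C'" unfolding C'_def using D that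
      by (intro member_le_sum[of a D "\<lambda>a. \<Sum>b\<in>D. cmod (G a b)"]) (auto simp: sum_nonneg)
    finally show "cmod (G a b) \<le> C'" .
  qed
  define N where "N = real (card D)"
  \<comment> \<open>Chosen so that the estimates 1 and 2 below, summed over all of \<open>D\<close>,
    bound \<open>S\<close> by a factor less than 1 times \<open>S\<close>.\<close>
  define t where "t = 1 + N * C + N * (C' * N * C)"
  have t: "t \<ge> 1" "N * C + N * (C' * N * C) < t" using C0 by (auto simp: t_def N_def)
  define z where "z = (complex_of_real (t powi A), complex_of_real (t powi B))"
  have monz: "mon z a = of_real (t powi w a)" for a
    using t unfolding z_def w_def by (intro mon_power_int) auto
  show ?thesis
  proof (intro exI[of _ z] conjI)
    show "fst z \<noteq> 0" "snd z \<noteq> 0" using t by (auto simp: z_def)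
    show "unisolvent d (p(i := z)) (insert i I) D" unfolding unisolvent_def
    proof (intro allI impI)
      fix f assume f: "\<forall>j\<in>insert i I. \<forall>P. polyfun exponents d P \<longrightarrow> (\<Sum>a\<in>D. f a * (P a * mon ((p(i := z)) j) a)) = 0"
      define S where "S = (\<Sum>b\<in>D. cmod (f b))"
      have S0: "S \<ge> 0" by (auto simp: S_def sum_nonneg)
      \<comment> \<open>In the condition given by \<open>P a\<close> at the new point, the term of
        \<open>a\<close> has coefficient \<open>f a\<close> times t^(w a), while the exponents that
        survive besides it have integral weight less than \<open>w a\<close> and lose a factor of at
        least t.\<close>
      have 1: "cmod (f a) \<le> C / t * S" if a: "a \<in> D - D'" for a
      proof -
        have "(\<Sum>b\<in>D. f b * (P a b * of_real (t powi w b))) = 0"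
          using f P(1)[OF a] monz by simp
        then have "f a * of_real (t powi w a) = - (\<Sum>b\<in>D-{a}. f b * (P a b * of_real (t powi w b)))"
          using a D P(2)[OF a] by (simp add: sum.remove[of D a] eq_neg_iff_add_eq_0)
        then have "cmod (f a * of_real (t powi w a)) = cmod (\<Sum>b\<in>D-{a}. f b * (P a b * of_real (t powi w b)))"
          by (simp only: norm_minus_cancel)
        then have "cmod (f a) * t powi w a = cmod (\<Sum>b\<in>D-{a}. f b * (P a b * of_real (t powi w b)))"
          using t by (simp add: norm_mult del: of_real_power_int)
        also have "\<dots> \<le> (\<Sum>b\<in>D-{a}. cmod (f b) * (C / t * t powi w a))"
        proof (rule sum_norm_le)
          fix b assume b: "b \<in> D - {a}"
          show "cmod (f b * (P a b * of_real (t powi w b))) \<le> cmod (f b) * (C / t * t powi w a)"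
          proof (cases "w a \<le> w b")
            case True
            then show ?thesis using P(3)[OF a, of b] b C0 t by simp
          next
            case False
            then have "t powi w b \<le> t powi (w a - 1)" using t by (intro power_int_increasing) auto
            also have "\<dots> = t powi w a / t" using t by (simp add: power_int_diff)
            finally have "cmod (P a b) * t powi w b \<le> C * (t powi w a / t)"
              using C(1)[of a b] C0 a b t by (intro mult_mono) auto
            then have "cmod (f b) * (cmod (P a b) * t powi w b) \<le> cmod (f b) * (C * (t powi w a / t))"
              by (rule mult_left_mono) simp
            then show ?thesis using t by (simp add: norm_mult del: of_real_power_int)
          qed
        qed
        also have "\<dots> \<le> (\<Sum>b\<in>D. cmod (f b) * (C / t * t powi w a))"
          using D C0 t by (intro sum_mono2) auto
        also have "\<dots> = S * (C / t * t powi w a)" by (simp only: S_def sum_distrib_right)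
        also have "\<dots> = C / t * S * t powi w a" by (simp only: mult_ac)
        finally show ?thesis by (rule mult_right_le_imp_le) (use t in simp)
      qed
      have "(\<Sum>b\<in>D. f b * g b) = 0" if gL: "g \<in> L" for g
      proof -
        obtain Q where Q: "\<forall>j. polyfun exponents d (Q j)" "g = (\<lambda>a. \<Sum>j\<in>I. Q j a * mon (p j) a)"
          using gL unfolding L_def by blast
        have "(\<Sum>b\<in>D. f b * g b) = (\<Sum>j\<in>I. \<Sum>b\<in>D. f b * (Q j b * mon (p j) b))"
          unfolding Q(2) sum_distrib_left by (rule sum.swap)
        also have "\<dots> = 0"
        proof (rule sum.neutral, intro ballI)
          fix j assume "j \<in> I"
          then show "(\<Sum>b\<in>D. f b * (Q j b * mon (p j) b)) = 0" using f Q(1) I by (auto split: if_splits)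
        qed
        finally show ?thesis .
      qed note orth = this
      \<comment> \<open>The conditions at the old points express the coefficients on
        \<open>D'\<close> by those on the eaten exponents, which 1 has already bounded.\<close>
      have 2: "cmod (f a) \<le> C' * N * (C / t) * S" if a: "a \<in> D'" for a
      proof -
        have "(\<Sum>b\<in>D'. f b * G a b) = (\<Sum>b\<in>D'. if b = a then f b else 0)"
          using G(2)[OF a] by (intro sum.cong) auto
        also have "\<dots> = f a" using a D sub finite_subset by (subst sum.delta) auto
        finally have "f a + (\<Sum>b\<in>D-D'. f b * G a b) = 0"
          using orth[OF G(1)[OF a]] sum.subset_diff[OF sub D, of "\<lambda>b. f b * G a b"] by (simp add: add.commute)
        then have "cmod (f a) = cmod (\<Sum>b\<in>D-D'. f b * G a b)"
          by (metis add_eq_0_iff norm_minus_cancel)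
        also have "\<dots> \<le> (\<Sum>b\<in>D-D'. C / t * S * C')"
        proof (rule sum_norm_le)
          fix b assume b: "b \<in> D - D'"
          have "cmod (f b) * cmod (G a b) \<le> C / t * S * C'"
            using 1[OF b] C(2)[of a b] a b sub C0 t S0 by (intro mult_mono) auto
          then show "cmod (f b * G a b) \<le> C / t * S * C'" by (simp add: norm_mult)
        qed
        also have "\<dots> \<le> (\<Sum>b\<in>D. C / t * S * C')" using D C0 t S0 by (intro sum_mono2) auto
        also have "\<dots> = C' * N * (C / t) * S" by (simp add: N_def)
        finally show ?thesis .
      qed
      have "S \<le> (\<Sum>b\<in>D. C / t * S + C' * N * (C / t) * S)"
        unfolding S_def
      proof (rule sum_mono, fold S_def)
        fix b assume b: "b \<in> D"
        have "C / t * S \<ge> 0" "C' * N * (C / t) * S \<ge> 0" using C0 t S0 by (auto simp: N_def)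
        then show "cmod (f b) \<le> C / t * S + C' * N * (C / t) * S" using 1[of b] 2[of b] b by (cases "b \<in> D'") auto
      qed
      also have "\<dots> = (N * C + N * (C' * N * C)) / t * S" by (simp add: N_def field_simps flip: add_divide_distrib)
      finally have "S * t \<le> (N * C + N * (C' * N * C)) * S" using t by (simp add: field_simps)
      then have "S = 0" using t S0 by (metis less_eq_real_def mult.commute mult_less_cancel_left_pos not_less)
      then show "\<forall>a\<in>D. f a = 0" using D by (simp add: S_def sum_nonneg_eq_0_iff)
    qed
  qed
qed

inductive eaten :: "nat \<Rightarrow> nat \<Rightarrow> (nat \<times> nat) set \<Rightarrow> bool" for d where
  empty: "eaten d 0 {}"
| step: "eats d D D' \<Longrightarrow> eaten d n D' \<Longrightarrow> eaten d (Suc n) D"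

text \<open>The point that eats first is placed last: how large its t must be depends on the points
  that dispose of the rest.\<close>

lemma eaten_unisolvent:
  assumes "eaten d n D" "finite D" "distinct is" "length is = n"
  shows "\<exists>p :: 'i \<Rightarrow> complex \<times> complex.
    (\<forall>i\<in>set is. fst (p i) \<noteq> 0 \<and> snd (p i) \<noteq> 0) \<and> unisolvent d p (set is) D"
  using assms
proof (induction arbitrary: "is" rule: eaten.induct)
  case empty
  then show ?case by (auto simp: unisolvent_def)
next
  case (step D D' n)
  then obtain i js where js: "is = i # js" by (cases "is") auto
  have fin: "finite D'" using step by (auto simp: eats_def intro: finite_subset)
  obtain p :: "'i \<Rightarrow> complex \<times> complex" where p: "\<forall>i\<in>set js. fst (p i) \<noteq> 0 \<and> snd (p i) \<noteq> 0" "unisolvent d p (set js) D'"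
    using step.IH[of js] step.prems js fin by auto
  obtain z where z: "fst z \<noteq> 0" "snd z \<noteq> 0" "unisolvent d (p(i := z)) (insert i (set js)) D"
    using unisolvent_degeneration[OF step.prems(1) step.hyps(1) p(2), of i] step.prems js by auto
  show ?case
  proof (intro exI[of _ "p(i := z)"] conjI)
    show "unisolvent d (p(i := z)) (set is) D" using z(3) js by simp
  qed (use z p(1) js in auto)
qed

section \<open>Interpolation by products of lines\<close>

definition interpolating :: "nat \<Rightarrow> (nat \<times> nat) set \<Rightarrow> bool" where
  "interpolating d S \<longleftrightarrow> (\<forall>g. \<exists>P. polyfun exponents d P \<and> (\<forall>a\<in>S. P a = g a))"

lemma separating_linform:
  assumes "a \<noteq> b"
  shows "\<exists>A B. linform A B a \<noteq> linform A B b"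
proof (cases "fst a = fst b")
  case True
  with assms have "linform 0 1 a \<noteq> linform 0 1 b" by (auto simp: linform_def prod_eq_iff)
  then show ?thesis by blast
next
  case False
  then have "linform 1 0 a \<noteq> linform 1 0 b" by (auto simp: linform_def)
  then show ?thesis by blast
qed

text \<open>Newton interpolation: the new point is reached by a product of at most \<open>d\<close>
  lines, one through each earlier point and none through the new one.\<close>

lemma interpolating_small:
  assumes "finite S" "card S \<le> Suc d"
  shows "interpolating d S"
  using assms
proof (induction S rule: finite_induct)
  case empty
  then show ?case by (auto simp: interpolating_def intro: polyfun.const)
next
  case (insert a S)
  have "\<forall>b\<in>S. \<exists>A B. linform A B a \<noteq> linform A B b" using insert.hyps separating_linform by metis
  then obtain A B where AB: "\<And>b. b \<in> S \<Longrightarrow> linform (A b) (B b) a \<noteq> linform (A b) (B b) b" by metis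
  define Z where "Z = (\<lambda>x. \<Prod>b\<in>S. complex_of_int (linform (A b) (B b) x - linform (A b) (B b) b))"
  have Z: "polyfun exponents d Z" unfolding Z_def using insert.hyps insert.prems
    by (intro polyfun_mono[OF polyfun_prod_linform]) auto
  have Z0: "Z b = 0" if "b \<in> S" for b using that insert.hyps by (auto simp: Z_def intro!: prod_zero)
  have Za: "Z a \<noteq> 0" using AB insert.hyps by (auto simp: Z_def)
  show ?case unfolding interpolating_def
  proof
    fix g
    obtain P where P: "polyfun exponents d P" "\<forall>b\<in>S. P b = g b"
      using insert by (auto simp: interpolating_def)
    have "polyfun exponents d (\<lambda>x. P x + (g a - P a) / Z a * Z x)"
      using polyfun.add[OF P(1) polyfun_scale[OF Z]] .
    then show "\<exists>P. polyfun exponents d P \<and> (\<forall>b\<in>insert a S. P b = g b)"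
      using P(2) Z0 Za by (intro exI conjI) auto
  qed
qed

text \<open>Here \<open>k\<close> is the degree plus one: a polynomial of degree
  \<open>k - 1\<close> can take arbitrary values at \<open>k\<close> points, and each line that is
  split off lowers the degree by one. At most k (k + 1) / 2 points can be exhausted, the dimension
  of the space of these polynomials.\<close>

fun peels :: "nat \<Rightarrow> (int \<times> int \<times> int) list \<Rightarrow> (nat \<times> nat) list \<Rightarrow> bool" where
  "peels k [] S \<longleftrightarrow> S = []"
| "peels k ((A, B, C) # ls) S \<longleftrightarrow> 0 < k \<and> length (filter (\<lambda>a. linform A B a = C) S) \<le> k \<and>
     peels (k - 1) ls (filter (\<lambda>a. linform A B a \<noteq> C) S)"

text \<open>Prescribe the values on the line first and then correct those off the line by the
  equation of the line times a polynomial of degree one less.\<close>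

lemma peels_interpolating: "peels (Suc d) ls S \<Longrightarrow> interpolating d (set S)"
proof (induction ls arbitrary: d S)
  case Nil
  then show ?case by (auto simp: interpolating_def intro: polyfun.const)
next
  case (Cons l ls)
  obtain A B C where l: "l = (A, B, C)" by (cases l)
  let ?on = "set (filter (\<lambda>a. linform A B a = C) S)" and ?off = "filter (\<lambda>a. linform A B a \<noteq> C) S"
  have on: "interpolating d ?on"
    using Cons.prems l by (intro interpolating_small order_trans[OF card_length]) simp_all
  have rest: "peels d ls ?off" using Cons.prems l by simp
  show ?case unfolding interpolating_def
  proof
    fix g
    obtain P where P: "polyfun exponents d P" "\<forall>a\<in>?on. P a = g a" using on unfolding interpolating_def by blast
    show "\<exists>P. polyfun exponents d P \<and> (\<forall>a\<in>set S. P a = g a)"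
    proof (cases d)
      case 0
      \<comment> \<open>With no degree left, \<open>peels 0\<close> accepts only the empty
        list.\<close>
      then have "?off = []" using rest by (cases ls) auto
      then have "set S = ?on" by (auto simp: filter_empty_conv)
      then show ?thesis using P by metis
    next
      case (Suc e)
      have "interpolating e (set ?off)" using Cons.IH[of e ?off] rest Suc by simp
      from this[unfolded interpolating_def, THEN spec, of "\<lambda>a. (g a - P a) / of_int (linform A B a - C)"]
      obtain R where R: "polyfun exponents e R"
        "\<forall>a\<in>set ?off. R a = (g a - P a) / of_int (linform A B a - C)" by blast
      have "polyfun exponents d (\<lambda>a. P a + of_int (linform A B a - C) * R a)"
        using polyfun.add[OF P(1)] polyfun_times[OF polyfun_linform R(1)] Suc by simp
      moreover have "P a + of_int (linform A B a - C) * R a = g a" if "a \<in> set S" for a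
        using that bspec[OF P(2), of a] bspec[OF R(2), of a] by (cases "linform A B a = C") simp_all
      ultimately show ?thesis by blast
    qed
  qed
qed

text \<open>An entry \<open>((A, B, C), ls)\<close> cuts off the half-plane \<open>A x + B y \<ge> C\<close>; the piece is exhausted
  by the lines \<open>A' x + B' y = C'\<close> in \<open>ls\<close>, the \<open>j\<close>-th of which (counted from \<open>0\<close>) contains at most
  \<open>k - j\<close> of the points left.\<close>

fun cuts :: "nat \<Rightarrow> ((int \<times> int \<times> int) \<times> (int \<times> int \<times> int) list) list \<Rightarrow> (nat \<times> nat) list \<Rightarrow> bool" where
  "cuts k [] S \<longleftrightarrow> S = []"
| "cuts k (((A, B, C), ls) # ops) S \<longleftrightarrow> peels k ls (filter (\<lambda>a. C \<le> linform A B a) S) \<and>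
     cuts k ops (filter (\<lambda>a. linform A B a < C) S)"

text \<open>All exponents at least as heavy as one in the half-plane lie in the half-plane too.
  Since arbitrary values can be interpolated there, the indicator function of \<open>a\<close>
  serves as its separating curve, whatever the order inside the piece.\<close>

lemma cuts_eaten: "cuts (Suc d) ops S \<Longrightarrow> eaten d (length ops) (set S)"
proof (induction ops arbitrary: S)
  case Nil
  then show ?case by (auto intro: eaten.empty)
next
  case (Cons x ops)
  obtain A B C ls where x: "x = ((A, B, C), ls)" by (metis prod_cases3 surj_pair)
  let ?D = "set (filter (\<lambda>a. C \<le> linform A B a) S)" and ?D' = "set (filter (\<lambda>a. linform A B a < C) S)"
  have int: "interpolating d ?D" using Cons.prems x peels_interpolating[of d ls "filter (\<lambda>a. C \<le> linform A B a) S"] by simp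
  have "eats d (set S) ?D'" unfolding eats_def
  proof (rule conjI, goal_cases)
    case 2
    show ?case
    proof (rule exI[of _ A], rule exI[of _ B], rule ballI)
    fix a assume a: "a \<in> set S - ?D'"
    obtain P where P: "polyfun exponents d P" "\<forall>b\<in>?D. P b = (if b = a then 1 else 0)"
      using int[unfolded interpolating_def, THEN spec, of "\<lambda>b. if b = a then 1 else 0"] by blast
    have "P b = (if b = a then 1 else 0)" if "b \<in> set S" "C \<le> linform A B b" for b
      using bspec[OF P(2), of b] that by simp
    moreover have "a \<in> set S" "C \<le> linform A B a" using a by (simp_all add: not_less)
    ultimately show "\<exists>P. polyfun exponents d P \<and> P a \<noteq> 0 \<and>
        (\<forall>b\<in>set S. b \<noteq> a \<longrightarrow> linform A B a \<le> linform A B b \<longrightarrow> P b = 0)"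
      using P(1) by (intro exI[of _ P] conjI ballI impI) simp_all
    qed
  qed auto
  from eaten.step[OF this Cons.IH] show ?case using Cons.prems x by simp
qed

lemma of_int_linform: "real_of_int (linform A B a) = of_int A * real (fst a) + of_int B * real (snd a)"
  by (simp add: linform_def)

text \<open>Points are ordered by columns \<open>u\<close> and inside a column by \<open>v\<close>.  The separating curve of \<open>a\<close>
  consists of the earlier columns and of the lines \<open>v = const\<close> through earlier positions in the
  column of \<open>a\<close>; the lower boundary of \<open>D\<close> is given by the edges \<open>v = m u + e\<close>.\<close>

lemma eats_columns:
  fixes u v :: "nat \<times> nat \<Rightarrow> int" and c :: real and es :: "(real \<times> real) list"
  assumes "finite D" and u: "u = linform u1 u2" and v: "v = linform v1 v2" and det: "u1 * v2 - u2 * v1 \<noteq> 0"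
    and c: "\<And>b. b \<in> D \<Longrightarrow> c \<le> u b"
    and edges: "\<And>(m::real) (e::real) b. (m, e) \<in> set es \<Longrightarrow> b \<in> D \<Longrightarrow> m * u b + e \<le> v b"
    and D': "D' = {a \<in> D. \<forall>(m, e)\<in>set es. Suc d \<le> (u a - c) + (v a - (m * u a + e))}"
  shows "eats d D D'"
proof -
  \<comment> \<open>Larger than any difference of values of \<open>v\<close>, so that the weight
    \<open>- (M * u + v)\<close> orders lexicographically: smaller \<open>u\<close> is heavier, and
    for equal \<open>u\<close> smaller \<open>v\<close> is heavier.\<close>
  define M where "M = 1 + 2 * (\<Sum>b\<in>D. \<bar>v b\<bar>)"
  have bound: "v a - v b < M" if "a \<in> D" "b \<in> D" for a b
  proof -
    have "\<bar>v a\<bar> \<le> (\<Sum>b\<in>D. \<bar>v b\<bar>)" "\<bar>v b\<bar> \<le> (\<Sum>b\<in>D. \<bar>v b\<bar>)"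
      using that \<open>finite D\<close> by (auto intro!: member_le_sum[of _ D "\<lambda>b. \<bar>v b\<bar>"])
    then show ?thesis unfolding M_def by linarith
  qed
  define A where "A = - (M * u1 + v1)"
  define B where "B = - (M * u2 + v2)"
  have AB: "linform A B a = - (M * u a + v a)" for a
    by (simp add: A_def B_def u v linform_def algebra_simps)
  have M: "M > 0" unfolding M_def by (simp add: add_pos_nonneg sum_nonneg)
  show ?thesis unfolding eats_def
  proof (rule conjI, goal_cases)
    case 2
    show ?case
    proof (rule exI[of _ A], rule exI[of _ B], rule ballI)
    fix a assume a: "a \<in> D - D'"
    then obtain m e :: real where me: "(m, e) \<in> set es" "(u a - c) + (v a - (m * u a + e)) < Suc d"
      unfolding D' by (auto simp: not_le)
    \<comment> \<open>The first integral column and the first integral position in the column of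
      \<open>a\<close>. Rounding up can only lower the number of factors of \<open>P\<close>, so the
      real inequality for the edge still bounds its degree by \<open>d\<close>.\<close>
    define c' where "c' = \<lceil>c\<rceil>"
    define e' where "e' = \<lceil>m * u a + e\<rceil>"
    define P where "P = (\<lambda>x. (\<Prod>i\<in>{c'..<u a}. complex_of_int (linform u1 u2 x - i)) * (\<Prod>j\<in>{e'..<v a}. complex_of_int (linform v1 v2 x - j)))"
    have c'u: "c' \<le> u b" if "b \<in> D" for b using c[OF that] by (simp add: c'_def ceiling_le_iff)
    have e'v: "e' \<le> v b" if "b \<in> D" "u b = u a" for b using edges[OF me(1) that(1)] that(2) by (simp add: e'_def ceiling_le_iff)
    have "real_of_int ((u a - c') + (v a - e')) < Suc d"
      using me(2) le_of_int_ceiling[of c, folded c'_def] le_of_int_ceiling[of "m * u a + e", folded e'_def]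
      unfolding of_int_add of_int_diff by linarith
    then have "nat (u a - c') + nat (v a - e') \<le> d"
      using c'u[of a] e'v[of a] a by (simp flip: of_int_less_iff)
    moreover have "polyfun exponents (card {c'..<u a} + card {e'..<v a}) P" unfolding P_def
      by (intro polyfun_times polyfun_prod_linform) auto
    ultimately have "polyfun exponents d P" by (auto intro: polyfun_mono)
    moreover have "P a \<noteq> 0" by (auto simp: P_def u v)
    moreover have "P b = 0" if b: "b \<in> D" "b \<noteq> a" "linform A B a \<le> linform A B b" for b
    proof -
      have le: "M * u b + v b \<le> M * u a + v a" using b(3) AB by simp
      have "u b < u a \<or> u b = u a \<and> v b < v a"
      proof (cases "u b" "u a" rule: linorder_cases)
        case equal
        have "v b \<noteq> v a"
        proof
          assume "v b = v a"
          then have 1: "u1 * (int (fst b) - int (fst a)) + u2 * (int (snd b) - int (snd a)) = 0"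
            "v1 * (int (fst b) - int (fst a)) + v2 * (int (snd b) - int (snd a)) = 0"
            using equal by (simp_all add: u v linform_def algebra_simps)
          have "(u1 * v2 - u2 * v1) * (int (fst b) - int (fst a)) = 0" "(u1 * v2 - u2 * v1) * (int (snd b) - int (snd a)) = 0"
            using 1 by algebra+
          then show False using det b(2) by (auto simp: prod_eq_iff)
        qed
        then show ?thesis using equal le by simp
      next
        case greater
        then have "M * (u a + 1) \<le> M * u b" using M by (intro mult_left_mono) auto
        then show ?thesis using le bound[of a b] a b(1) by (simp add: algebra_simps)
      qed auto
      then show ?thesis using c'u[OF b(1)] e'v[OF b(1)] by (auto simp: P_def u v intro!: prod_zero)
    qed
    ultimately show "\<exists>P. polyfun exponents d P \<and> P a \<noteq> 0 \<and>
        (\<forall>b\<in>D. b \<noteq> a \<longrightarrow> linform A B a \<le> linform A B b \<longrightarrow> P b = 0)" by blast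
    qed
  qed (auto simp: D')
qed


lemma cuts_grid_eaten:
  assumes "cuts (Suc d) ops (filter (\<lambda>a. a \<notin> set E) (List.product [0..<n] [0..<n]))"
    and "length ops = m"
  shows "eaten d m ({..<n} \<times> {..<n} - set E)"
proof -
  have "set (filter (\<lambda>a. a \<notin> set E) (List.product [0..<n] [0..<n])) = {..<n} \<times> {..<n} - set E"
    by auto
  then show ?thesis using cuts_eaten[OF assms(1)] assms(2) by simp
qed

section \<open>Explicit decompositions of the grids\<close>

text \<open>For d = 0 every point eats one of the nine monomials of bidegree at most (2, 2). Thus no
  such curve passes through nine general points of the quadric, which is the source of the
  uniqueness of Q and of its smoothness at the points.\<close>

lemma eaten_quadrics: "eaten 0 9 ({..<3} \<times> {..<3} - set [])"
proof -
  have "cuts (Suc 0)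
    [((1, -1, 2), [(1, 0, 2)]),
     ((1, 1, 4), [(1, 0, 2)]),
     ((-1, -1, 0), [(1, 0, 0)]),
     ((0, -1, 0), [(1, 0, 1)]),
     ((1, 2, 5), [(1, 0, 1)]),
     ((1, -1, 1), [(1, 0, 2)]),
     ((-1, 1, 2), [(1, 0, 0)]),
     ((1, -1, 0), [(1, 0, 1)]),
     ((-1, -1, -1), [(1, 0, 0)])]
    (filter (\<lambda>a. a \<notin> set []) (List.product [0..<3] [0..<3]))"
    by code_simp
  then show ?thesis by (rule cuts_grid_eaten) simp
qed

text \<open>The listed exponents are the ones left over. Here and up to \<open>eaten_7\<close> their
  number is the expected dimension (8 - m)(m + 1) / 2 for m = d + 1, so each of the nine pieces has
  the maximal size m (m + 1) / 2.\<close>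

lemma eaten_1: "eaten 0 9 ({..<4} \<times> {..<4} - set [(0, 2), (1, 1), (1, 2), (2, 1), (2, 2), (3, 1), (3, 2)])"
proof -
  have "cuts (Suc 0)
    [((1, -1, 3), [(1, 0, 3)]),
     ((1, 1, 6), [(1, 0, 3)]),
     ((-1, -1, 0), [(1, 0, 0)]),
     ((-1, -2, -1), [(1, 0, 1)]),
     ((1, 2, 8), [(1, 0, 2)]),
     ((0, -1, 0), [(1, 0, 2)]),
     ((-1, 1, 3), [(1, 0, 0)]),
     ((0, 1, 3), [(1, 0, 1)]),
     ((-1, -1, -1), [(1, 0, 0)])]
    (filter (\<lambda>a. a \<notin> set [(0, 2), (1, 1), (1, 2), (2, 1), (2, 2), (3, 1), (3, 2)]) (List.product [0..<4] [0..<4]))"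
    by code_simp
  then show ?thesis by (rule cuts_grid_eaten) simp
qed

lemma eaten_2: "eaten 1 9 ({..<6} \<times> {..<6} - set [(1, 3), (2, 2), (2, 3), (3, 1), (3, 2), (3, 3), (4, 2), (4, 3), (5, 2)])"
proof -
  have "cuts (Suc 1)
    [((1, -1, 4), [(0, 1, 0), (1, 0, 5)]),
     ((-1, 1, 4), [(1, 0, 0), (1, 0, 1)]),
     ((1, 1, 9), [(1, 0, 5), (1, 0, 4)]),
     ((-1, -1, -1), [(0, 1, 0), (1, 0, 0)]),
     ((-2, 1, 2), [(1, 0, 0), (1, 0, 1)]),
     ((1, -2, 2), [(0, 1, 0), (1, 0, 4)]),
     ((-1, 2, 6), [(0, 1, 5), (1, 0, 2)]),
     ((1, 2, 11), [(0, 1, 4), (1, 0, 5)]),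
     ((-1, -1, -3), [(1, 0, 1), (1, 0, 2)])]
    (filter (\<lambda>a. a \<notin> set [(1, 3), (2, 2), (2, 3), (3, 1), (3, 2), (3, 3), (4, 2), (4, 3), (5, 2)]) (List.product [0..<6] [0..<6]))"
    by code_simp
  then show ?thesis by (rule cuts_grid_eaten) simp
qed

lemma eaten_3: "eaten 2 9 ({..<8} \<times> {..<8} - set [(1, 2), (1, 3), (2, 1), (2, 2), (2, 3), (3, 2), (3, 3), (3, 4), (4, 2), (4, 3)])"
proof -
  have "cuts (Suc 2)
    [((1, -1, 5), [(0, 1, 0), (0, 1, 1), (1, 0, 7)]),
     ((-1, 1, 5), [(1, 0, 0), (1, 0, 1), (1, 0, 2)]),
     ((1, 1, 12), [(1, 0, 7), (1, 0, 6), (1, 0, 5)]),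
     ((-1, 3, 14), [(1, -1, -4), (1, -1, -3), (1, 0, 4)]),
     ((-3, 4, 10), [(0, 1, 4), (1, -1, -3), (1, 0, 3)]),
     ((1, 2, 14), [(1, 1, 11), (1, 1, 10), (1, 0, 4)]),
     ((-1, -1, -2), [(1, 0, 0), (1, 0, 1), (1, 0, 2)]),
     ((1, 1, 8), [(0, 1, 3), (0, 1, 4), (1, 0, 6)]),
     ((1, -2, 1), [(0, 1, 1), (0, 1, 0), (1, 0, 5)])]
    (filter (\<lambda>a. a \<notin> set [(1, 2), (1, 3), (2, 1), (2, 2), (2, 3), (3, 2), (3, 3), (3, 4), (4, 2), (4, 3)]) (List.product [0..<8] [0..<8]))"
    by code_simp
  then show ?thesis by (rule cuts_grid_eaten) simp
qed

lemma eaten_4: "eaten 3 9 ({..<10} \<times> {..<10} - set [(5, 4), (5, 5), (6, 3), (6, 4), (6, 5), (7, 2), (7, 3), (7, 4), (8, 3), (8, 4)])"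
proof -
  have "cuts (Suc 3)
    [((1, -1, 6), [(1, 0, 9), (0, 1, 0), (0, 1, 1), (1, 0, 8)]),
     ((-1, 1, 6), [(0, 1, 9), (1, 0, 0), (1, 0, 1), (1, 0, 2)]),
     ((1, 1, 15), [(0, 1, 9), (1, 0, 9), (1, 0, 8), (1, 0, 7)]),
     ((-1, 3, 17), [(1, -1, -5), (1, -1, -4), (0, 1, 8), (1, 0, 4)]),
     ((-3, 4, 12), [(1, -1, -3), (1, -1, -4), (2, -5, -25), (1, 0, 4)]),
     ((1, 2, 17), [(0, 1, 6), (1, 1, 13), (1, 1, 14), (1, 0, 7)]),
     ((-3, -2, -9), [(0, 1, 0), (0, 1, 1), (0, 1, 2), (1, 0, 1)]),
     ((-1, -2, -8), [(0, 1, 1), (1, 1, 5), (1, 1, 4), (1, 0, 4)]),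
     ((-3, -2, -22), [(1, 1, 8), (1, 1, 7), (1, 1, 6), (1, 0, 4)])]
    (filter (\<lambda>a. a \<notin> set [(5, 4), (5, 5), (6, 3), (6, 4), (6, 5), (7, 2), (7, 3), (7, 4), (8, 3), (8, 4)]) (List.product [0..<10] [0..<10]))"
    by code_simp
  then show ?thesis by (rule cuts_grid_eaten) simp
qed

lemma eaten_5: "eaten 4 9 ({..<12} \<times> {..<12} - set [(4, 7), (4, 8), (4, 9), (5, 7), (5, 8), (5, 9), (6, 6), (6, 7), (7, 5)])"
proof -
  have "cuts (Suc 4)
    [((1, -1, 7), [(1, 0, 11), (1, 0, 10), (0, 1, 0), (0, 1, 1), (1, 0, 9)]),
     ((-1, 1, 7), [(0, 1, 11), (0, 1, 10), (1, 0, 0), (1, 0, 1), (1, 0, 2)]),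
     ((1, 1, 18), [(0, 1, 11), (0, 1, 10), (1, 0, 11), (1, 0, 10), (1, 0, 9)]),
     ((-2, 1, 2), [(1, -1, -6), (1, -1, -5), (1, 0, 0), (1, 0, 1), (1, 0, 2)]),
     ((1, -2, 2), [(1, -1, 6), (1, -1, 5), (0, 1, 0), (0, 1, 1), (1, 0, 6)]),
     ((-2, -3, -16), [(0, 1, 2), (0, 1, 1), (0, 1, 3), (0, 1, 0), (1, 0, 2)]),
     ((3, -2, 12), [(1, -1, 3), (1, -1, 4), (1, -1, 5), (1, 1, 16), (1, 0, 8)]),
     ((-2, -3, -28), [(0, 1, 5), (0, 1, 4), (0, 1, 6), (0, 1, 3), (1, 0, 3)]),
     ((2, 1, 20), [(1, 0, 7), (1, 0, 6), (1, 0, 8), (3, 4, 59), (1, 0, 5)])]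
    (filter (\<lambda>a. a \<notin> set [(4, 7), (4, 8), (4, 9), (5, 7), (5, 8), (5, 9), (6, 6), (6, 7), (7, 5)]) (List.product [0..<12] [0..<12]))"
    by code_simp
  then show ?thesis by (rule cuts_grid_eaten) simp
qed

lemma eaten_6: "eaten 5 9 ({..<14} \<times> {..<14} - set [(2, 5), (2, 6), (3, 6), (4, 6), (4, 7), (5, 7), (6, 7)])"
proof -
  have "cuts (Suc 5)
    [((-1, -1, -5), [(0, 1, 0), (0, 1, 1), (0, 1, 2), (1, 0, 0), (1, 0, 1), (1, 0, 2)]),
     ((-1, -2, -11), [(1, 1, 6), (1, 1, 7), (1, 1, 8), (0, 1, 0), (0, 1, 1), (1, 0, 7)]),
     ((1, -2, 3), [(1, 0, 13), (1, 0, 12), (1, 0, 11), (1, 0, 10), (0, 1, 2), (1, 0, 9)]),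
     ((1, 1, 21), [(0, 1, 13), (0, 1, 12), (0, 1, 11), (1, 0, 13), (1, 0, 12), (1, 0, 11)]),
     ((3, -1, 21), [(1, 0, 10), (1, 0, 11), (1, 0, 12), (1, 0, 9), (1, 0, 13), (1, 0, 8)]),
     ((1, -2, -7), [(0, 1, 5), (0, 1, 4), (0, 1, 6), (0, 1, 7), (0, 1, 3), (1, 0, 9)]),
     ((-1, 1, 8), [(1, 0, 0), (1, 0, 1), (1, 0, 2), (0, 1, 13), (0, 1, 12), (1, 0, 3)]),
     ((3, 2, 37), [(1, 0, 7), (1, 0, 8), (1, 0, 6), (1, 0, 9), (2, 5, 70), (1, 0, 5)]),
     ((-2, 5, 28), [(0, 1, 8), (0, 1, 9), (0, 1, 7), (0, 1, 10), (5, -4, -24), (1, 0, 1)])]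
    (filter (\<lambda>a. a \<notin> set [(2, 5), (2, 6), (3, 6), (4, 6), (4, 7), (5, 7), (6, 7)]) (List.product [0..<14] [0..<14]))"
    by code_simp
  then show ?thesis by (rule cuts_grid_eaten) simp
qed

lemma eaten_7: "eaten 6 9 ({..<16} \<times> {..<16} - set [(4, 8), (6, 7), (7, 6), (9, 5)])"
proof -
  have "cuts (Suc 6)
    [((1, 1, 24), [(1, 0, 15), (1, 0, 14), (1, 0, 13), (1, 0, 12), (0, 1, 15), (0, 1, 14), (1, 0, 11)]),
     ((-1, -1, -6), [(0, 1, 0), (0, 1, 1), (0, 1, 2), (0, 1, 3), (1, 0, 0), (1, 0, 1), (1, 0, 2)]),
     ((1, 2, 32), [(0, 1, 15), (0, 1, 14), (0, 1, 13), (0, 1, 12), (1, 1, 23), (1, 1, 22), (1, 0, 10)]),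
     ((-1, -2, -13), [(1, 1, 7), (1, 1, 8), (1, 1, 9), (1, 1, 10), (0, 1, 0), (0, 1, 1), (1, 0, 9)]),
     ((3, 2, 48), [(1, 1, 20), (1, 1, 19), (1, 0, 15), (1, 0, 14), (1, 0, 13), (1, 1, 21), (1, 0, 12)]),
     ((8, 1, 82), [(1, 0, 10), (1, 0, 11), (1, 0, 12), (1, 0, 13), (1, 0, 14), (1, 0, 15), (1, 0, 9)]),
     ((-1, 2, 18), [(1, 0, 0), (1, 0, 1), (1, 0, 2), (1, 0, 3), (1, 0, 4), (1, 0, 5), (1, 0, 6)]),
     ((3, 5, 54), [(0, 1, 9), (0, 1, 10), (0, 1, 8), (0, 1, 11), (0, 1, 7), (3, 1, 33), (1, 0, 8)]),
     ((-2, -3, -31), [(1, 1, 11), (1, 1, 10), (1, 1, 12), (1, 1, 9), (1, 1, 8), (1, 3, 21), (1, 0, 8)])]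
    (filter (\<lambda>a. a \<notin> set [(4, 8), (6, 7), (7, 6), (9, 5)]) (List.product [0..<16] [0..<16]))"
    by code_simp
  then show ?thesis by (rule cuts_grid_eaten) simp
qed

text \<open>The balanced case: 18^2 = 324 = 9 * 36. Nothing is left over and no piece may be smaller
  than 36, the number of monomials of degree at most 7 in two variables.\<close>

lemma eaten_8: "eaten 7 9 ({..<18} \<times> {..<18} - set [])"
proof -
  have "cuts (Suc 7)
    [((1, 1, 27), [(1, 0, 17), (1, 0, 16), (1, 0, 15), (1, 0, 14), (1, 0, 13), (0, 1, 17), (0, 1, 16), (1, 0, 12)]),
     ((-1, -1, -7), [(0, 1, 0), (0, 1, 1), (0, 1, 2), (0, 1, 3), (0, 1, 4), (1, 0, 0), (1, 0, 1), (1, 0, 2)]),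
     ((-2, -1, -15), [(1, 0, 0), (1, 0, 1), (1, 0, 2), (1, 0, 3), (1, 0, 4), (1, 1, 8), (1, 1, 9), (1, 0, 5)]),
     ((1, 2, 36), [(0, 1, 17), (0, 1, 16), (0, 1, 15), (0, 1, 14), (0, 1, 13), (1, 1, 26), (1, 1, 25), (1, 0, 12)]),
     ((-2, -3, -31), [(1, 1, 12), (0, 1, 0), (0, 1, 1), (0, 1, 2), (0, 1, 3), (0, 1, 4), (1, 1, 11), (1, 0, 8)]),
     ((3, 4, 72), [(1, 2, 35), (1, 2, 34), (1, 2, 33), (1, 2, 32), (1, 2, 31), (1, 2, 30), (1, 2, 29), (1, 0, 16)]),
     ((-2, -9, -75), [(0, 1, 4), (0, 1, 5), (0, 1, 3), (0, 1, 2), (0, 1, 6), (0, 1, 1), (0, 1, 0), (1, 0, 6)]),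
     ((-31, -57, -802), [(1, 2, 26), (0, 1, 8), (0, 1, 7), (0, 1, 9), (0, 1, 10), (0, 1, 6), (1, 0, 3), (1, 0, 5)]),
     ((-1, -1, -22), [(1, 1, 18), (1, 1, 17), (1, 1, 19), (1, 1, 16), (1, 1, 20), (1, 1, 21), (9, 16, 233), (1, 0, 2)])]
    (filter (\<lambda>a. a \<notin> set []) (List.product [0..<18] [0..<18]))"
    by code_simp
  then show ?thesis by (rule cuts_grid_eaten) simp
qed

lemma eaten_9: "eaten 8 9 ({..<20} \<times> {..<20} - set [])"
proof -
  have "cuts (Suc 8)
    [((1, 1, 30), [(0, 1, 19), (0, 1, 18), (0, 1, 17), (0, 1, 16), (0, 1, 15), (0, 1, 14), (1, 0, 19), (1, 0, 18), (1, 0, 17)]),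
     ((-1, -1, -8), [(0, 1, 0), (0, 1, 1), (0, 1, 2), (0, 1, 3), (0, 1, 4), (0, 1, 5), (1, 0, 0), (1, 0, 1), (1, 0, 2)]),
     ((1, 2, 40), [(1, 1, 29), (1, 1, 28), (1, 1, 27), (1, 1, 26), (1, 1, 25), (1, 1, 24), (0, 1, 19), (0, 1, 18), (1, 0, 6)]),
     ((3, 4, 80), [(1, 2, 39), (1, 2, 38), (1, 2, 37), (1, 2, 36), (1, 2, 35), (1, 2, 34), (1, 2, 33), (1, 1, 25), (1, 0, 16)]),
     ((-2, -1, -17), [(1, 1, 9), (1, 1, 10), (1, 1, 11), (1, 1, 12), (1, 1, 13), (1, 1, 14), (1, 0, 0), (1, 0, 1), (1, 0, 2)]),
     ((-2, -3, -35), [(1, 1, 13), (0, 1, 0), (0, 1, 1), (1, 1, 14), (0, 1, 2), (0, 1, 3), (0, 1, 4), (1, 1, 12), (1, 0, 10)]),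
     ((2, -3, 6), [(0, 1, 5), (0, 1, 4), (0, 1, 6), (0, 1, 3), (0, 1, 2), (0, 1, 7), (0, 1, 1), (0, 1, 0), (1, 0, 15)]),
     ((-1, -2, -30), [(1, 1, 16), (1, 1, 17), (1, 1, 15), (0, 1, 8), (0, 1, 9), (0, 1, 10), (0, 1, 7), (1, 1, 18), (1, 0, 8)]),
     ((-1, -1, -23), [(1, 1, 20), (1, 1, 19), (1, 1, 21), (1, 1, 18), (1, 1, 22), (1, 1, 17), (1, 1, 23)])]
    (filter (\<lambda>a. a \<notin> set []) (List.product [0..<20] [0..<20]))"
    by code_simp
  then show ?thesis by (rule cuts_grid_eaten) simp
qed

lemma eaten_10: "eaten 9 9 ({..<22} \<times> {..<22} - set [])"
proof -
  have "cuts (Suc 9)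
    [((1, 1, 33), [(0, 1, 21), (0, 1, 20), (0, 1, 19), (0, 1, 18), (0, 1, 17), (0, 1, 16), (0, 1, 15), (1, 0, 21), (1, 0, 20), (1, 0, 19)]),
     ((-1, -1, -9), [(0, 1, 0), (0, 1, 1), (0, 1, 2), (0, 1, 3), (0, 1, 4), (0, 1, 5), (0, 1, 6), (1, 0, 0), (1, 0, 1), (1, 0, 2)]),
     ((1, 2, 44), [(1, 1, 32), (1, 1, 31), (1, 1, 30), (1, 1, 29), (1, 1, 28), (1, 1, 27), (1, 1, 26), (0, 1, 21), (0, 1, 20), (1, 0, 6)]),
     ((3, 4, 88), [(1, 1, 27), (1, 1, 28), (1, 2, 43), (1, 2, 42), (1, 2, 41), (1, 2, 40), (1, 2, 39), (1, 2, 38), (1, 2, 37), (1, 0, 16)]),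
     ((-1, 4, 48), [(1, 0, 0), (1, 0, 1), (1, 0, 2), (0, 1, 15), (1, 0, 3), (1, 0, 4), (1, 0, 5), (1, 0, 6), (1, 0, 7), (1, 0, 8)]),
     ((-1, -2, -19), [(1, 1, 10), (1, 1, 11), (1, 1, 12), (1, 1, 13), (1, 1, 14), (1, 1, 15), (1, 1, 16), (0, 1, 0), (0, 1, 1), (1, 0, 15)]),
     ((-1, -4, -38), [(1, 2, 20), (0, 1, 4), (1, 2, 21), (1, 2, 22), (0, 1, 5), (1, 2, 23), (1, 2, 24), (1, 2, 25), (0, 1, 3), (1, 0, 14)]),
     ((4, 7, 108), [(1, 1, 24), (1, 1, 23), (1, 1, 25), (1, 1, 22), (1, 1, 21), (1, 1, 26), (1, 1, 20), (1, 1, 19), (7, 16, 243), (1, 0, 6)]),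
     ((-1, -1, -22), [(0, 1, 10), (0, 1, 9), (0, 1, 11), (0, 1, 8), (0, 1, 12), (0, 1, 7), (0, 1, 6)])]
    (filter (\<lambda>a. a \<notin> set []) (List.product [0..<22] [0..<22]))"
    by code_simp
  then show ?thesis by (rule cuts_grid_eaten) simp
qed

text \<open>The polygons lie in the square of side \<open>23 K / 11\<close>, which contains the grid since
  \<open>2 K + 1 \<le> 23 K / 11\<close> for \<open>K \<ge> 11\<close>.  Eating by columns replaces a lower edge \<open>v \<ge> m u + e\<close> by
  \<open>v \<ge> m u + e + K - (u - c)\<close>; the sequence of directions was found by computer search.\<close>

lemma eaten_large:
  assumes "10 \<le> d"
  shows "eaten d 9 ({..<2 * d + 4} \<times> {..<2 * d + 4})"
proof -
  \<comment> \<open>A piece can have area up to K^2 / 2. Nine of them amount to 4.5 K^2, while the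
    square of side 23 K / 11 has area less than 4.38 K^2.\<close>
  define K where "K = real (Suc d)"
  have K: "K \<ge> 11" using assms by (simp add: K_def)
  define D0 :: "(nat \<times> nat) set" where "D0 = {..<2 * d + 4} \<times> {..<2 * d + 4}"
  have d0: "0 \<le> real (fst a) \<and> 0 \<le> real (snd a) \<and> 11 * real (fst a) \<le> 23 * K \<and> 11 * real (snd a) \<le> 23 * K"
    if "a \<in> D0" for a
  proof -
    have "real (fst a) \<le> real (2 * d + 3)" "real (snd a) \<le> real (2 * d + 3)"
      using that by (auto simp: D0_def simp flip: of_nat_le_iff)
    then show ?thesis using K by (simp add: K_def)
  qed
  have fin0: "finite D0" by (simp add: D0_def)
  \<comment> \<open>The first three cuts remove triangles with legs K at the corners (0, 0), (0, 23
    K / 11) and (23 K / 11, 0) of the square.\<close>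
  define D1 where "D1 = {a \<in> D0. K \<le> real (fst a) + real (snd a)}"
  have d1: "K \<le> real (fst a) + real (snd a)" if "a \<in> D1" for a using that unfolding D1_def by blast
  have s1: "D1 \<subseteq> D0" unfolding D1_def by blast
  have e1: "eats d D0 D1"
  proof (rule eats_columns[where c = "0" and es = "[(-1, 0)]" and ?u1.0 = "1" and ?u2.0 = "0" and ?v1.0 = "-1" and ?v2.0 = "1", OF _ refl refl])
    show "finite D0" using fin0 .
    fix b assume b: "b \<in> D0"
    note f = d0[OF b]
    show "(0::real) \<le> linform 1 0 b" using f unfolding of_int_linform of_int_0 of_int_1 of_int_numeral of_int_neg_numeral of_int_minus mult_1_left mult_zero_left add_0_left add_0_right ring_distribs by linarith
    fix m e :: real assume "(m, e) \<in> set [(-1, 0)]"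
    then have "m = -1 \<and> e = 0" by (simp only: list.set insert_iff empty_iff prod.inject HOL.simp_thms)
    then show "m * linform 1 0 b + e \<le> linform (-1) 1 b"
      using f by (elim disjE conjE; simp only: of_int_linform of_int_0 of_int_1 of_int_numeral of_int_neg_numeral of_int_minus mult_1_left mult_zero_left add_0_left add_0_right ring_distribs; linarith)
  next
    show "D1 = {a \<in> D0. \<forall>(m::real, e::real)\<in>set [(-1, 0)]. real (Suc d) \<le> (linform 1 0 a - (0::real)) + (linform (-1) 1 a - (m * linform 1 0 a + e))}"
      unfolding D1_def K_def[symmetric] by (auto simp: linform_def field_simps)
  qed simp
  have fin1: "finite D1" using fin0 s1 by (rule finite_subset[rotated])
  define D2 where "D2 = {a \<in> D1. -12 * K \<le> 11 * real (fst a) - 11 * real (snd a)}"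
  have d2: "-12 * K \<le> 11 * real (fst a) - 11 * real (snd a)" if "a \<in> D2" for a using that unfolding D2_def by blast
  have s2: "D2 \<subseteq> D1" unfolding D2_def by blast
  have e2: "eats d D1 D2"
  proof (rule eats_columns[where c = "0" and es = "[(-1, -23/11 * K)]" and ?u1.0 = "1" and ?u2.0 = "0" and ?v1.0 = "-1" and ?v2.0 = "-1", OF _ refl refl])
    show "finite D1" using fin1 .
    fix b assume b: "b \<in> D1"
    then have b0: "b \<in> D0" using s1 by blast
    note f = d1[OF b] d0[OF b0]
    show "(0::real) \<le> linform 1 0 b" using f unfolding of_int_linform of_int_0 of_int_1 of_int_numeral of_int_neg_numeral of_int_minus mult_1_left mult_zero_left add_0_left add_0_right ring_distribs by linarith
    fix m e :: real assume "(m, e) \<in> set [(-1, -23/11 * K)]"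
    then have "m = -1 \<and> e = -23/11 * K" by (simp only: list.set insert_iff empty_iff prod.inject HOL.simp_thms)
    then show "m * linform 1 0 b + e \<le> linform (-1) (-1) b"
      using f by (elim disjE conjE; simp only: of_int_linform of_int_0 of_int_1 of_int_numeral of_int_neg_numeral of_int_minus mult_1_left mult_zero_left add_0_left add_0_right ring_distribs; linarith)
  next
    show "D2 = {a \<in> D1. \<forall>(m::real, e::real)\<in>set [(-1, -23/11 * K)]. real (Suc d) \<le> (linform 1 0 a - (0::real)) + (linform (-1) (-1) a - (m * linform 1 0 a + e))}"
      unfolding D2_def K_def[symmetric] by (auto simp: linform_def field_simps)
  qed simp
  have fin2: "finite D2" using fin1 s2 by (rule finite_subset[rotated])
  define D3 where "D3 = {a \<in> D2. -12 * K \<le> - 11 * real (fst a) + 11 * real (snd a)}"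
  have d3: "-12 * K \<le> - 11 * real (fst a) + 11 * real (snd a)" if "a \<in> D3" for a using that unfolding D3_def by blast
  have s3: "D3 \<subseteq> D2" unfolding D3_def by blast
  have e3: "eats d D2 D3"
  proof (rule eats_columns[where c = "0" and es = "[(-1, -23/11 * K)]" and ?u1.0 = "0" and ?u2.0 = "1" and ?v1.0 = "-1" and ?v2.0 = "-1", OF _ refl refl])
    show "finite D2" using fin2 .
    fix b assume b: "b \<in> D2"
    then have b1: "b \<in> D1" using s2 by blast
    have b0: "b \<in> D0" using b1 s1 by blast
    note f = d2[OF b] d0[OF b0] d1[OF b1]
    show "(0::real) \<le> linform 0 1 b" using f unfolding of_int_linform of_int_0 of_int_1 of_int_numeral of_int_neg_numeral of_int_minus mult_1_left mult_zero_left add_0_left add_0_right ring_distribs by linarith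
    fix m e :: real assume "(m, e) \<in> set [(-1, -23/11 * K)]"
    then have "m = -1 \<and> e = -23/11 * K" by (simp only: list.set insert_iff empty_iff prod.inject HOL.simp_thms)
    then show "m * linform 0 1 b + e \<le> linform (-1) (-1) b"
      using f by (elim disjE conjE; simp only: of_int_linform of_int_0 of_int_1 of_int_numeral of_int_neg_numeral of_int_minus mult_1_left mult_zero_left add_0_left add_0_right ring_distribs; linarith)
  next
    show "D3 = {a \<in> D2. \<forall>(m::real, e::real)\<in>set [(-1, -23/11 * K)]. real (Suc d) \<le> (linform 0 1 a - (0::real)) + (linform (-1) (-1) a - (m * linform 0 1 a + e))}"
      unfolding D3_def K_def[symmetric] by (auto simp: linform_def field_simps)
  qed simp
  have fin3: "finite D3" using fin2 s3 by (rule finite_subset[rotated])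
  \<comment> \<open>This cut is made at the vertex (K, 23 K / 11) created by \<open>D2\<close>;
    \<open>D5\<close> is its mirror image in the diagonal, at the vertex (23 K / 11, K) created by
    \<open>D3\<close>.\<close>
  define D4 where "D4 = {a \<in> D3. -24 * K \<le> 11 * real (fst a) - 22 * real (snd a)}"
  have d4: "-24 * K \<le> 11 * real (fst a) - 22 * real (snd a)" if "a \<in> D4" for a using that unfolding D4_def by blast
  have s4: "D4 \<subseteq> D3" unfolding D4_def by blast
  have e4: "eats d D3 D4"
  proof (rule eats_columns[where c = "-12/11 * K" and es = "[(0, -23/11 * K)]" and ?u1.0 = "1" and ?u2.0 = "-1" and ?v1.0 = "0" and ?v2.0 = "-1", OF _ refl refl])
    show "finite D3" using fin3 .
    fix b assume b: "b \<in> D3"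
    then have b2: "b \<in> D2" using s3 by blast
    have b1: "b \<in> D1" using b2 s2 by blast
    have b0: "b \<in> D0" using b1 s1 by blast
    note f = d3[OF b] d0[OF b0] d1[OF b1] d2[OF b2]
    show "-12/11 * K \<le> linform 1 (-1) b" using f unfolding of_int_linform of_int_0 of_int_1 of_int_numeral of_int_neg_numeral of_int_minus mult_1_left mult_zero_left add_0_left add_0_right ring_distribs by linarith
    fix m e :: real assume "(m, e) \<in> set [(0, -23/11 * K)]"
    then have "m = 0 \<and> e = -23/11 * K" by (simp only: list.set insert_iff empty_iff prod.inject HOL.simp_thms)
    then show "m * linform 1 (-1) b + e \<le> linform 0 (-1) b"
      using f by (elim disjE conjE; simp only: of_int_linform of_int_0 of_int_1 of_int_numeral of_int_neg_numeral of_int_minus mult_1_left mult_zero_left add_0_left add_0_right ring_distribs; linarith)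
  next
    show "D4 = {a \<in> D3. \<forall>(m::real, e::real)\<in>set [(0, -23/11 * K)]. real (Suc d) \<le> (linform 1 (-1) a - -12/11 * K) + (linform 0 (-1) a - (m * linform 1 (-1) a + e))}"
      unfolding D4_def K_def[symmetric] by (auto simp: linform_def field_simps)
  qed simp
  have fin4: "finite D4" using fin3 s4 by (rule finite_subset[rotated])
  define D5 where "D5 = {a \<in> D4. -24 * K \<le> - 22 * real (fst a) + 11 * real (snd a)}"
  have d5: "-24 * K \<le> - 22 * real (fst a) + 11 * real (snd a)" if "a \<in> D5" for a using that unfolding D5_def by blast
  have s5: "D5 \<subseteq> D4" unfolding D5_def by blast
  have e5: "eats d D4 D5"
  proof (rule eats_columns[where c = "-23/11 * K" and es = "[(-2, -12/11 * K)]" and ?u1.0 = "-1" and ?u2.0 = "0" and ?v1.0 = "1" and ?v2.0 = "1", OF _ refl refl])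
    show "finite D4" using fin4 .
    fix b assume b: "b \<in> D4"
    then have b3: "b \<in> D3" using s4 by blast
    have b2: "b \<in> D2" using b3 s3 by blast
    have b1: "b \<in> D1" using b2 s2 by blast
    have b0: "b \<in> D0" using b1 s1 by blast
    note f = d4[OF b] d0[OF b0] d1[OF b1] d2[OF b2] d3[OF b3]
    show "-23/11 * K \<le> linform (-1) 0 b" using f unfolding of_int_linform of_int_0 of_int_1 of_int_numeral of_int_neg_numeral of_int_minus mult_1_left mult_zero_left add_0_left add_0_right ring_distribs by linarith
    fix m e :: real assume "(m, e) \<in> set [(-2, -12/11 * K)]"
    then have "m = -2 \<and> e = -12/11 * K" by (simp only: list.set insert_iff empty_iff prod.inject HOL.simp_thms)
    then show "m * linform (-1) 0 b + e \<le> linform 1 1 b"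
      using f by (elim disjE conjE; simp only: of_int_linform of_int_0 of_int_1 of_int_numeral of_int_neg_numeral of_int_minus mult_1_left mult_zero_left add_0_left add_0_right ring_distribs; linarith)
  next
    show "D5 = {a \<in> D4. \<forall>(m::real, e::real)\<in>set [(-2, -12/11 * K)]. real (Suc d) \<le> (linform (-1) 0 a - -23/11 * K) + (linform 1 1 a - (m * linform (-1) 0 a + e))}"
      unfolding D5_def K_def[symmetric] by (auto simp: linform_def field_simps)
  qed simp
  have fin5: "finite D5" using fin4 s5 by (rule finite_subset[rotated])
  \<comment> \<open>From here on some pieces are bounded below by several sides, and every edge in
    \<open>es\<close> contributes one inequality to the next set. For \<open>D6\<close> the edges
    are x = 0 and the side made by \<open>D4\<close>; for \<open>D7\<close> they are y = 0 and the
    two sides made by \<open>D6\<close>.\<close>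
  define D6 where "D6 = {a \<in> D5. 2 * K \<le> 2 * real (fst a) + real (snd a) \<and> 42 * K \<le> 44 * real (fst a) + 11 * real (snd a)}"
  have d6: "2 * K \<le> 2 * real (fst a) + real (snd a) \<and> 42 * K \<le> 44 * real (fst a) + 11 * real (snd a)" if "a \<in> D6" for a using that unfolding D6_def by blast
  have s6: "D6 \<subseteq> D5" unfolding D6_def by blast
  have e6: "eats d D5 D6"
  proof (rule eats_columns[where c = "K" and es = "[(0, 0), (2/3, -8/11 * K)]" and ?u1.0 = "1" and ?u2.0 = "1" and ?v1.0 = "1" and ?v2.0 = "0", OF _ refl refl])
    show "finite D5" using fin5 .
    fix b assume b: "b \<in> D5"
    then have b4: "b \<in> D4" using s5 by blast
    have b3: "b \<in> D3" using b4 s4 by blast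
    have b2: "b \<in> D2" using b3 s3 by blast
    have b1: "b \<in> D1" using b2 s2 by blast
    have b0: "b \<in> D0" using b1 s1 by blast
    note f = d5[OF b] d0[OF b0] d1[OF b1] d2[OF b2] d3[OF b3] d4[OF b4]
    show "K \<le> linform 1 1 b" using f unfolding of_int_linform of_int_0 of_int_1 of_int_numeral of_int_neg_numeral of_int_minus mult_1_left mult_zero_left add_0_left add_0_right ring_distribs by linarith
    fix m e :: real assume "(m, e) \<in> set [(0, 0), (2/3, -8/11 * K)]"
    then have "m = 0 \<and> e = 0 \<or> m = 2/3 \<and> e = -8/11 * K" by (simp only: list.set insert_iff empty_iff prod.inject HOL.simp_thms)
    then show "m * linform 1 1 b + e \<le> linform 1 0 b"
      using f by (elim disjE conjE; simp only: of_int_linform of_int_0 of_int_1 of_int_numeral of_int_neg_numeral of_int_minus mult_1_left mult_zero_left add_0_left add_0_right ring_distribs; linarith)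
  next
    show "D6 = {a \<in> D5. \<forall>(m::real, e::real)\<in>set [(0, 0), (2/3, -8/11 * K)]. real (Suc d) \<le> (linform 1 1 a - K) + (linform 1 0 a - (m * linform 1 1 a + e))}"
      unfolding D6_def K_def[symmetric] by (auto simp: linform_def field_simps)
  qed simp
  have fin6: "finite D6" using fin5 s6 by (rule finite_subset[rotated])
  define D7 where "D7 = {a \<in> D6. -26 * K \<le> - 44 * real (fst a) + 33 * real (snd a) \<and> -30 * K \<le> - 66 * real (fst a) + 55 * real (snd a) \<and> -36 * K \<le> - 88 * real (fst a) + 77 * real (snd a)}"
  have d7: "-26 * K \<le> - 44 * real (fst a) + 33 * real (snd a) \<and> -30 * K \<le> - 66 * real (fst a) + 55 * real (snd a) \<and> -36 * K \<le> - 88 * real (fst a) + 77 * real (snd a)" if "a \<in> D7" for a using that unfolding D7_def by blast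
  have s7: "D7 \<subseteq> D6" unfolding D7_def by blast
  have e7: "eats d D6 D7"
  proof (rule eats_columns[where c = "-24/11 * K" and es = "[(-1/2, 0), (-1/4, 1/2 * K), (-1/6, 7/11 * K)]" and ?u1.0 = "-2" and ?u2.0 = "1" and ?v1.0 = "1" and ?v2.0 = "0", OF _ refl refl])
    show "finite D6" using fin6 .
    fix b assume b: "b \<in> D6"
    then have b5: "b \<in> D5" using s6 by blast
    have b4: "b \<in> D4" using b5 s5 by blast
    have b3: "b \<in> D3" using b4 s4 by blast
    have b2: "b \<in> D2" using b3 s3 by blast
    have b1: "b \<in> D1" using b2 s2 by blast
    have b0: "b \<in> D0" using b1 s1 by blast
    note f = d6[OF b] d0[OF b0] d1[OF b1] d2[OF b2] d3[OF b3] d4[OF b4] d5[OF b5]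
    show "-24/11 * K \<le> linform (-2) 1 b" using f unfolding of_int_linform of_int_0 of_int_1 of_int_numeral of_int_neg_numeral of_int_minus mult_1_left mult_zero_left add_0_left add_0_right ring_distribs by linarith
    fix m e :: real assume "(m, e) \<in> set [(-1/2, 0), (-1/4, 1/2 * K), (-1/6, 7/11 * K)]"
    then have "m = -1/2 \<and> e = 0 \<or> m = -1/4 \<and> e = 1/2 * K \<or> m = -1/6 \<and> e = 7/11 * K" by (simp only: list.set insert_iff empty_iff prod.inject HOL.simp_thms)
    then show "m * linform (-2) 1 b + e \<le> linform 1 0 b"
      using f by (elim disjE conjE; simp only: of_int_linform of_int_0 of_int_1 of_int_numeral of_int_neg_numeral of_int_minus mult_1_left mult_zero_left add_0_left add_0_right ring_distribs; linarith)
  next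
    show "D7 = {a \<in> D6. \<forall>(m::real, e::real)\<in>set [(-1/2, 0), (-1/4, 1/2 * K), (-1/6, 7/11 * K)]. real (Suc d) \<le> (linform (-2) 1 a - -24/11 * K) + (linform 1 0 a - (m * linform (-2) 1 a + e))}"
      unfolding D7_def K_def[symmetric] by (auto simp: linform_def field_simps)
  qed simp
  have fin7: "finite D7" using fin6 s7 by (rule finite_subset[rotated])
  define D8 where "D8 = {a \<in> D7. 467 * K \<le> - 66 * real (fst a) + 396 * real (snd a)}"
  have d8: "467 * K \<le> - 66 * real (fst a) + 396 * real (snd a)" if "a \<in> D8" for a using that unfolding D8_def by blast
  have s8: "D8 \<subseteq> D7" unfolding D8_def by blast
  have e8: "eats d D7 D8"
  \<comment> \<open>The least value of y - x on the polygon of \<open>D7\<close>, taken at the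
    vertex (5 K / 6, 16 K / 33) where 88 x - 77 y = 36 K meets 44 x + 11 y = 42 K. The edge is the
    latter line.\<close>
  proof (rule eats_columns[where c = "-23/66 * K" and es = "[(4/5, 42/55 * K)]" and ?u1.0 = "-1" and ?u2.0 = "1" and ?v1.0 = "0" and ?v2.0 = "1", OF _ refl refl])
    show "finite D7" using fin7 .
    fix b assume b: "b \<in> D7"
    then have b6: "b \<in> D6" using s7 by blast
    have b5: "b \<in> D5" using b6 s6 by blast
    have b4: "b \<in> D4" using b5 s5 by blast
    have b3: "b \<in> D3" using b4 s4 by blast
    have b2: "b \<in> D2" using b3 s3 by blast
    have b1: "b \<in> D1" using b2 s2 by blast
    have b0: "b \<in> D0" using b1 s1 by blast
    note f = d7[OF b] d0[OF b0] d1[OF b1] d2[OF b2] d3[OF b3] d4[OF b4] d5[OF b5] d6[OF b6]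
    show "-23/66 * K \<le> linform (-1) 1 b" using f unfolding of_int_linform of_int_0 of_int_1 of_int_numeral of_int_neg_numeral of_int_minus mult_1_left mult_zero_left add_0_left add_0_right ring_distribs by linarith
    fix m e :: real assume "(m, e) \<in> set [(4/5, 42/55 * K)]"
    then have "m = 4/5 \<and> e = 42/55 * K" by (simp only: list.set insert_iff empty_iff prod.inject HOL.simp_thms)
    then show "m * linform (-1) 1 b + e \<le> linform 0 1 b"
      using f by (elim disjE conjE; simp only: of_int_linform of_int_0 of_int_1 of_int_numeral of_int_neg_numeral of_int_minus mult_1_left mult_zero_left add_0_left add_0_right ring_distribs; linarith)
  next
    show "D8 = {a \<in> D7. \<forall>(m::real, e::real)\<in>set [(4/5, 42/55 * K)]. real (Suc d) \<le> (linform (-1) 1 a - -23/66 * K) + (linform 0 1 a - (m * linform (-1) 1 a + e))}"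
      unfolding D8_def K_def[symmetric] by (auto simp: linform_def field_simps)
  qed simp
  have fin8: "finite D8" using fin7 s8 by (rule finite_subset[rotated])
  define D9 where "D9 = {a \<in> D8. 155 * K \<le> 198 * real (fst a) - 132 * real (snd a) \<and> -75 * K \<le> 143 * real (fst a) - 187 * real (snd a)}"
  have d9: "155 * K \<le> 198 * real (fst a) - 132 * real (snd a) \<and> -75 * K \<le> 143 * real (fst a) - 187 * real (snd a)" if "a \<in> D9" for a using that unfolding D9_def by blast
  have s9: "D9 \<subseteq> D8" unfolding D9_def by blast
  have e9: "eats d D8 D9"
  proof (rule eats_columns[where c = "-24/11 * K" and es = "[(1/4, 467/264 * K), (-4/9, 14/33 * K)]" and ?u1.0 = "1" and ?u2.0 = "-2" and ?v1.0 = "0" and ?v2.0 = "1", OF _ refl refl])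
    show "finite D8" using fin8 .
    fix b assume b: "b \<in> D8"
    then have b7: "b \<in> D7" using s8 by blast
    have b6: "b \<in> D6" using b7 s7 by blast
    have b5: "b \<in> D5" using b6 s6 by blast
    have b4: "b \<in> D4" using b5 s5 by blast
    have b3: "b \<in> D3" using b4 s4 by blast
    have b2: "b \<in> D2" using b3 s3 by blast
    have b1: "b \<in> D1" using b2 s2 by blast
    have b0: "b \<in> D0" using b1 s1 by blast
    note f = d8[OF b] d0[OF b0] d1[OF b1] d2[OF b2] d3[OF b3] d4[OF b4] d5[OF b5] d6[OF b6] d7[OF b7]
    show "-24/11 * K \<le> linform 1 (-2) b" using f unfolding of_int_linform of_int_0 of_int_1 of_int_numeral of_int_neg_numeral of_int_minus mult_1_left mult_zero_left add_0_left add_0_right ring_distribs by linarith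
    fix m e :: real assume "(m, e) \<in> set [(1/4, 467/264 * K), (-4/9, 14/33 * K)]"
    then have "m = 1/4 \<and> e = 467/264 * K \<or> m = -4/9 \<and> e = 14/33 * K" by (simp only: list.set insert_iff empty_iff prod.inject HOL.simp_thms)
    then show "m * linform 1 (-2) b + e \<le> linform 0 1 b"
      using f by (elim disjE conjE; simp only: of_int_linform of_int_0 of_int_1 of_int_numeral of_int_neg_numeral of_int_minus mult_1_left mult_zero_left add_0_left add_0_right ring_distribs; linarith)
  next
    show "D9 = {a \<in> D8. \<forall>(m::real, e::real)\<in>set [(1/4, 467/264 * K), (-4/9, 14/33 * K)]. real (Suc d) \<le> (linform 1 (-2) a - -24/11 * K) + (linform 0 1 a - (m * linform 1 (-2) a + e))}"
      unfolding D9_def K_def[symmetric] by (auto simp: linform_def field_simps)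
  qed simp
  have fin9: "finite D9" using fin8 s9 by (rule finite_subset[rotated])
  \<comment> \<open>The half-planes collected so far have no common point when K is
    positive.\<close>
  have "D9 = {}"
  proof (rule equals0I)
    fix b assume b: "b \<in> D9"
    then have b8: "b \<in> D8" using s9 by blast
    have b7: "b \<in> D7" using b8 s8 by blast
    have b6: "b \<in> D6" using b7 s7 by blast
    have b5: "b \<in> D5" using b6 s6 by blast
    have b4: "b \<in> D4" using b5 s5 by blast
    have b3: "b \<in> D3" using b4 s4 by blast
    have b2: "b \<in> D2" using b3 s3 by blast
    have b1: "b \<in> D1" using b2 s2 by blast
    have b0: "b \<in> D0" using b1 s1 by blast
    show False using K d9[OF b] d0[OF b0] d1[OF b1] d2[OF b2] d3[OF b3] d4[OF b4] d5[OF b5] d6[OF b6] d7[OF b7] d8[OF b8] by linarith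
  qed
  then have "eaten d 0 D9" by (simp add: eaten.empty)
  from eaten.step[OF e9 this] have "eaten d 1 D8" by (simp add: eval_nat_numeral)
  from eaten.step[OF e8 this] have "eaten d 2 D7" by (simp add: eval_nat_numeral)
  from eaten.step[OF e7 this] have "eaten d 3 D6" by (simp add: eval_nat_numeral)
  from eaten.step[OF e6 this] have "eaten d 4 D5" by (simp add: eval_nat_numeral)
  from eaten.step[OF e5 this] have "eaten d 5 D4" by (simp add: eval_nat_numeral)
  from eaten.step[OF e4 this] have "eaten d 6 D3" by (simp add: eval_nat_numeral)
  from eaten.step[OF e3 this] have "eaten d 7 D2" by (simp add: eval_nat_numeral)
  from eaten.step[OF e2 this] have "eaten d 8 D1" by (simp add: eval_nat_numeral)
  from eaten.step[OF e1 this] have "eaten d 9 D0" by (simp add: eval_nat_numeral)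
  then show ?thesis by (simp add: D0_def)
qed

text \<open>The bound on \<open>card E\<close> is the expected dimension \<open>(2m + 2)\<^sup>2 - 9 m (m + 1) / 2\<close> for \<open>m = d + 1\<close>;
  truncated subtraction makes it \<open>0\<close> for \<open>m \<ge> 8\<close>.\<close>

lemma grid_eatenI:
  assumes "eaten d 9 ({..<n} \<times> {..<n} - set E)" "n = 2 * d + 4" "length E \<le> (7 - d) * (d + 2) div 2"
  shows "\<exists>E. finite E \<and> card E \<le> (7 - d) * (d + 2) div 2 \<and> eaten d 9 ({..<2 * d + 4} \<times> {..<2 * d + 4} - E)"
  using assms card_length[of E] by (intro exI[of _ "set E"]) auto

lemma grid_eaten:
  "\<exists>E. finite E \<and> card E \<le> (7 - d) * (d + 2) div 2 \<and> eaten d 9 ({..<2 * d + 4} \<times> {..<2 * d + 4} - E)"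
proof (cases "10 \<le> d")
  case True
  then show ?thesis using eaten_large[of d] by (intro exI[of _ "{}"]) simp
next
  case False
  from False consider "d = 0" | "d = 1" | "d = 2" | "d = 3" | "d = 4" | "d = 5" | "d = 6" | "d = 7" | "d = 8" | "d = 9"
    by fastforce
  then show ?thesis
  proof cases
    case 1
    show ?thesis unfolding 1 by (rule grid_eatenI[OF eaten_1]) simp_all
  next
    case 2
    show ?thesis unfolding 2 by (rule grid_eatenI[OF eaten_2]) simp_all
  next
    case 3
    show ?thesis unfolding 3 by (rule grid_eatenI[OF eaten_3]) simp_all
  next
    case 4
    show ?thesis unfolding 4 by (rule grid_eatenI[OF eaten_4]) simp_all
  next
    case 5
    show ?thesis unfolding 5 by (rule grid_eatenI[OF eaten_5]) simp_all
  next
    case 6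
    show ?thesis unfolding 6 by (rule grid_eatenI[OF eaten_6]) simp_all
  next
    case 7
    show ?thesis unfolding 7 by (rule grid_eatenI[OF eaten_7]) simp_all
  next
    case 8
    show ?thesis unfolding 8 by (rule grid_eatenI[OF eaten_8]) simp_all
  next
    case 9
    show ?thesis unfolding 9 by (rule grid_eatenI[OF eaten_9]) simp_all
  next
    case 10
    show ?thesis unfolding 10 by (rule grid_eatenI[OF eaten_10]) simp_all
  qed
qed

section \<open>Generic points\<close>

text \<open>Fraction-free elimination: this replaces the use of a maximal minor.  The index of \<open>Cl\<close> is the
  multidegree of the entries of a row.\<close>

lemma open_injectivity:
  fixes A :: "'r \<Rightarrow> 'b \<Rightarrow> 'p \<Rightarrow> complex" and Cl :: "'e::comm_monoid_add \<Rightarrow> ('p \<Rightarrow> complex) \<Rightarrow> bool"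
  assumes one: "Cl 0 (\<lambda>_. 1)"
    and mult: "\<And>e e' f g. Cl e f \<Longrightarrow> Cl e' g \<Longrightarrow> Cl (e + e') (\<lambda>p. f p * g p)"
    and diff: "\<And>e f g. Cl e f \<Longrightarrow> Cl e g \<Longrightarrow> Cl e (\<lambda>p. f p - g p)"
    and "finite B"
    and entries: "\<And>r. r \<in> R \<Longrightarrow> \<exists>e. \<forall>b\<in>B. Cl e (A r b)"
    and inj: "\<And>c. (\<forall>r\<in>R. (\<Sum>b\<in>B. c b * A r b p0) = 0) \<Longrightarrow> \<forall>b\<in>B. c b = 0"
  shows "\<exists>e f. Cl e f \<and> f p0 \<noteq> 0 \<and>
    (\<forall>p. f p \<noteq> 0 \<longrightarrow> (\<forall>c. (\<forall>r\<in>R. (\<Sum>b\<in>B. c b * A r b p) = 0) \<longrightarrow> (\<forall>b\<in>B. c b = 0)))"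
  using assms(4-)
proof (induction B arbitrary: A rule: finite_induct)
  case empty
  show ?case using one by (intro exI[of _ 0] exI[of _ "\<lambda>_. 1"]) auto
next
  case (insert x B)
  note entries = insert.prems(1) and inj = insert.prems(2)
  obtain r where r: "r \<in> R" "A r x p0 \<noteq> 0"
  proof (rule ccontr)
    assume "\<not> thesis"
    then have "\<And>r. r \<in> R \<Longrightarrow> A r x p0 = 0" using that by blast
    then have "\<forall>b\<in>insert x B. (if b = x then 1 else (0::complex)) = 0"
      using insert.hyps by (intro inj) (auto intro!: sum.neutral)
    then show False by auto
  qed
  \<comment> \<open>Cross multiplication with the pivot row \<open>r\<close> eliminates the column
    \<open>x\<close>. Both products in an entry have the same degree, so a row remains of constant
    degree.\<close>
  define A' where "A' = (\<lambda>r' b p. A r x p * A r' b p - A r' x p * A r b p)"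
  have sumA': "(\<Sum>b\<in>B. c b * A' r' b p) = A r x p * (\<Sum>b\<in>B. c b * A r' b p) - A r' x p * (\<Sum>b\<in>B. c b * A r b p)" for c r' p
    by (simp add: A'_def algebra_simps sum_subtractf sum_distrib_left)
  have "\<exists>e f. Cl e f \<and> f p0 \<noteq> 0 \<and>
    (\<forall>p. f p \<noteq> 0 \<longrightarrow> (\<forall>c. (\<forall>r\<in>R. (\<Sum>b\<in>B. c b * A' r b p) = 0) \<longrightarrow> (\<forall>b\<in>B. c b = 0)))"
  proof (rule insert.IH)
    fix r' assume r': "r' \<in> R"
    obtain e e' where e: "\<forall>b\<in>insert x B. Cl e (A r b)" "\<forall>b\<in>insert x B. Cl e' (A r' b)"
      using entries[OF r(1)] entries[OF r'] by blast
    have "Cl (e + e') (A' r' b)" if "b \<in> B" for b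
    proof -
      have "Cl (e + e') (\<lambda>p. A r x p * A r' b p)" "Cl (e' + e) (\<lambda>p. A r' x p * A r b p)"
        using e that by (auto intro: mult)
      then show ?thesis unfolding A'_def by (intro diff) (simp_all add: add.commute)
    qed
    then show "\<exists>e. \<forall>b\<in>B. Cl e (A' r' b)" by blast
  next
    fix c assume c: "\<forall>r\<in>R. (\<Sum>b\<in>B. c b * A' r b p0) = 0"
    define s where "s = (\<lambda>r'. \<Sum>b\<in>B. c b * A r' b p0)"
    \<comment> \<open>A kernel vector of the eliminated system at \<open>p0\<close> extends to one
      of the full system by solving the pivot row for the coefficient of \<open>x\<close>.\<close>
    define c' where "c' = (\<lambda>b. if b = x then - s r / A r x p0 else c b)"
    have "\<forall>b\<in>insert x B. c' b = 0"
    proof (rule inj, intro ballI)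
      fix r' assume "r' \<in> R"
      then have "A r x p0 * s r' = A r' x p0 * s r" using c sumA'[of c r' p0] by (simp add: s_def)
      moreover have "(\<Sum>b\<in>B. c' b * A r' b p0) = s r'"
        unfolding s_def using insert.hyps by (intro sum.cong) (auto simp: c'_def)
      ultimately show "(\<Sum>b\<in>insert x B. c' b * A r' b p0) = 0"
        using insert.hyps r(2) by (simp add: c'_def field_simps)
    qed
    then show "\<forall>b\<in>B. c b = 0" using insert.hyps by (auto simp: c'_def split: if_splits)
  qed
  then obtain e f where f: "Cl e f" "f p0 \<noteq> 0"
    "\<And>p c. f p \<noteq> 0 \<Longrightarrow> (\<forall>r\<in>R. (\<Sum>b\<in>B. c b * A' r b p) = 0) \<Longrightarrow> \<forall>b\<in>B. c b = 0" by blast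
  obtain e' where e': "Cl e' (A r x)" using entries[OF r(1)] by blast
  show ?case
  proof (intro exI[of _ "e' + e"] exI[of _ "\<lambda>p. A r x p * f p"] conjI allI impI)
    show "Cl (e' + e) (\<lambda>p. A r x p * f p)" using mult[OF e' f(1)] .
    show "A r x p0 * f p0 \<noteq> 0" using r f by simp
    fix p c assume nz: "A r x p * f p \<noteq> 0" and c: "\<forall>r\<in>R. (\<Sum>b\<in>insert x B. c b * A r b p) = 0"
    have s: "(\<Sum>b\<in>B. c b * A r' b p) = - c x * A r' x p" if "r' \<in> R" for r'
      using c that insert.hyps by (simp add: add_eq_0_iff)
    have "\<forall>b\<in>B. c b = 0" using nz r(1) by (intro f(3)) (auto simp: sumA' s)
    moreover have "c x = 0" using s[OF r(1)] calculation nz by auto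
    ultimately show "\<forall>b\<in>insert x B. c b = 0" by blast
  qed
qed

definition move :: "('i \<Rightarrow> complex \<times> complex) \<Rightarrow> ('i \<Rightarrow> complex \<times> complex) \<Rightarrow> complex \<Rightarrow> 'i \<Rightarrow> complex \<times> complex" where
  "move p q s i = (fst (p i) + s * (fst (q i) - fst (p i)), snd (p i) + s * (snd (q i) - snd (p i)))"

lemma move_0 [simp]: "move p q 0 = p" and move_1 [simp]: "move p q 1 = q"
  by (auto simp: move_def fun_eq_iff)

text \<open>A substitute for polynomial functions on the configuration space: it is closed under the
  operations of the elimination and strong enough to intersect nonempty open sets.\<close>

definition line_polynomial :: "(('i \<Rightarrow> complex \<times> complex) \<Rightarrow> complex) \<Rightarrow> bool" where
  "line_polynomial f \<longleftrightarrow> (\<forall>p q. \<exists>P. \<forall>s. f (move p q s) = poly P s)"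

lemma line_polynomial_const: "line_polynomial (\<lambda>_. c)"
  unfolding line_polynomial_def by (intro allI exI[of _ "[:c:]"]) simp

lemma line_polynomial_mult:
  assumes "line_polynomial f" "line_polynomial g"
  shows "line_polynomial (\<lambda>p. f p * g p)"
  unfolding line_polynomial_def
proof (intro allI)
  fix p q
  obtain P Q where "\<forall>s. f (move p q s) = poly P s" "\<forall>s. g (move p q s) = poly Q s"
    using assms unfolding line_polynomial_def by blast
  then show "\<exists>P. \<forall>s. f (move p q s) * g (move p q s) = poly P s" by (intro exI[of _ "P * Q"]) simp
qed

lemma line_polynomial_diff:
  assumes "line_polynomial f" "line_polynomial g"
  shows "line_polynomial (\<lambda>p. f p - g p)"
  unfolding line_polynomial_def
proof (intro allI)
  fix p q
  obtain P Q where "\<forall>s. f (move p q s) = poly P s" "\<forall>s. g (move p q s) = poly Q s"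
    using assms unfolding line_polynomial_def by blast
  then show "\<exists>P. \<forall>s. f (move p q s) - g (move p q s) = poly P s" by (intro exI[of _ "P - Q"]) simp
qed

lemma line_polynomial_power: "line_polynomial f \<Longrightarrow> line_polynomial (\<lambda>p. f p ^ n)"
  by (induction n) (auto intro: line_polynomial_const line_polynomial_mult)

lemma line_polynomial_coord: "line_polynomial (\<lambda>p. fst (p i))" "line_polynomial (\<lambda>p. snd (p i))"
proof -
  show "line_polynomial (\<lambda>p. fst (p i))" unfolding line_polynomial_def
  proof (intro allI)
    fix p q :: "'a \<Rightarrow> complex \<times> complex"
    show "\<exists>P. \<forall>s. fst (move p q s i) = poly P s"
      by (intro exI[of _ "[:fst (p i), fst (q i) - fst (p i):]"]) (simp add: move_def)
  qed
  show "line_polynomial (\<lambda>p. snd (p i))" unfolding line_polynomial_def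
  proof (intro allI)
    fix p q :: "'a \<Rightarrow> complex \<times> complex"
    show "\<exists>P. \<forall>s. snd (move p q s i) = poly P s"
      by (intro exI[of _ "[:snd (p i), snd (q i) - snd (p i):]"]) (simp add: move_def)
  qed
qed

text \<open>Join a good configuration for the old functions to one for the new function by a line.
  On it all the functions are nonzero polynomials in one variable, and finitely many of these have a
  common nonroot.\<close>

lemma common_nonzero:
  fixes f :: "'j \<Rightarrow> ('i \<Rightarrow> complex \<times> complex) \<Rightarrow> complex"
  assumes "finite J" "\<And>j. j \<in> J \<Longrightarrow> line_polynomial (f j)" "\<And>j. j \<in> J \<Longrightarrow> \<exists>p. f j p \<noteq> 0"
  shows "\<exists>p. \<forall>j\<in>J. f j p \<noteq> 0"
  using assms
proof (induction J rule: finite_induct)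
  case (insert x J)
  obtain p where p: "\<forall>j\<in>J. f j p \<noteq> 0" using insert by auto
  obtain q where q: "f x q \<noteq> 0" using insert by blast
  have "\<forall>j\<in>insert x J. \<exists>P. \<forall>s. f j (move p q s) = poly P s"
    using insert.prems(1) unfolding line_polynomial_def by blast
  then obtain P where P: "\<And>j s. j \<in> insert x J \<Longrightarrow> f j (move p q s) = poly (P j) s" by metis
  have "P j \<noteq> 0" if "j \<in> insert x J" for j
  proof
    assume "P j = 0"
    then have "f j p = 0" "f j q = 0" using P[OF that, of 0] P[OF that, of 1] by auto
    then show False using p q that by auto
  qed
  then have "finite (\<Union>j\<in>insert x J. {s. poly (P j) s = 0})"
    using insert.hyps by (intro finite_UN_I) (auto simp: poly_roots_finite)
  then obtain s where "s \<notin> (\<Union>j\<in>insert x J. {s. poly (P j) s = 0})"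
    using infinite_UNIV_char_0 ex_new_if_finite by blast
  then show ?case using P by (intro exI[of _ "move p q s"]) auto
qed auto

text \<open>Degeneration yields separate points for each \<open>j\<close>, but the induction over
  multiplicities needs the same points at every level. Unisolvence at a level is implied by the
  nonvanishing of a suitable function, and finitely many such functions can be made nonzero
  together.\<close>

lemma generic_unisolvent:
  fixes D :: "'j \<Rightarrow> (nat \<times> nat) set" and d :: "'j \<Rightarrow> nat"
  assumes J: "finite J" and D: "\<And>j. j \<in> J \<Longrightarrow> finite (D j) \<and> eaten (d j) CARD('i) (D j)"
  shows "\<exists>p :: 'i::finite \<Rightarrow> complex \<times> complex. (\<forall>i. fst (p i) \<noteq> 0 \<and> snd (p i) \<noteq> 0) \<and>
    (\<forall>j\<in>J. unisolvent (d j) p UNIV (D j))"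
proof -
  obtain xs :: "'i list" where xs: "set xs = UNIV" "distinct xs" using finite_distinct_list[of "UNIV :: 'i set"] by auto
  then have len: "length xs = CARD('i)" using distinct_card by fastforce
  have "\<forall>j\<in>J. \<exists>f. line_polynomial f \<and> (\<exists>p. f p \<noteq> 0) \<and>
      (\<forall>p :: 'i \<Rightarrow> complex \<times> complex. f p \<noteq> 0 \<longrightarrow> unisolvent (d j) p UNIV (D j))"
  proof
    fix j assume j: "j \<in> J"
    obtain p0 :: "'i \<Rightarrow> complex \<times> complex" where p0: "unisolvent (d j) p0 UNIV (D j)"
      using eaten_unisolvent[of "d j" "CARD('i)" "D j" xs] D[OF j] xs len by auto
    define R where "R = {r :: 'i \<times> (nat \<times> nat \<Rightarrow> complex). polyfun exponents (d j) (snd r)}"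
    define A where "A = (\<lambda>(r :: 'i \<times> (nat \<times> nat \<Rightarrow> complex)) a p. snd r a * mon (p (fst r)) a)"
    have R: "unisolvent (d j) p UNIV (D j) \<longleftrightarrow> (\<forall>f. (\<forall>r\<in>R. (\<Sum>a\<in>D j. f a * A r a p) = 0) \<longrightarrow> (\<forall>a\<in>D j. f a = 0))" for p
      unfolding unisolvent_def R_def A_def by auto
    have "\<exists>e f. (\<lambda>(e::nat) f. line_polynomial f) e f \<and> f p0 \<noteq> 0 \<and>
      (\<forall>p. f p \<noteq> 0 \<longrightarrow> (\<forall>c. (\<forall>r\<in>R. (\<Sum>b\<in>D j. c b * A r b p) = 0) \<longrightarrow> (\<forall>b\<in>D j. c b = 0)))"
    proof (rule open_injectivity)
      show "\<exists>e::nat. \<forall>b\<in>D j. line_polynomial (A r b)" for r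
        unfolding A_def mon_def
        by (intro exI ballI line_polynomial_mult line_polynomial_const line_polynomial_power line_polynomial_coord)
      show "finite (D j)" using D[OF j] by simp
      show "\<forall>b\<in>D j. c b = 0" if "\<forall>r\<in>R. (\<Sum>b\<in>D j. c b * A r b p0) = 0" for c
        using p0 that unfolding R by blast
    qed (auto intro: line_polynomial_const line_polynomial_mult line_polynomial_diff)
    then show "\<exists>f. line_polynomial f \<and> (\<exists>p. f p \<noteq> 0) \<and>
      (\<forall>p :: 'i \<Rightarrow> complex \<times> complex. f p \<noteq> 0 \<longrightarrow> unisolvent (d j) p UNIV (D j))"
      unfolding R by blast
  qed
  then obtain f where f: "\<And>j. j \<in> J \<Longrightarrow> line_polynomial (f j)" "\<And>j. j \<in> J \<Longrightarrow> \<exists>p. f j p \<noteq> 0"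
    "\<And>j p. j \<in> J \<Longrightarrow> f j p \<noteq> 0 \<Longrightarrow> unisolvent (d j) (p :: 'i \<Rightarrow> complex \<times> complex) UNIV (D j)" by metis
  \<comment> \<open>The extra functions, products of the two coordinates of each point, keep the
    common configuration inside the torus.\<close>
  define g where "g = case_sum f (\<lambda>i p. fst (p i) * snd (p i))"
  have "\<exists>p. \<forall>j\<in>J <+> UNIV. g j p \<noteq> 0"
  proof (rule common_nonzero)
    show "finite (J <+> (UNIV :: 'i set))" using J by simp
    show "line_polynomial (g j)" if "j \<in> J <+> UNIV" for j
      using that f(1) by (auto simp: g_def intro!: line_polynomial_mult[OF line_polynomial_coord])
    show "\<exists>p. g j p \<noteq> 0" if "j \<in> J <+> UNIV" for j
    proof (cases j)
      case (Inl i)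
      then show ?thesis using that f(2)[of i] by (auto simp: g_def)
    next
      case (Inr i)
      then show ?thesis by (auto simp: g_def intro!: exI[of _ "\<lambda>_. (1, 1)"])
    qed
  qed
  then obtain p where p: "\<forall>j\<in>J <+> UNIV. g j p \<noteq> 0" by blast
  have "fst (p i) \<noteq> 0 \<and> snd (p i) \<noteq> 0" for i using p[rule_format, of "Inr i"] by (auto simp: g_def)
  moreover have "unisolvent (d j) p UNIV (D j)" if "j \<in> J" for j
    using p[rule_format, of "Inl j"] that f(3)[of j p] by (auto simp: g_def)
  ultimately show ?thesis by blast
qed

section \<open>Derivatives and multiplicities of polynomials\<close>

abbreviation cf :: "('a \<Rightarrow>\<^sub>0 'b::zero) \<Rightarrow> 'a \<Rightarrow> 'b" where
  "cf \<equiv> Poly_Mapping.lookup"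

abbreviation unit_exp :: "'v \<Rightarrow> 'v \<Rightarrow>\<^sub>0 nat" where
  "unit_exp v \<equiv> Poly_Mapping.single v 1"

definition monom_eval :: "('v::finite \<Rightarrow> complex) \<Rightarrow> ('v \<Rightarrow>\<^sub>0 nat) \<Rightarrow> complex" where
  "monom_eval x a = (\<Prod>v\<in>UNIV. x v ^ cf a v)"

definition total_degree :: "('v::finite \<Rightarrow>\<^sub>0 nat) \<Rightarrow> nat" where
  "total_degree a = (\<Sum>v\<in>UNIV. cf a v)"

lemma monom_eval_0 [simp]: "monom_eval x 0 = 1"
  by (simp add: monom_eval_def)

lemma monom_eval_add: "monom_eval x (a + b) = monom_eval x a * monom_eval x b"
  by (simp add: monom_eval_def lookup_add power_add prod.distrib)

lemma monom_eval_unit [simp]: "monom_eval x (unit_exp v) = x v"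
proof -
  have "monom_eval x (unit_exp v) = (\<Prod>w\<in>UNIV. if w = v then x v else 1)"
    unfolding monom_eval_def by (intro prod.cong) (auto simp: lookup_single when_def)
  then show ?thesis by simp
qed

lemma total_degree_0 [simp]: "total_degree 0 = 0"
  by (simp add: total_degree_def)

lemma total_degree_add: "total_degree (a + b) = total_degree a + total_degree b"
  by (simp add: total_degree_def lookup_add sum.distrib)

lemma total_degree_unit [simp]: "total_degree (unit_exp v) = 1"
proof -
  have "total_degree (unit_exp v) = (\<Sum>w\<in>UNIV. if w = v then 1 else 0)"
    unfolding total_degree_def by (intro sum.cong) (auto simp: lookup_single when_def)
  then show ?thesis by simp
qed

declare monom_eval_unit[simplified, simp] total_degree_unit[simplified, simp]

lemma homogeneous_alt: "homogeneous d f \<longleftrightarrow> (\<forall>a. cf f a \<noteq> 0 \<longrightarrow> total_degree a = d)"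
  by (auto simp: homogeneous_def total_degree_def in_keys_iff)

lemma sum_single_lookup: "(\<Sum>a\<in>Poly_Mapping.keys f. Poly_Mapping.single a (cf f a)) = f"
proof (rule poly_mapping_eqI)
  fix k
  have "cf (\<Sum>a\<in>Poly_Mapping.keys f. Poly_Mapping.single a (cf f a)) k = (\<Sum>a\<in>Poly_Mapping.keys f. if a = k then cf f a else 0)"
    unfolding lookup_sum by (intro sum.cong) (auto simp: lookup_single when_def)
  then show "cf (\<Sum>a\<in>Poly_Mapping.keys f. Poly_Mapping.single a (cf f a)) k = cf f k"
    by (simp add: in_keys_iff)
qed

lemma cpoly_induct [case_names single add]:
  fixes f :: "'v cpoly"
  assumes "\<And>a c. P (Poly_Mapping.single a c)" "\<And>f g. P f \<Longrightarrow> P g \<Longrightarrow> P (f + g)"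
  shows "P f"
proof -
  have 0: "P 0" using assms(1)[of 0 0] by simp
  have "P (\<Sum>a\<in>A. Poly_Mapping.single a (cf f a))" for A
    by (induction A rule: infinite_finite_induct) (auto simp: 0 assms)
  from this[of "Poly_Mapping.keys f"] show ?thesis by (simp add: sum_single_lookup)
qed

lemma cpoly_eval_superset:
  assumes "finite A" "Poly_Mapping.keys f \<subseteq> A"
  shows "cpoly_eval x f = (\<Sum>a\<in>A. cf f a * monom_eval x a)"
  unfolding cpoly_eval_def monom_eval_def using assms
  by (intro sum.mono_neutral_left) (auto simp: in_keys_iff)

lemma cpoly_eval_single [simp]: "cpoly_eval x (Poly_Mapping.single a c) = c * monom_eval x a"
  by (subst cpoly_eval_superset[of "{a}"]) auto

lemma cpoly_eval_add [simp]: "cpoly_eval x (f + g) = cpoly_eval x f + cpoly_eval x g"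
  unfolding cpoly_eval_def by (rule setsum_keys_plus_distrib) (auto simp: algebra_simps)

lemma cpoly_eval_0 [simp]: "cpoly_eval x 0 = 0"
  by (simp add: cpoly_eval_def)

lemma cpoly_eval_1 [simp]: "cpoly_eval x 1 = 1"
  using cpoly_eval_single[of x 0 1] by simp

lemma cpoly_eval_mult [simp]: "cpoly_eval x (f * g) = cpoly_eval x f * cpoly_eval x g"
proof (induction f rule: cpoly_induct)
  case (single a c)
  show ?case by (induction g rule: cpoly_induct) (simp_all add: mult_single monom_eval_add algebra_simps)
qed (simp add: distrib_right)

lemma cpoly_eval_uminus [simp]: "cpoly_eval x (- f) = - cpoly_eval x f"
  using cpoly_eval_add[of x f "- f"] by (simp add: eq_neg_iff_add_eq_0 add.commute)

lemma cpoly_eval_diff [simp]: "cpoly_eval x (f - g) = cpoly_eval x f - cpoly_eval x g"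
  using cpoly_eval_add[of x f "- g"] by simp

lemma cpoly_eval_scale [simp]: "cpoly_eval x (cpoly_scale c f) = c * cpoly_eval x f"
  by (simp add: cpoly_scale_def)

lemma cpoly_eval_sum: "cpoly_eval x (sum f A) = (\<Sum>i\<in>A. cpoly_eval x (f i))"
  by (induction A rule: infinite_finite_induct) auto

lemma lookup_scale [simp]: "cf (cpoly_scale c f) a = c * cf f a"
proof (induction f rule: cpoly_induct)
  case (single b d)
  show ?case by (simp add: cpoly_scale_def mult_single lookup_single when_def)
qed (simp add: cpoly_scale_def distrib_left lookup_add)

text \<open>The truncated subtraction in \<open>cpoly_partial\<close> does no harm: a monomial free
  of \<open>v\<close> comes with coefficient 0. In this form linearity and commutation are checked
  coefficientwise.\<close>

lemma lookup_partial: "cf (cpoly_partial v f) a = of_nat (Suc (cf a v)) * cf f (a + unit_exp v)"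
proof -
  have "cf (cpoly_partial v f) a =
      (\<Sum>b\<in>Poly_Mapping.keys f. if b = a + unit_exp v then of_nat (cf b v) * cf f b else 0)"
    unfolding cpoly_partial_def lookup_sum
  proof (intro sum.cong refl)
    fix b :: "'a \<Rightarrow>\<^sub>0 nat"
    have 1: "b = a + unit_exp v" if "b - unit_exp v = a" "cf b v \<noteq> 0"
    proof (rule poly_mapping_eqI)
      fix w
      have "cf a w = cf b w - cf (unit_exp v) w" using that(1) lookup_minus by metis
      then show "cf b w = cf (a + unit_exp v) w"
        using that(2) by (auto simp: lookup_add lookup_single when_def)
    qed
    have 2: "b - unit_exp v = a" if "b = a + unit_exp v" using that by simp
    show "cf (Poly_Mapping.single (b - unit_exp v) (of_nat (cf b v) * cf f b)) a =
        (if b = a + unit_exp v then of_nat (cf b v) * cf f b else 0)"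
    proof (cases "cf b v = 0")
      case True
      then have "b \<noteq> a + unit_exp v" by (auto simp: lookup_add)
      then show ?thesis using True by simp
    next
      case False
      then have "b - unit_exp v = a \<longleftrightarrow> b = a + unit_exp v" using 1 2 by blast
      then show ?thesis by (simp only: lookup_single when_def)
    qed
  qed
  also have "\<dots> = of_nat (Suc (cf a v)) * cf f (a + unit_exp v)"
    by (auto simp: in_keys_iff lookup_add)
  finally show ?thesis .
qed

lemma partial_add: "cpoly_partial v (f + g) = cpoly_partial v f + cpoly_partial v g"
  by (rule poly_mapping_eqI) (simp add: lookup_partial lookup_add algebra_simps)

lemma partial_scale: "cpoly_partial v (cpoly_scale c f) = cpoly_scale c (cpoly_partial v f)"
  by (rule poly_mapping_eqI) (simp add: lookup_partial)

lemma partial_commute: "cpoly_partial v (cpoly_partial w f) = cpoly_partial w (cpoly_partial v f)"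
  by (cases "v = w")
    (auto intro!: poly_mapping_eqI simp: lookup_partial lookup_add lookup_single algebra_simps)

lemma partial_single:
  "cpoly_partial v (Poly_Mapping.single a c) = Poly_Mapping.single (a - unit_exp v) (of_nat (cf a v) * c)"
  by (cases "c = 0") (simp_all add: cpoly_partial_def)

lemma partial_mult: "cpoly_partial v (f * g) = cpoly_partial v f * g + f * cpoly_partial v g"
proof (induction f rule: cpoly_induct)
  case (single a c)
  show ?case
  proof (induction g rule: cpoly_induct)
    case (single b d)
    have 1: "a - unit_exp v + b = a + b - unit_exp v" if "cf a v \<noteq> 0"
      by (rule poly_mapping_eqI) (use that in \<open>auto simp: lookup_add lookup_minus lookup_single when_def\<close>)
    have 2: "a + (b - unit_exp v) = a + b - unit_exp v" if "cf b v \<noteq> 0"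
      by (rule poly_mapping_eqI) (use that in \<open>auto simp: lookup_add lookup_minus lookup_single when_def\<close>)
    show ?case
      using 1 2 by (cases "cf a v = 0"; cases "cf b v = 0")
        (simp_all add: partial_single mult_single lookup_add algebra_simps flip: single_add)
  qed (simp add: partial_add distrib_left algebra_simps)
qed (simp add: partial_add distrib_right algebra_simps)

section \<open>Iterated derivatives and the multiplicity of products\<close>

definition partials :: "'v list \<Rightarrow> 'v cpoly \<Rightarrow> 'v cpoly" where
  "partials vs = fold cpoly_partial vs"

lemma partials_Nil [simp]: "partials [] f = f"
  and partials_Cons [simp]: "partials (v # vs) f = partials vs (cpoly_partial v f)"
  by (simp_all add: partials_def)

lemma partials_mset: "mset vs = mset ws \<Longrightarrow> partials vs f = partials ws f"
  unfolding partials_def by (rule fun_cong, rule fold_multiset_equiv) (auto simp: fun_eq_iff partial_commute)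

lemma partials_add: "partials vs (f + g) = partials vs f + partials vs g"
  by (induction vs arbitrary: f g) (simp_all add: partial_add)

lemma partials_scale: "partials vs (cpoly_scale c f) = cpoly_scale c (partials vs f)"
  by (induction vs arbitrary: f) (simp_all add: partial_scale)

lemma partials_0 [simp]: "partials vs 0 = 0"
  using partials_add[of vs 0 0] by simp

lemma partials_sum: "partials vs (sum f A) = (\<Sum>i\<in>A. partials vs (f i))"
  by (induction A rule: infinite_finite_induct) (simp_all add: partials_add)

abbreviation point_eval :: "complex^4 \<Rightarrow> 4 cpoly \<Rightarrow> complex" where
  "point_eval z \<equiv> cpoly_eval (\<lambda>j. z $ j)"

lemma mult_at_least_alt: "mult_at_least m z f \<longleftrightarrow> (\<forall>vs. length vs < m \<longrightarrow> point_eval z (partials vs f) = 0)"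
  by (simp add: mult_at_least_def partials_def)

lemma mult_at_least_0 [simp]: "mult_at_least 0 z f"
  by (simp add: mult_at_least_alt)

lemma mult_at_least_Suc:
  "mult_at_least (Suc m) z f \<longleftrightarrow> point_eval z f = 0 \<and> (\<forall>v. mult_at_least m z (cpoly_partial v f))"
proof
  assume f: "mult_at_least (Suc m) z f"
  have "point_eval z (partials vs f) = 0" if "length vs < Suc m" for vs
    using f that by (simp add: mult_at_least_alt)
  from this[of "[]"] this[of "_ # _"] show "point_eval z f = 0 \<and> (\<forall>v. mult_at_least m z (cpoly_partial v f))"
    by (simp add: mult_at_least_alt)
next
  assume f: "point_eval z f = 0 \<and> (\<forall>v. mult_at_least m z (cpoly_partial v f))"
  show "mult_at_least (Suc m) z f" unfolding mult_at_least_alt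
  proof (intro allI impI)
    fix vs :: "4 list" assume "length vs < Suc m"
    then show "point_eval z (partials vs f) = 0" using f by (cases vs) (auto simp: mult_at_least_alt)
  qed
qed

lemma mult_at_least_add: "mult_at_least m z f \<Longrightarrow> mult_at_least m z g \<Longrightarrow> mult_at_least m z (f + g)"
  by (simp add: mult_at_least_alt partials_add)

lemma mult_at_least_scale: "mult_at_least m z f \<Longrightarrow> mult_at_least m z (cpoly_scale c f)"
  by (simp add: mult_at_least_alt partials_scale)

lemma mult_at_least_mono: "mult_at_least m z f \<Longrightarrow> n \<le> m \<Longrightarrow> mult_at_least n z f"
  by (simp add: mult_at_least_alt)

lemma mult_at_least_times: "mult_at_least m z f \<Longrightarrow> mult_at_least m z (g * f)"
proof (induction m arbitrary: f g)
  case (Suc m)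
  have "mult_at_least m z f" using Suc.prems mult_at_least_mono by fastforce
  then show ?case using Suc by (auto simp: mult_at_least_Suc partial_mult intro!: mult_at_least_add)
qed simp

lemma mult_at_least_times_Suc:
  assumes "point_eval z q = 0"
  shows "mult_at_least m z f \<Longrightarrow> mult_at_least (Suc m) z (q * f)"
proof (induction m arbitrary: f)
  case 0
  then show ?case using assms by (simp add: mult_at_least_Suc)
next
  case (Suc m)
  have "mult_at_least (Suc m) z (cpoly_partial v (q * f))" for v
    unfolding partial_mult using Suc by (intro mult_at_least_add mult_at_least_times Suc.IH) (auto simp: mult_at_least_Suc)
  then show ?case using assms by (subst mult_at_least_Suc) simp
qed

lemma mult_at_least_power_times:
  assumes "point_eval z q = 0" "mult_at_least m z f"
  shows "mult_at_least (k + m) z (q ^ k * f)"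
  by (induction k) (use assms mult_at_least_times_Suc[OF assms(1)] in \<open>auto simp: mult.assoc\<close>)

text \<open>In the Leibniz expansion a term with a derivative on \<open>g\<close> leaves fewer than
  \<open>length vs\<close> derivatives on \<open>f\<close>, and these vanish at
  \<open>z\<close>.\<close>

lemma eval_partials_times:
  "mult_at_least (length vs) z f \<Longrightarrow>
    point_eval z (partials vs (g * f)) = point_eval z g * point_eval z (partials vs f)"
proof (induction vs arbitrary: f g)
  case (Cons v vs)
  have "mult_at_least (Suc (length vs)) z (cpoly_partial v g * f)"
    using Cons.prems by (intro mult_at_least_times) simp
  then have "point_eval z (partials vs (cpoly_partial v g * f)) = 0" by (simp add: mult_at_least_alt)
  then show ?case using Cons.IH[of "cpoly_partial v f" g] Cons.prems
    by (simp add: partial_mult partials_add mult_at_least_Suc)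
qed simp

text \<open>Leibniz expansion in which only the terms that differentiate \<open>q\<close> exactly once, in the
  direction \<open>v\<close>, survive.\<close>

lemma eval_partials_times_smooth:
  assumes "point_eval z q = 0"
  shows "length us = Suc m \<Longrightarrow> mult_at_least m z f \<Longrightarrow>
    (\<And>w. w \<in> set us \<Longrightarrow> w \<noteq> v \<Longrightarrow> point_eval z (partials (remove1 w us) f) = 0) \<Longrightarrow>
    point_eval z (partials us (q * f)) =
      of_nat (count (mset us) v) * point_eval z (cpoly_partial v q) * point_eval z (partials (remove1 v us) f)"
proof (induction us arbitrary: m f)
  case (Cons u us)
  have first: "point_eval z (partials us (cpoly_partial u q * f)) =
      (if u = v then point_eval z (cpoly_partial v q) * point_eval z (partials us f) else 0)"
    using Cons.prems(3)[of u] Cons.prems(1,2) by (auto simp: eval_partials_times)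
  have second: "point_eval z (partials us (q * cpoly_partial u f)) =
      of_nat (count (mset us) v) * point_eval z (cpoly_partial v q) * point_eval z (partials (remove1 v (u # us)) f)"
  proof (cases m)
    case 0
    then show ?thesis using Cons.prems(1) assms by simp
  next
    case (Suc n)
    have eq: "partials (remove1 w us) (cpoly_partial u f) = partials (remove1 w (u # us)) f" if "w \<in> set us" for w
    proof -
      have "partials (u # remove1 w us) f = partials (remove1 w (u # us)) f"
        using that by (intro partials_mset) auto
      then show ?thesis by simp
    qed
    have "point_eval z (partials us (q * cpoly_partial u f)) =
      of_nat (count (mset us) v) * point_eval z (cpoly_partial v q) * point_eval z (partials (remove1 v us) (cpoly_partial u f))"
    proof (rule Cons.IH)
      show "length us = Suc n" using Cons.prems(1) Suc by simp
      show "mult_at_least n z (cpoly_partial u f)" using Cons.prems(2) Suc by (simp add: mult_at_least_Suc)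
      show "point_eval z (partials (remove1 w us) (cpoly_partial u f)) = 0" if "w \<in> set us" "w \<noteq> v" for w
        unfolding eq[OF that(1)] using Cons.prems(3)[of w] that by simp
    qed
    then show ?thesis using eq[of v] by (cases "v \<in> set us") (auto simp: count_eq_zero_iff)
  qed
  show ?case using first second by (auto simp: partial_mult partials_add algebra_simps)
qed simp

text \<open>Division by a surface that is smooth at \<open>z\<close> lowers the multiplicity by at
  most one. Smoothness enters through one direction \<open>v\<close> in which the derivative of
  \<open>q\<close> is nonzero.\<close>

lemma mult_at_least_times_cancel:
  assumes q: "point_eval z q = 0" "point_eval z (cpoly_partial v q) \<noteq> 0"
  shows "mult_at_least (Suc m) z (q * f) \<Longrightarrow> mult_at_least m z f"
proof (induction m)
  case (Suc m)
  have IH: "mult_at_least m z f" using Suc mult_at_least_mono by fastforce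
  have *: "point_eval z (partials us f) = 0" if "length us = m" for us
    using that
  \<comment> \<open>Induction on the number of derivatives in directions other than
    \<open>v\<close>. Differentiate \<open>q * f\<close> along \<open>v # us\<close>: a term that
    loses some \<open>w\<close> other than \<open>v\<close> keeps one more \<open>v\<close> and
    vanishes by induction. What remains is a nonzero multiple of the derivative of \<open>f\<close>
    along \<open>us\<close>.\<close>
  proof (induction "m - count (mset us) v" arbitrary: us rule: less_induct)
    case less
    have "point_eval z (partials (v # us) (q * f)) = 0"
      using Suc.prems less.prems unfolding mult_at_least_alt by (metis length_Cons lessI)
    moreover have "point_eval z (partials (v # us) (q * f)) = of_nat (count (mset (v # us)) v) *
        point_eval z (cpoly_partial v q) * point_eval z (partials (remove1 v (v # us)) f)"
    proof (rule eval_partials_times_smooth[OF q(1) _ IH])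
      fix w assume w: "w \<in> set (v # us)" "w \<noteq> v"
      have "count (mset us) v < m"
      proof -
        have "count (mset us) v < length us"
          using w length_filter_less[of w us "\<lambda>y. v = y"] by (auto simp: count_mset count_list_eq_length_filter)
        then show ?thesis using less.prems by simp
      qed
      then show "point_eval z (partials (remove1 w (v # us)) f) = 0"
        using w less.prems by (intro less.hyps) (auto simp: length_remove1)
    qed (use less.prems in simp)
    ultimately show ?case using q(2) by (simp add: of_nat_eq_0_iff del: of_nat_Suc)
  qed
  show ?case unfolding mult_at_least_alt
  proof (intro allI impI)
    fix vs :: "4 list" assume "length vs < Suc m"
    then show "point_eval z (partials vs f) = 0"
      using * IH by (cases "length vs = m") (auto simp: mult_at_least_alt)
  qed
qed simp

section \<open>Dimensions of linear systems\<close>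

context vector_space
begin

text \<open>The space of all polynomials has infinite dimension. Therefore the comparisons of
  dimensions carry a finite set \<open>F\<close> that spans a space containing those
  compared.\<close>

lemma card_le_dim:
  assumes "independent S" "S \<subseteq> V" "V \<subseteq> span F" "finite F"
  shows "finite S \<and> card S \<le> dim V"
proof -
  obtain B where B: "B \<subseteq> V" "independent B" "V \<subseteq> span B" "card B = dim V" using basis_exists by blast
  have "finite B" using independent_span_bound[OF assms(4) B(2)] B(1) assms(3) by blast
  then show ?thesis using independent_span_bound[OF _ assms(1)] assms(2) B by (metis subset_trans)
qed

lemma dim_le_dim_of_subset:
  assumes "V \<subseteq> W" "W \<subseteq> span F" "finite F"
  shows "dim V \<le> dim W"
proof -
  obtain B where B: "B \<subseteq> V" "independent B" "V \<subseteq> span B" "card B = dim V" using basis_exists by blast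
  then show ?thesis using card_le_dim[OF B(2) _ assms(2,3)] assms(1) by auto
qed

lemma subspace_eq_of_dim_le:
  assumes "subspace W" "W \<subseteq> V" "V \<subseteq> span F" "finite F" "dim V \<le> dim W"
  shows "W = V"
proof (rule ccontr)
  assume "W \<noteq> V"
  then obtain v where v: "v \<in> V" "v \<notin> W" using assms(2) by blast
  obtain B where B: "B \<subseteq> W" "independent B" "W \<subseteq> span B" "card B = dim W" using basis_exists by blast
  have "span B \<subseteq> W" using B(1) assms(1) by (simp add: span_minimal)
  then have "v \<notin> span B" using v by blast
  then have ind: "independent (insert v B)" using B(2) by (simp add: independent_insert)
  have "finite (insert v B) \<and> card (insert v B) \<le> dim V"
    using B v assms by (intro card_le_dim[OF ind _ assms(3,4)]) auto
  moreover have "v \<notin> B" using v B by blast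
  ultimately show False using B(4) assms(5) by auto
qed

lemma dim_le_kernel_Suc:
  assumes V: "subspace V" "V \<subseteq> span F" "finite F"
    and add: "\<And>x y. \<phi> (x + y) = \<phi> x + \<phi> y" and scale: "\<And>c x. \<phi> (scale c x) = c * \<phi> x"
  shows "dim V \<le> Suc (dim {v \<in> V. \<phi> v = 0})"
proof -
  let ?W = "{v \<in> V. \<phi> v = 0}"
  obtain B where B: "B \<subseteq> ?W" "independent B" "?W \<subseteq> span B" "card B = dim ?W" using basis_exists by blast
  have finB: "finite B" using card_le_dim[OF B(2) _ V(2,3)] B(1) by blast
  show ?thesis
  proof (cases "\<exists>v0\<in>V. \<phi> v0 \<noteq> 0")
    case False
    then have "?W = V" by auto
    then show ?thesis by simp
  next
    case True
    then obtain v0 where v0: "v0 \<in> V" "\<phi> v0 \<noteq> 0" by blast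
    have "V \<subseteq> span (insert v0 B)"
    proof
      fix v assume v: "v \<in> V"
      let ?c = "\<phi> v / \<phi> v0"
      have m: "\<phi> (v - scale ?c v0) = 0"
        using add[of "v - scale ?c v0" "scale ?c v0"] scale[of ?c v0] v0(2) by simp
      have "v - scale ?c v0 \<in> ?W" using v v0(1) V(1) m by (simp add: subspace_diff subspace_scale)
      then have "v - scale ?c v0 \<in> span (insert v0 B)" using B(3) span_mono[of B "insert v0 B"] by blast
      moreover have "scale ?c v0 \<in> span (insert v0 B)" by (intro span_scale span_base) simp
      ultimately have "v - scale ?c v0 + scale ?c v0 \<in> span (insert v0 B)" by (rule span_add)
      then show "v \<in> span (insert v0 B)" by simp
    qed
    then have "dim V \<le> card (insert v0 B)" using finB by (intro dim_le_card) auto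
    also have "\<dots> \<le> Suc (dim ?W)" using card_insert_le_m1 B(4) finB by (metis card_insert_if le_SucI order_refl)
    finally show ?thesis .
  qed
qed

lemma dim_le_kernel_card:
  assumes "finite I" and V: "subspace V" "V \<subseteq> span F" "finite F"
    and add: "\<And>i x y. i \<in> I \<Longrightarrow> \<phi> i (x + y) = \<phi> i x + \<phi> i y"
    and scale: "\<And>i c x. i \<in> I \<Longrightarrow> \<phi> i (scale c x) = c * \<phi> i x"
  shows "dim V \<le> dim {v \<in> V. \<forall>i\<in>I. \<phi> i v = 0} + card I"
  using assms
proof (induction I arbitrary: V rule: finite_induct)
  case (insert i I)
  let ?V = "{v \<in> V. \<phi> i v = 0}"
  have 0: "\<phi> i 0 = 0" using insert.prems(5)[of i 0 0] by simp
  have sub: "subspace ?V"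
    using insert.prems 0 by (intro subspaceI) (auto simp: subspace_0 subspace_add subspace_scale)
  have "dim V \<le> Suc (dim ?V)" using insert.prems by (intro dim_le_kernel_Suc) auto
  also have "dim ?V \<le> dim {v \<in> ?V. \<forall>i\<in>I. \<phi> i v = 0} + card I"
    using insert.prems sub by (intro insert.IH) auto
  also have "{v \<in> ?V. \<forall>i\<in>I. \<phi> i v = 0} = {v \<in> V. \<forall>i\<in>insert i I. \<phi> i v = 0}" by auto
  finally show ?case using insert.hyps by simp
qed simp

text \<open>Each functional chosen is nonzero on the common kernel of the previous ones, so it
  lowers the dimension. The lemma serves to pick as many coefficients as the dimension that
  determine every member of a linear system.\<close>

lemma separating_functionals:
  assumes V: "subspace V" "V \<subseteq> span F" "finite F"
    and "finite M"
    and add: "\<And>i x y. i \<in> M \<Longrightarrow> \<phi> i (x + y) = \<phi> i x + \<phi> i y"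
    and scale: "\<And>i c x. i \<in> M \<Longrightarrow> \<phi> i (scale c x) = c * \<phi> i x"
    and sep: "\<And>v. v \<in> V \<Longrightarrow> (\<forall>i\<in>M. \<phi> i v = 0) \<Longrightarrow> v = 0"
  shows "\<exists>R\<subseteq>M. card R \<le> dim V \<and> (\<forall>v\<in>V. (\<forall>i\<in>R. \<phi> i v = 0) \<longrightarrow> v = 0)"
  using V sep
proof (induction "dim V" arbitrary: V rule: less_induct)
  case less
  show ?case
  proof (cases "V \<subseteq> {0}")
    case True
    then show ?thesis by (intro exI[of _ "{}"]) auto
  next
    case False
    then obtain v0 i where i: "v0 \<in> V" "i \<in> M" "\<phi> i v0 \<noteq> 0" using less.prems(4) by blast
    let ?V = "{v \<in> V. \<phi> i v = 0}"
    have 0: "\<phi> i 0 = 0" using scale[OF i(2), of 0 0] by simp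
    have sub: "subspace ?V"
      using less.prems(1) 0 i(2) by (intro subspaceI) (auto simp: subspace_0 subspace_add subspace_scale add scale)
    have lt: "dim ?V < dim V"
    proof (rule ccontr)
      assume "\<not> dim ?V < dim V"
      then have "?V = V" by (intro subspace_eq_of_dim_le[OF sub _ less.prems(2,3)]) auto
      then show False using i by blast
    qed
    have "\<exists>R\<subseteq>M. card R \<le> dim ?V \<and> (\<forall>v\<in>?V. (\<forall>i\<in>R. \<phi> i v = 0) \<longrightarrow> v = 0)"
      using less.prems sub by (intro less.hyps[OF lt]) auto
    then obtain R where R: "R \<subseteq> M" "card R \<le> dim ?V" "\<forall>v\<in>?V. (\<forall>i\<in>R. \<phi> i v = 0) \<longrightarrow> v = 0" by blast
    have "finite R" using R(1) \<open>finite M\<close> finite_subset by blast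
    then have "card (insert i R) \<le> dim V" using R(2) lt by (simp add: card_insert_if)
    then show ?thesis using R i(2) by (intro exI[of _ "insert i R"]) auto
  qed
qed

end

section \<open>Spaces of forms and the count of conditions\<close>

definition monomials :: "nat \<Rightarrow> ('v::finite \<Rightarrow>\<^sub>0 nat) set" where
  "monomials d = {a. total_degree a = d}"

lemma card_monomials:
  "finite (monomials d :: ('v::finite \<Rightarrow>\<^sub>0 nat) set) \<and>
    card (monomials d :: ('v \<Rightarrow>\<^sub>0 nat) set) = (d + CARD('v) - 1) choose d"
proof -
  obtain xs :: "'v list" where xs: "set xs = UNIV" "distinct xs" using finite_distinct_list[of "UNIV :: 'v set"] by auto
  then have len: "length xs = CARD('v)" using distinct_card by fastforce
  have deg: "total_degree a = sum_list (map (cf a) xs)" for a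
    using xs by (simp add: total_degree_def sum_list_distinct_conv_sum_set)
  let ?L = "{l::nat list. length l = CARD('v) \<and> sum_list l = d}"
  have bij: "bij_betw (\<lambda>a. map (cf a) xs) (monomials d) ?L"
  proof (rule bij_betw_imageI)
    show "inj_on (\<lambda>a. map (cf a) xs) (monomials d)"
      using xs(1) by (auto intro!: inj_onI poly_mapping_eqI)
    show "(\<lambda>a. map (cf a) xs) ` monomials d = ?L"
    proof (intro equalityI subsetI)
      fix l assume "l \<in> (\<lambda>a. map (cf a) xs) ` monomials d"
      then show "l \<in> ?L" using xs len
        by (auto simp: monomials_def deg)
    next
      fix l assume l: "l \<in> ?L"
      define a where "a = Abs_poly_mapping (\<lambda>v. the (map_of (zip xs l) v))"
      have a: "cf a v = the (map_of (zip xs l) v)" for v by (simp add: a_def)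
      have "map (cf a) xs = l"
        using l len xs(2) by (intro nth_equalityI) (auto simp: a map_of_zip_nth)
      moreover have "a \<in> monomials d"
        using l \<open>map (cf a) xs = l\<close> by (simp add: monomials_def deg)
      ultimately show "l \<in> (\<lambda>a. map (cf a) xs) ` monomials d" by blast
    qed
  qed
  have "finite ?L" 
  proof (rule finite_subset)
    show "?L \<subseteq> {l. set l \<subseteq> {..d} \<and> length l = CARD('v)}" using member_le_sum_list by fastforce
  qed (simp add: finite_lists_length_eq)
  then show ?thesis
    using bij bij_betw_finite bij_betw_same_card[OF bij] card_length_sum_list[of "CARD('v)" d] by auto
qed

lemma finite_monomials [simp]: "finite (monomials d)"
  using card_monomials by blast

lemma card_monomials_4: "card (monomials d :: (4 \<Rightarrow>\<^sub>0 nat) set) = (d + 3) choose 3"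
proof -
  have "card (monomials d :: (4 \<Rightarrow>\<^sub>0 nat) set) = (d + 4 - 1) choose d" using card_monomials[of d, where 'v = 4] by simp
  also have "\<dots> = (d + 3) choose 3" using binomial_symmetric[of d "d + 3"] by (simp add: add.commute)
  finally show ?thesis .
qed

lemma homogeneous_keys: "homogeneous d f \<longleftrightarrow> Poly_Mapping.keys f \<subseteq> monomials d"
  by (auto simp: homogeneous_alt monomials_def in_keys_iff)

lemma homogeneous_0 [simp]: "homogeneous d 0"
  by (simp add: homogeneous_alt)

lemma homogeneous_add: "homogeneous d f \<Longrightarrow> homogeneous d g \<Longrightarrow> homogeneous d (f + g)"
  unfolding homogeneous_alt lookup_add by (metis add_0)

lemma homogeneous_scale: "homogeneous d f \<Longrightarrow> homogeneous d (cpoly_scale c f)"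
  by (simp add: homogeneous_alt)

lemma homogeneous_sum: "(\<And>i. i \<in> I \<Longrightarrow> homogeneous d (f i)) \<Longrightarrow> homogeneous d (sum f I)"
  by (induction I rule: infinite_finite_induct) (auto intro: homogeneous_add)

lemma homogeneous_single: "total_degree a = d \<Longrightarrow> homogeneous d (Poly_Mapping.single a c)"
  by (auto simp: homogeneous_alt lookup_single when_def)

lemma homogeneous_mult: "homogeneous d f \<Longrightarrow> homogeneous e g \<Longrightarrow> homogeneous (d + e) (f * g)"
  unfolding homogeneous_keys monomials_def using keys_mult[of f g] by (fastforce simp: total_degree_add)

lemma homogeneous_partial: "homogeneous d f \<Longrightarrow> homogeneous (d - 1) (cpoly_partial v f)"
  by (auto simp: homogeneous_alt lookup_partial total_degree_add)

lemma homogeneous_partials: "homogeneous d f \<Longrightarrow> homogeneous (d - length vs) (partials vs f)"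
proof (induction vs arbitrary: d f)
  case (Cons v vs)
  from Cons.IH[OF homogeneous_partial[OF Cons.prems]] show ?case by simp
qed simp

lemma homogeneous_expand:
  assumes "homogeneous d f"
  shows "f = (\<Sum>a\<in>monomials d. cpoly_scale (cf f a) (Poly_Mapping.single a 1))"
proof (rule poly_mapping_eqI)
  fix b
  have "cf (\<Sum>a\<in>monomials d. cpoly_scale (cf f a) (Poly_Mapping.single a 1)) b = (\<Sum>a\<in>monomials d. if a = b then cf f a else 0)"
    unfolding lookup_sum by (intro sum.cong) (auto simp: lookup_single when_def)
  then show "cf f b = cf (\<Sum>a\<in>monomials d. cpoly_scale (cf f a) (Poly_Mapping.single a 1)) b"
    using assms by (auto simp: homogeneous_keys in_keys_iff)
qed

abbreviation forms :: "nat \<Rightarrow> 'v::finite cpoly set" where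
  "forms d \<equiv> {f. homogeneous d f}"

abbreviation monomial_forms :: "nat \<Rightarrow> 'v::finite cpoly set" where
  "monomial_forms d \<equiv> (\<lambda>a. Poly_Mapping.single a 1) ` monomials d"

lemma forms_subset_span: "forms d \<subseteq> cpoly.span (monomial_forms d)"
proof
  fix f :: "'a cpoly" assume "f \<in> forms d"
  then have f: "f = (\<Sum>a\<in>monomials d. cpoly_scale (cf f a) (Poly_Mapping.single a 1))"
    by (intro homogeneous_expand) simp
  show "f \<in> cpoly.span (monomial_forms d)"
    by (subst f) (intro cpoly.span_sum cpoly.span_scale cpoly.span_base imageI)
qed

lemma subspace_forms: "cpoly.subspace (forms d)"
  by (intro cpoly.subspaceI) (auto intro: homogeneous_add homogeneous_scale)

lemma dim_forms: "card (monomials d :: ('v::finite \<Rightarrow>\<^sub>0 nat) set) \<le> cpoly.dim (forms d :: 'v cpoly set)"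
proof -
  let ?S = "monomial_forms d :: 'v cpoly set"
  have inj: "inj (\<lambda>a. Poly_Mapping.single a 1 :: 'v cpoly)" by (auto intro!: injI dest: poly_mapping_eq_iff[THEN iffD1] simp: fun_eq_iff lookup_single when_def split: if_splits)
  have ind: "cpoly.independent ?S"
  proof (rule cpoly.independent_if_scalars_zero)
    fix u and x :: "'v cpoly"
    assume u: "(\<Sum>x\<in>?S. cpoly_scale (u x) x) = 0" and x: "x \<in> ?S"
    then obtain b where b: "b \<in> monomials d" "x = Poly_Mapping.single b 1" by blast
    have "(\<Sum>a\<in>monomials d. cpoly_scale (u (Poly_Mapping.single a 1)) (Poly_Mapping.single a 1)) = (0 :: 'v cpoly)"
      using u by (subst (asm) sum.reindex) (auto intro: inj_on_subset[OF inj])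
    then have "cf (\<Sum>a\<in>monomials d. cpoly_scale (u (Poly_Mapping.single a 1)) (Poly_Mapping.single a 1)) b = 0" by simp
    moreover have "cf (\<Sum>a\<in>monomials d. cpoly_scale (u (Poly_Mapping.single a 1)) (Poly_Mapping.single a 1)) b
        = (\<Sum>a\<in>monomials d. if a = b then u (Poly_Mapping.single a 1) else 0)"
      unfolding lookup_sum by (intro sum.cong) (auto simp: lookup_single when_def)
    ultimately show "u x = 0" using b by simp
  qed simp
  have "?S \<subseteq> forms d" by (auto simp: monomials_def intro: homogeneous_single)
  from cpoly.card_le_dim[OF ind this forms_subset_span]
  have "card ?S \<le> cpoly.dim (forms d :: 'v cpoly set)" by simp
  then show ?thesis by (simp add: card_image inj_on_subset[OF inj])
qed

lemma subspace_linear_system: "cpoly.subspace (linear_system d p m)"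
  by (intro cpoly.subspaceI)
    (auto simp: linear_system_def intro: homogeneous_add homogeneous_scale mult_at_least_add mult_at_least_scale,
     simp add: mult_at_least_alt)

lemma linear_system_subset_span: "linear_system d p m \<subseteq> cpoly.span (monomial_forms d)"
  using forms_subset_span by (force simp: linear_system_def)

lemma euler_identity:
  assumes "homogeneous d f"
  shows "(\<Sum>v\<in>UNIV. x v * cpoly_eval x (cpoly_partial v f)) = of_nat d * cpoly_eval x f"
proof -
  have single: "(\<Sum>v\<in>UNIV. x v * cpoly_eval x (cpoly_partial v (Poly_Mapping.single a c))) =
      of_nat (total_degree a) * cpoly_eval x (Poly_Mapping.single a c)" for a c
  proof -
    have "x v * cpoly_eval x (cpoly_partial v (Poly_Mapping.single a c)) = of_nat (cf a v) * (c * monom_eval x a)" for v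
    proof (cases "cf a v = 0")
      case False
      have "a = (a - unit_exp v) + unit_exp v"
        by (rule poly_mapping_eqI) (use False in \<open>auto simp: lookup_add lookup_minus lookup_single when_def\<close>)
      then have "monom_eval x a = monom_eval x (a - unit_exp v) * x v" by (metis monom_eval_add monom_eval_unit)
      then show ?thesis by (simp add: partial_single)
    qed (simp add: partial_single)
    then show ?thesis by (simp add: total_degree_def sum_distrib_right)
  qed
  have f: "f = (\<Sum>a\<in>monomials d. cpoly_scale (cf f a) (Poly_Mapping.single a 1))"
    using assms by (rule homogeneous_expand)
  have partial_sum: "cpoly_partial v (\<Sum>a\<in>A. h a) = (\<Sum>a\<in>A. cpoly_partial v (h a))" for v A and h :: "('a \<Rightarrow>\<^sub>0 nat) \<Rightarrow> 'a cpoly"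
    using partials_sum[of "[v]" h A] by simp
  have "(\<Sum>v\<in>UNIV. x v * cpoly_eval x (cpoly_partial v f)) =
      (\<Sum>v\<in>UNIV. \<Sum>a\<in>monomials d. cf f a * (x v * cpoly_eval x (cpoly_partial v (Poly_Mapping.single a 1))))"
    by (subst f) (simp add: partial_sum cpoly_eval_sum partial_scale sum_distrib_left mult.left_commute)
  also have "\<dots> = (\<Sum>a\<in>monomials d. cf f a * (\<Sum>v\<in>UNIV. x v * cpoly_eval x (cpoly_partial v (Poly_Mapping.single a 1))))"
    by (subst sum.swap) (simp add: sum_distrib_left)
  also have "\<dots> = (\<Sum>a\<in>monomials d. of_nat d * (cf f a * cpoly_eval x (Poly_Mapping.single a 1)))"
    by (intro sum.cong) (auto simp: single monomials_def)
  also have "\<dots> = of_nat d * cpoly_eval x f"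
    by (subst (2) f) (simp add: cpoly_eval_sum sum_distrib_left)
  finally show ?thesis .
qed

lemma partials_append: "partials (us @ vs) f = partials vs (partials us f)"
  by (simp add: partials_def)

text \<open>For forms, Euler's identity reduces the multiplicity conditions to the derivatives of the
  top order.\<close>

lemma mult_at_least_form:
  assumes "homogeneous d f" "m \<le> d" "\<And>vs. length vs = m \<Longrightarrow> point_eval z (partials vs f) = 0"
  shows "mult_at_least (Suc m) z f"
proof -
  have "point_eval z (partials vs f) = 0" if "length vs \<le> m" for vs
    using that
  proof (induction "m - length vs" arbitrary: vs)
    case 0
    then show ?case using assms(3) by simp
  next
    case (Suc n)
    have "point_eval z (cpoly_partial v (partials vs f)) = 0" for v
      using Suc.hyps(1)[of "vs @ [v]"] Suc.hyps(2) by (simp add: partials_append)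
    then have "of_nat (d - length vs) * point_eval z (partials vs f) = 0"
      using euler_identity[OF homogeneous_partials[OF assms(1)], of "\<lambda>j. z $ j" vs] by simp
    moreover have "d - length vs \<noteq> 0" using Suc.hyps(2) assms(2) by linarith
    ultimately show ?case by simp
  qed
  then show ?thesis by (simp add: mult_at_least_alt)
qed

text \<open>Only derivatives of order exactly m_i - 1 need to be killed, and up to order of
  differentiation these correspond to the monomials of degree m_i - 1 in four variables. The
  hypothesis places this order at most at \<open>d\<close>, where Euler's identity yields the lower
  ones.\<close>

lemma vdim_le_ls_dim:
  fixes p :: "'s::finite \<Rightarrow> complex^4"
  assumes "\<And>i. m i \<le> Suc d"
  shows "vdim d m \<le> int (ls_dim d p m)"
proof -
  define I where "I = (SIGMA i:UNIV. (if m i = 0 then {} else monomials (m i - 1) :: (4 \<Rightarrow>\<^sub>0 nat) set))"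
  \<comment> \<open>Some list of variables with the multiplicities prescribed by \<open>b\<close>;
    since derivatives commute, any choice gives the same condition.\<close>
  define as_list where "as_list = (\<lambda>b :: 4 \<Rightarrow>\<^sub>0 nat. SOME vs. \<forall>v. count (mset vs) v = cf b v)"
  have as_list: "mset (as_list b) = mset vs" if "\<And>v. cf b v = count (mset vs) v" for b vs
    unfolding as_list_def by (rule multiset_eqI, rule someI2[of _ vs]) (use that in auto)
  define \<phi> where "\<phi> = (\<lambda>(i, b) f. point_eval (p i) (partials (as_list b) f))"
  have finI: "finite I" unfolding I_def by (intro finite_SigmaI) auto
  have "cpoly.dim (forms d :: 4 cpoly set) \<le> cpoly.dim {f \<in> forms d. \<forall>i\<in>I. \<phi> i f = 0} + card I"
    by (rule cpoly.dim_le_kernel_card[OF finI subspace_forms forms_subset_span])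
      (auto simp: \<phi>_def partials_add partials_scale)
  also have "cpoly.dim {f \<in> forms d. \<forall>i\<in>I. \<phi> i f = 0} \<le> ls_dim d p m"
    unfolding ls_dim_def
  proof (rule cpoly.dim_le_dim_of_subset[OF _ linear_system_subset_span])
    show "{f \<in> forms d. \<forall>i\<in>I. \<phi> i f = 0} \<subseteq> linear_system d p m"
    proof
      fix f assume f: "f \<in> {f \<in> forms d. \<forall>i\<in>I. \<phi> i f = 0}"
      have "mult_at_least (m i) (p i) f" for i
      proof (cases "m i")
        case (Suc n)
        show ?thesis unfolding Suc
        proof (rule mult_at_least_form)
          show "homogeneous d f" "n \<le> d" using f assms[of i] Suc by auto
          fix vs :: "4 list" assume vs: "length vs = n"
          define b where "b = Abs_poly_mapping (count (mset vs))"
          have b: "cf b v = count (mset vs) v" for v by (simp add: b_def)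
          have "total_degree b = n"
          proof -
            have "(\<Sum>v\<in>UNIV. count (mset vs) v) = (\<Sum>v\<in>set_mset (mset vs). count (mset vs) v)"
              by (rule sum.mono_neutral_right) auto
            also have "\<dots> = size (mset vs)" by (rule size_multiset_overloaded_eq[symmetric])
            finally show ?thesis using vs by (simp add: total_degree_def b)
          qed
          then have "(i, b) \<in> I" using Suc by (simp add: I_def monomials_def)
          then have "point_eval (p i) (partials (as_list b) f) = 0" using f by (auto simp: \<phi>_def)
          then show "point_eval (p i) (partials vs f) = 0" using partials_mset[OF as_list[OF b], of f] by simp
        qed
      qed simp
      then show "f \<in> linear_system d p m" using f by (simp add: linear_system_def)
    qed
  qed simp
  finally have "(d + 3) choose 3 \<le> ls_dim d p m + card I"
    using dim_forms[of d, where 'v = 4] by (simp add: card_monomials_4)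
  moreover have "card I = (\<Sum>i\<in>UNIV. (m i + 2) choose 3)"
    unfolding I_def
  proof (subst card_SigmaI, goal_cases)
    case 3
    show ?case
    proof (intro sum.cong refl)
      fix i
      show "card (if m i = 0 then {} else monomials (m i - 1) :: (4 \<Rightarrow>\<^sub>0 nat) set) = (m i + 2) choose 3"
        by (cases "m i") (simp_all add: card_monomials_4 eval_nat_numeral)
    qed
  qed auto
  ultimately show ?thesis unfolding vdim_def by (simp flip: of_nat_sum)
qed

section \<open>Semicontinuity\<close>

definition lift_exp :: "'s \<Rightarrow> (4 \<Rightarrow>\<^sub>0 nat) \<Rightarrow> ('s::finite \<times> 4 \<Rightarrow>\<^sub>0 nat)" where
  "lift_exp i b = Abs_poly_mapping (\<lambda>(k, j). if k = i then cf b j else 0)"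

lemma lookup_lift_exp: "cf (lift_exp i b) (k, j) = (if k = i then cf b j else 0)"
  by (simp add: lift_exp_def)

definition lift_poly :: "'s \<Rightarrow> 4 cpoly \<Rightarrow> ('s::finite \<times> 4) cpoly" where
  "lift_poly i f = (\<Sum>b\<in>Poly_Mapping.keys f. Poly_Mapping.single (lift_exp i b) (cf f b))"

lemma monom_eval_lift_exp: "monom_eval (\<lambda>(i, j). p i $ j) (lift_exp i b) = monom_eval (\<lambda>j. p i $ j) b"
proof -
  have "monom_eval (\<lambda>(i, j). p i $ j) (lift_exp i b) =
      (\<Prod>k\<in>UNIV. \<Prod>j\<in>UNIV. p k $ j ^ cf (lift_exp i b) (k, j))"
    unfolding monom_eval_def UNIV_Times_UNIV[symmetric] by (subst prod.cartesian_product) (auto intro: prod.cong)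
  also have "\<dots> = (\<Prod>k\<in>UNIV. if k = i then \<Prod>j\<in>UNIV. p i $ j ^ cf b j else 1)"
    by (intro prod.cong) (auto simp: lookup_lift_exp)
  finally show ?thesis by (simp add: monom_eval_def)
qed

lemma eval_lift_poly: "cpoly_eval (\<lambda>(i, j). p i $ j) (lift_poly i f) = point_eval (p i) f"
  unfolding lift_poly_def cpoly_eval_sum cpoly_eval_single monom_eval_lift_exp
  by (simp add: cpoly_eval_def monom_eval_def)

text \<open>The multidegree is explicit, and finitely supported functions are used for it, because
  \<open>open_injectivity\<close> asks for an additive monoid of degrees.\<close>

definition multidegree :: "('s \<Rightarrow>\<^sub>0 nat) \<Rightarrow> ('s::finite \<times> 4) cpoly \<Rightarrow> bool" where
  "multidegree e g \<longleftrightarrow> (\<forall>a. cf g a \<noteq> 0 \<longrightarrow> (\<forall>i. (\<Sum>j\<in>UNIV. cf a (i, j)) = cf e i))"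

lemma multidegree_multihomogeneous: "multidegree e g \<Longrightarrow> multihomogeneous g"
  unfolding multidegree_def multihomogeneous_def by (intro exI[of _ "cf e"]) (auto simp: in_keys_iff)

lemma multidegree_1: "multidegree 0 1"
  by (auto simp: multidegree_def lookup_one when_def)

lemma multidegree_diff: "multidegree e f \<Longrightarrow> multidegree e g \<Longrightarrow> multidegree e (f - g)"
  unfolding multidegree_def lookup_minus by (metis diff_zero diff_self)

lemma multidegree_mult:
  assumes "multidegree e f" "multidegree e' g"
  shows "multidegree (e + e') (f * g)"
  unfolding multidegree_def
proof (intro allI impI)
  fix a i assume "cf (f * g) a \<noteq> 0"
  then have "a \<in> Poly_Mapping.keys (f * g)" by (simp add: in_keys_iff)
  then obtain b c where "a = b + c" "cf f b \<noteq> 0" "cf g c \<noteq> 0" using keys_mult[of f g] by (auto simp: in_keys_iff)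
  then show "(\<Sum>j\<in>UNIV. cf a (i, j)) = cf (e + e') i"
    using assms by (simp add: multidegree_def lookup_add sum.distrib)
qed

lemma multidegree_lift_poly:
  assumes "homogeneous d f"
  shows "multidegree (Poly_Mapping.single i d) (lift_poly i f)"
  unfolding multidegree_def
proof (intro allI impI)
  fix a k assume "cf (lift_poly i f) a \<noteq> 0"
  then obtain b where b: "b \<in> Poly_Mapping.keys f" "a = lift_exp i b"
    unfolding lift_poly_def lookup_sum by (auto simp: lookup_single when_def split: if_splits elim!: sum.not_neutral_contains_not_neutral)
  have "(\<Sum>j\<in>UNIV. cf b j) = d" using b(1) assms by (auto simp: homogeneous_def)
  then show "(\<Sum>j\<in>UNIV. cf a (k, j)) = cf (Poly_Mapping.single i d) k"
    by (simp add: b(2) lookup_lift_exp lookup_single when_def)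
qed

definition multiform :: "('s::finite \<Rightarrow>\<^sub>0 nat) \<Rightarrow> (('s \<Rightarrow> complex^4) \<Rightarrow> complex) \<Rightarrow> bool" where
  "multiform e F \<longleftrightarrow> (\<exists>g. multidegree e g \<and> F = (\<lambda>p. cpoly_eval (\<lambda>(i, j). p i $ j) g))"

lemma multiform_1: "multiform 0 (\<lambda>_. 1)"
  unfolding multiform_def using multidegree_1 by (intro exI[of _ 1]) auto

lemma multiform_mult: "multiform e F \<Longrightarrow> multiform e' G \<Longrightarrow> multiform (e + e') (\<lambda>p. F p * G p)"
proof -
  assume "multiform e F" "multiform e' G"
  then obtain f g where "multidegree e f" "F = (\<lambda>p. cpoly_eval (\<lambda>(i, j). p i $ j) f)"
    "multidegree e' g" "G = (\<lambda>p. cpoly_eval (\<lambda>(i, j). p i $ j) g)" unfolding multiform_def by blast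
  then show ?thesis unfolding multiform_def using multidegree_mult by (intro exI[of _ "f * g"]) auto
qed

lemma multiform_diff: "multiform e F \<Longrightarrow> multiform e G \<Longrightarrow> multiform e (\<lambda>p. F p - G p)"
proof -
  assume "multiform e F" "multiform e G"
  then obtain f g where "multidegree e f" "F = (\<lambda>p. cpoly_eval (\<lambda>(i, j). p i $ j) f)"
    "multidegree e g" "G = (\<lambda>p. cpoly_eval (\<lambda>(i, j). p i $ j) g)" unfolding multiform_def by blast
  then show ?thesis unfolding multiform_def using multidegree_diff by (intro exI[of _ "f - g"]) auto
qed

text \<open>At \<open>p0\<close> choose a set \<open>R\<close> of at most \<open>N\<close>
  coefficients that determine the members of the system. Then no nonzero form supported off
  \<open>R\<close> satisfies the conditions at \<open>p0\<close>. This injectivity persists where a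
  suitable multiform is nonzero, and there the members are again determined by
  \<open>R\<close>.\<close>

lemma ls_dim_upper_semicontinuous:
  fixes p0 :: "'s::finite \<Rightarrow> complex^4"
  assumes "ls_dim d p0 m \<le> N"
  shows "\<exists>e F. multiform e F \<and> F p0 \<noteq> 0 \<and> (\<forall>p. F p \<noteq> 0 \<longrightarrow> ls_dim d p m \<le> N)"
proof -
  have "\<exists>R\<subseteq>monomials d. card R \<le> cpoly.dim (linear_system d p0 m) \<and>
      (\<forall>f\<in>linear_system d p0 m. (\<forall>a\<in>R. cf f a = 0) \<longrightarrow> f = 0)"
  proof (rule cpoly.separating_functionals[OF subspace_linear_system linear_system_subset_span])
    fix f :: "4 cpoly" assume "f \<in> linear_system d p0 m" "\<forall>a\<in>monomials d. cf f a = 0"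
    then show "f = 0" by (intro poly_mapping_eqI) (auto simp: linear_system_def homogeneous_keys in_keys_iff)
  qed (auto simp: lookup_add)
  then obtain R where R: "R \<subseteq> monomials d" "card R \<le> N"
    "\<And>f. f \<in> linear_system d p0 m \<Longrightarrow> (\<forall>a\<in>R. cf f a = 0) \<Longrightarrow> f = 0"
    using assms unfolding ls_dim_def by (meson order_trans)
  define B where "B = monomials d - R"
  define Rows where "Rows = {(i, vs). length (vs :: 4 list) < m (i :: 's)}"
  define A where "A = (\<lambda>(i, vs) b (p :: 's \<Rightarrow> complex^4). point_eval (p i) (partials vs (Poly_Mapping.single b 1)))"
  define comb where "comb = (\<lambda>c. \<Sum>b\<in>B. cpoly_scale (c b) (Poly_Mapping.single b 1) :: 4 cpoly)"
  have finB: "finite B" by (simp add: B_def)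
  have comb_hom: "homogeneous d (comb c)" for c
    unfolding comb_def by (intro homogeneous_sum homogeneous_scale homogeneous_single) (auto simp: B_def monomials_def)
  have comb_lookup: "cf (comb c) a = (if a \<in> B then c a else 0)" for c a
  proof -
    have "cf (comb c) a = (\<Sum>b\<in>B. if b = a then c b else 0)"
      unfolding comb_def lookup_sum by (intro sum.cong) (auto simp: lookup_single when_def)
    then show ?thesis using finB by simp
  qed
  have rows: "(\<forall>r\<in>Rows. (\<Sum>b\<in>B. c b * A r b p) = 0) \<longleftrightarrow> comb c \<in> linear_system d p m" for c p
  proof -
    have "(\<Sum>b\<in>B. c b * A (i, vs) b p) = point_eval (p i) (partials vs (comb c))" for i vs
      by (simp add: A_def comb_def partials_sum cpoly_eval_sum partials_scale)
    then show ?thesis using comb_hom by (auto simp: linear_system_def mult_at_least_alt Rows_def)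
  qed
  have "\<exists>e F. multiform e F \<and> F p0 \<noteq> 0 \<and>
    (\<forall>p. F p \<noteq> 0 \<longrightarrow> (\<forall>c. (\<forall>r\<in>Rows. (\<Sum>b\<in>B. c b * A r b p) = 0) \<longrightarrow> (\<forall>b\<in>B. c b = 0)))"
  proof (rule open_injectivity)
    fix r assume "r \<in> Rows"
    obtain i vs where r: "r = (i, vs)" by (cases r)
    have "multiform (Poly_Mapping.single i (d - length vs)) (A r b)" if "b \<in> B" for b
      unfolding multiform_def
    proof (intro exI conjI)
      show "multidegree (Poly_Mapping.single i (d - length vs)) (lift_poly i (partials vs (Poly_Mapping.single b 1)))"
        using that by (intro multidegree_lift_poly homogeneous_partials homogeneous_single) (auto simp: B_def monomials_def)
    qed (simp add: A_def r eval_lift_poly)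
    then show "\<exists>e. \<forall>b\<in>B. multiform e (A r b)" by blast
  next
    fix c assume "\<forall>r\<in>Rows. (\<Sum>b\<in>B. c b * A r b p0) = 0"
    then have "comb c = 0" unfolding rows by (rule R(3)) (auto simp: comb_lookup B_def)
    then show "\<forall>b\<in>B. c b = 0" using comb_lookup[of c] by (metis lookup_zero)
  qed (use finB multiform_1 multiform_mult multiform_diff in auto)
  then obtain e F where F: "multiform e F" "F p0 \<noteq> 0"
    "\<And>p c. F p \<noteq> 0 \<Longrightarrow> comb c \<in> linear_system d p m \<Longrightarrow> \<forall>b\<in>B. c b = 0" unfolding rows by blast
  have "ls_dim d p m \<le> N" if "F p \<noteq> 0" for p
  proof -
    have "{f \<in> linear_system d p m. \<forall>a\<in>R. cf f a = 0} \<subseteq> {0}"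
    proof
      fix f assume f: "f \<in> {f \<in> linear_system d p m. \<forall>a\<in>R. cf f a = 0}"
      have "f = comb (cf f)"
        using f by (intro poly_mapping_eqI) (auto simp: comb_lookup B_def linear_system_def homogeneous_keys in_keys_iff)
      then have "\<forall>b\<in>B. cf f b = 0" using F(3)[OF that, of "cf f"] f by simp
      then have "comb (cf f) = 0" by (intro poly_mapping_eqI) (simp add: comb_lookup)
      then show "f \<in> {0}" using \<open>f = comb (cf f)\<close> by simp
    qed
    then have "cpoly.dim {f \<in> linear_system d p m. \<forall>a\<in>R. cf f a = 0} \<le> card ({} :: 4 cpoly set)"
      by (intro cpoly.dim_le_card) auto
    moreover have "cpoly.dim (linear_system d p m) \<le> cpoly.dim {f \<in> linear_system d p m. \<forall>a\<in>R. cf f a = 0} + card R"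
      by (rule cpoly.dim_le_kernel_card[OF _ subspace_linear_system linear_system_subset_span])
        (use R(1) in \<open>auto simp: lookup_add intro: finite_subset\<close>)
    ultimately show ?thesis using R(2) by (simp add: ls_dim_def)
  qed
  then show ?thesis using F(1,2) by blast
qed

text \<open>One configuration satisfying finitely many upper bounds makes them hold for general
  points: the product of the multiforms defines the open set.\<close>

lemma for_general_points_ls_dim:
  fixes p0 :: "'s::finite \<Rightarrow> complex^4"
  assumes "finite K" "\<And>i. p0 i \<noteq> 0" "\<And>k. k \<in> K \<Longrightarrow> ls_dim (d k) p0 (m k) \<le> N k"
    and P: "\<And>p. (\<And>k. k \<in> K \<Longrightarrow> ls_dim (d k) p (m k) \<le> N k) \<Longrightarrow> P p"
  shows "for_general_points P"
proof -
  have "\<exists>e F. multiform e F \<and> F p0 \<noteq> 0 \<and> (\<forall>p. F p \<noteq> 0 \<longrightarrow> (\<forall>k\<in>K. ls_dim (d k) p (m k) \<le> N k))"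
    using assms(1,3)
  proof (induction K rule: finite_induct)
    case empty
    show ?case using multiform_1 by (intro exI[of _ 0] exI[of _ "\<lambda>_. 1"]) auto
  next
    case (insert k K)
    obtain e F where F: "multiform e F" "F p0 \<noteq> 0" "\<forall>p. F p \<noteq> 0 \<longrightarrow> (\<forall>k\<in>K. ls_dim (d k) p (m k) \<le> N k)"
      using insert by auto
    obtain e' G where G: "multiform e' G" "G p0 \<noteq> 0" "\<forall>p. G p \<noteq> 0 \<longrightarrow> ls_dim (d k) p (m k) \<le> N k"
      using ls_dim_upper_semicontinuous[of "d k" p0 "m k" "N k"] insert by auto
    show ?case
      using multiform_mult[OF F(1) G(1)] F G by (intro exI[of _ "e + e'"] exI[of _ "\<lambda>p. F p * G p"]) auto
  qed
  then obtain e g where g: "multidegree e g" "cpoly_eval (\<lambda>(i, j). p0 i $ j) g \<noteq> 0"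
    "\<And>p. cpoly_eval (\<lambda>(i, j). p i $ j) g \<noteq> 0 \<Longrightarrow> \<forall>k\<in>K. ls_dim (d k) p (m k) \<le> N k"
    unfolding multiform_def by blast
  let ?U = "{p :: 's \<Rightarrow> complex^4. (\<forall>i. p i \<noteq> 0) \<and> (\<exists>g\<in>{g}. cpoly_eval (\<lambda>(i, j). p i $ j) g \<noteq> 0)}"
  have "zariski_open ?U" unfolding zariski_open_def
    using multidegree_multihomogeneous[OF g(1)] by (intro exI[of _ "{g}"]) simp
  moreover have "p0 \<in> ?U" using g(2) assms(2) by simp
  moreover have "\<forall>p\<in>?U. P p" using g(3) P by blast
  ultimately show ?thesis unfolding for_general_points_def by blast
qed

section \<open>Points on the Segre quadric\<close>

text \<open>For polynomial \<open>R\<close> this is the value at \<open>x\<close> of R(E) f, where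
  the Euler operators E_v = x_v d/dx_v are substituted for the exponents.\<close>

definition weighted_eval :: "('v::finite \<Rightarrow> complex) \<Rightarrow> (('v \<Rightarrow>\<^sub>0 nat) \<Rightarrow> complex) \<Rightarrow> 'v cpoly \<Rightarrow> complex" where
  "weighted_eval x R f = (\<Sum>a\<in>Poly_Mapping.keys f. cf f a * (R a * monom_eval x a))"

lemma weighted_eval_superset:
  assumes "finite A" "Poly_Mapping.keys f \<subseteq> A"
  shows "weighted_eval x R f = (\<Sum>a\<in>A. cf f a * (R a * monom_eval x a))"
  unfolding weighted_eval_def using assms by (intro sum.mono_neutral_left) (auto simp: in_keys_iff)

lemma weighted_eval_single: "weighted_eval x R (Poly_Mapping.single a c) = c * (R a * monom_eval x a)"
  by (subst weighted_eval_superset[of "{a}"]) auto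

lemma weighted_eval_add: "weighted_eval x R (f + g) = weighted_eval x R f + weighted_eval x R g"
  unfolding weighted_eval_def by (rule setsum_keys_plus_distrib) (auto simp: algebra_simps)

lemma weighted_eval_0 [simp]: "weighted_eval x R 0 = 0"
  by (simp add: weighted_eval_def)

lemma exp_minus_unit_plus: "cf a v \<noteq> 0 \<Longrightarrow> a - unit_exp v + unit_exp v = a"
  by (rule poly_mapping_eqI) (auto simp: lookup_add lookup_minus lookup_single when_def)

text \<open>One Euler operator is a derivative followed by multiplication by x_v. The derivative
  lowers the exponent, so \<open>R\<close> has to be read at the exponent raised again.\<close>

lemma weighted_eval_partial:
  "weighted_eval x (\<lambda>a. of_nat (cf a v) * R a) f = x v * weighted_eval x (\<lambda>a. R (a + unit_exp v)) (cpoly_partial v f)"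
proof (induction f rule: cpoly_induct)
  case (single a c)
  show ?case
  proof (cases "cf a v = 0")
    case False
    then have "monom_eval x a = monom_eval x (a - unit_exp v) * x v"
      using exp_minus_unit_plus[of a v] monom_eval_add monom_eval_unit by metis
    then show ?thesis using exp_minus_unit_plus[OF False] by (simp add: weighted_eval_single partial_single)
  qed (simp add: weighted_eval_single partial_single)
qed (simp add: weighted_eval_add partial_add distrib_left)

abbreviation exponents4 :: "((4 \<Rightarrow>\<^sub>0 nat) \<Rightarrow> complex) set" where
  "exponents4 \<equiv> range (\<lambda>v a. of_nat (cf a v))"

text \<open>At a point of multiplicity above \<open>d\<close> the Euler operators kill the form: these act on
  monomials by multiplication with polynomials in the exponents.\<close>

lemma weighted_eval_eq_0:
  assumes "polyfun exponents4 d R"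
  shows "mult_at_least (Suc d) z f \<Longrightarrow> weighted_eval (\<lambda>j. z $ j) (\<lambda>a. R (a + s)) f = 0"
  using assms
proof (induction arbitrary: f s rule: polyfun.induct)
  case (const d c)
  have "weighted_eval (\<lambda>j. z $ j) (\<lambda>a. c) f = c * point_eval z f"
    by (simp add: weighted_eval_def cpoly_eval_superset[OF finite_keys order_refl] sum_distrib_left mult.left_commute)
  then show ?case using const by (simp add: mult_at_least_Suc)
next
  case (add d P Q)
  have "weighted_eval (\<lambda>j. z $ j) (\<lambda>a. P (a + s) + Q (a + s)) f =
      weighted_eval (\<lambda>j. z $ j) (\<lambda>a. P (a + s)) f + weighted_eval (\<lambda>j. z $ j) (\<lambda>a. Q (a + s)) f"
    by (simp add: weighted_eval_def sum.distrib algebra_simps)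
  then show ?case using add by simp
next
  case (mult x d P)
  then obtain v where x: "x = (\<lambda>a. of_nat (cf a v))" by blast
  have "weighted_eval (\<lambda>j. z $ j) (\<lambda>a. x (a + s) * P (a + s)) f =
      weighted_eval (\<lambda>j. z $ j) (\<lambda>a. of_nat (cf a v) * P (a + s)) f +
      of_nat (cf s v) * weighted_eval (\<lambda>j. z $ j) (\<lambda>a. P (a + s)) f"
    unfolding x weighted_eval_def by (simp add: lookup_add algebra_simps sum.distrib sum_distrib_left)
  also have "weighted_eval (\<lambda>j. z $ j) (\<lambda>a. P (a + s)) f = 0"
    using mult.IH mult_at_least_mono[OF mult.prems] by simp
  \<comment> \<open>The shift \<open>s\<close> is there for this step: it takes up the exponent lost
    by the derivative.\<close>
  also have "weighted_eval (\<lambda>j. z $ j) (\<lambda>a. of_nat (cf a v) * P (a + s)) f = 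
      z $ v * weighted_eval (\<lambda>j. z $ j) (\<lambda>a. P (a + (unit_exp v + s))) (cpoly_partial v f)"
    using weighted_eval_partial[of "\<lambda>j. z $ j" v "\<lambda>a. P (a + s)" f] by (simp add: add.assoc)
  also have "weighted_eval (\<lambda>j. z $ j) (\<lambda>a. P (a + (unit_exp v + s))) (cpoly_partial v f) = 0"
    using mult.prems mult_at_least_Suc[of "Suc d" z f] by (intro mult.IH) simp
  finally show ?case by simp
qed

section \<open>Restriction of forms to the Segre quadric\<close>

definition segre :: "complex \<times> complex \<Rightarrow> complex^4" where
  "segre z = (\<chi> j. if j = 1 then 1 else if j = 2 then fst z else if j = 3 then snd z else fst z * snd z)"

lemma segre_nth [simp]: "segre z $ 1 = 1" "segre z $ 2 = fst z" "segre z $ 3 = snd z" "segre z $ 4 = fst z * snd z"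
  by (simp_all add: segre_def)

definition bidegree :: "(4 \<Rightarrow>\<^sub>0 nat) \<Rightarrow> nat \<times> nat" where
  "bidegree a = (cf a 2 + cf a 4, cf a 3 + cf a 4)"

lemma prod_4: "prod f (UNIV :: 4 set) = f 1 * f 2 * f 3 * f 4"
  unfolding UNIV_4 by (simp add: ac_simps)

lemma monom_eval_segre: "monom_eval (\<lambda>j. segre z $ j) a = mon z (bidegree a)"
  unfolding monom_eval_def prod_4 segre_nth
  by (simp add: mon_def bidegree_def power_add power_mult_distrib)

lemma total_degree_4: "total_degree (a :: 4 \<Rightarrow>\<^sub>0 nat) = cf a 1 + cf a 2 + cf a 3 + cf a 4"
  by (simp add: total_degree_def sum_4)

definition segre_quadric :: "4 cpoly" where
  "segre_quadric = Poly_Mapping.single (unit_exp 2 + unit_exp 3) 1 - Poly_Mapping.single (unit_exp 1 + unit_exp 4) 1"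

lemma eval_segre_quadric: "point_eval (segre z) segre_quadric = 0"
  by (simp add: segre_quadric_def monom_eval_add)

text \<open>The derivative of x_2 x_3 - x_1 x_4 with respect to x_4 is -x_1, and x_1 = 1 on the
  image of \<open>segre\<close>.\<close>

lemma eval_partial_segre_quadric: "point_eval (segre z) (cpoly_partial 4 segre_quadric) \<noteq> 0"
proof -
  have "segre_quadric + Poly_Mapping.single (unit_exp 1 + unit_exp 4) 1 = Poly_Mapping.single (unit_exp 2 + unit_exp 3) 1"
    by (simp add: segre_quadric_def)
  then have "point_eval (segre z) (cpoly_partial 4 segre_quadric) +
      point_eval (segre z) (cpoly_partial 4 (Poly_Mapping.single (unit_exp 1 + unit_exp 4) 1)) =
      point_eval (segre z) (cpoly_partial 4 (Poly_Mapping.single (unit_exp 2 + unit_exp 3) 1))"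
    by (metis cpoly_eval_add partial_add)
  then have "point_eval (segre z) (cpoly_partial 4 segre_quadric) + 1 = 0"
    by (simp add: partial_single lookup_add lookup_single)
  then show ?thesis by auto
qed

text \<open>For a form of degree \<open>d\<close> this is the coefficient of the monomial with
  exponents \<open>ab\<close> in f(1, x, y, x y).\<close>

definition restriction :: "nat \<Rightarrow> 4 cpoly \<Rightarrow> nat \<times> nat \<Rightarrow> complex" where
  "restriction d f ab = (\<Sum>a\<in>{a \<in> monomials d. bidegree a = ab}. cf f a)"

lemma bidegree_le: "a \<in> monomials d \<Longrightarrow> bidegree a \<in> {..<Suc d} \<times> {..<Suc d}"
  by (auto simp: monomials_def total_degree_4 bidegree_def)

lemma polyfun_bidegree: "polyfun exponents d P \<Longrightarrow> polyfun exponents4 d (\<lambda>a. P (bidegree a))"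
proof (induction rule: polyfun.induct)
  case (mult x d P)
  have *: "polyfun exponents4 (Suc d) (\<lambda>a. of_nat (cf a v) * P (bidegree a))" for v
    using mult.IH by (intro polyfun.mult[of "\<lambda>a. of_nat (cf a v)"]) auto
  have "x = (\<lambda>a. of_nat (fst a)) \<or> x = (\<lambda>a. of_nat (snd a))" using mult.hyps(1) by auto
  then show ?case
    using polyfun.add[OF *[of 2] *[of 4]] polyfun.add[OF *[of 3] *[of 4]] by (auto simp: bidegree_def algebra_simps)
qed (auto intro: polyfun.intros)

lemma restriction_vanishing:
  assumes "homogeneous d f" "mult_at_least (Suc k) (segre z) f" "polyfun exponents k P"
  shows "(\<Sum>ab\<in>{..<Suc d} \<times> {..<Suc d}. restriction d f ab * (P ab * mon z ab)) = 0"
proof -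
  have "0 = weighted_eval (\<lambda>j. segre z $ j) (\<lambda>a. P (bidegree a)) f"
    using weighted_eval_eq_0[OF polyfun_bidegree[OF assms(3)] assms(2), of 0] by simp
  also have "\<dots> = (\<Sum>a\<in>monomials d. cf f a * (P (bidegree a) * mon z (bidegree a)))"
    using assms(1) by (subst weighted_eval_superset[of "monomials d"]) (auto simp: homogeneous_keys monom_eval_segre)
  also have "\<dots> = (\<Sum>ab\<in>{..<Suc d} \<times> {..<Suc d}. \<Sum>a\<in>{a \<in> monomials d. bidegree a = ab}. cf f a * (P (bidegree a) * mon z (bidegree a)))"
    using bidegree_le by (intro sum.group[symmetric] image_subsetI) simp_all
  also have "\<dots> = (\<Sum>ab\<in>{..<Suc d} \<times> {..<Suc d}. restriction d f ab * (P ab * mon z ab))"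
    unfolding restriction_def sum_distrib_right by (intro sum.cong) auto
  finally show ?thesis by simp
qed

text \<open>Modulo the quadric a factor x_2 x_3 may be replaced by x_1 x_4. This preserves degree
  and bidegree and lowers the exponent of x_2, so it ends with a monomial in which x_2 or x_3 is
  absent.\<close>

lemma monomial_normal_form:
  assumes "total_degree a = d"
  shows "\<exists>b h. total_degree b = d \<and> bidegree b = bidegree a \<and> (cf b 2 = 0 \<or> cf b 3 = 0) \<and>
    homogeneous (d - 2) h \<and> Poly_Mapping.single a 1 - Poly_Mapping.single b 1 = segre_quadric * h"
  using assms
proof (induction "cf a 2" arbitrary: a)
  case 0
  then show ?case by (intro exI[of _ a] exI[of _ 0]) auto
next
  case (Suc n)
  show ?case
  proof (cases "cf a 3 = 0")
    case True
    then show ?thesis using Suc.prems by (intro exI[of _ a] exI[of _ 0]) auto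
  next
    case False
    define c where "c = a - unit_exp 2 - unit_exp 3"
    define a' where "a' = c + (unit_exp 1 + unit_exp 4)"
    have a: "a = c + (unit_exp 2 + unit_exp 3)"
      by (rule poly_mapping_eqI) (use False Suc.hyps(2) in \<open>auto simp: c_def lookup_add lookup_minus lookup_single when_def\<close>)
    have deg: "total_degree c = d - 2" "total_degree a' = d"
      using Suc.prems by (auto simp: a a'_def total_degree_add)
    have "n = cf a' 2" using Suc.hyps(2) by (simp add: a a'_def lookup_add lookup_single)
    then obtain b h where b: "total_degree b = d" "bidegree b = bidegree a'" "cf b 2 = 0 \<or> cf b 3 = 0"
      "homogeneous (d - 2) h" "Poly_Mapping.single a' 1 - Poly_Mapping.single b 1 = segre_quadric * h"
      using Suc.hyps(1)[of a'] deg(2) by blast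
    have "bidegree a' = bidegree a" by (simp add: a a'_def bidegree_def lookup_add lookup_single)
    moreover have "Poly_Mapping.single a 1 - Poly_Mapping.single a' 1 = segre_quadric * Poly_Mapping.single c 1"
      by (simp add: a a'_def segre_quadric_def left_diff_distrib mult_single add.commute)
    then have "Poly_Mapping.single a 1 - Poly_Mapping.single b 1 = segre_quadric * (Poly_Mapping.single c 1 + h)"
      using b(5) by (simp add: distrib_left algebra_simps)
    moreover have "homogeneous (d - 2) (Poly_Mapping.single c 1 + h)"
      using b(4) deg(1) by (intro homogeneous_add homogeneous_single)
    ultimately show ?thesis using b by metis
  qed
qed

lemma normal_form_unique:
  assumes "total_degree b = total_degree b'" "bidegree b = bidegree b'"
    "cf b 2 = 0 \<or> cf b 3 = 0" "cf b' 2 = 0 \<or> cf b' 3 = 0"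
  shows "b = b'"
proof (rule poly_mapping_eqI)
  fix v :: 4
  have "cf b 1 = cf b' 1 \<and> cf b 2 = cf b' 2 \<and> cf b 3 = cf b' 3 \<and> cf b 4 = cf b' 4"
    using assms by (auto simp: total_degree_4 bidegree_def)
  then show "cf b v = cf b' v" using exhaust_4[of v] by auto
qed

text \<open>Modulo the quadric \<open>f\<close> is a combination of normal forms. Distinct normal
  forms of degree \<open>d\<close> have distinct bidegrees, so their coefficients are those of the
  restriction and vanish.\<close>

lemma divisible_by_segre_quadric:
  assumes f: "homogeneous d f" and zero: "\<And>ab. restriction d f ab = 0"
  shows "\<exists>g. homogeneous (d - 2) g \<and> f = segre_quadric * g"
proof -
  have "\<forall>a\<in>monomials d. \<exists>b h. total_degree b = d \<and> bidegree b = bidegree a \<and> (cf b 2 = 0 \<or> cf b 3 = 0) \<and>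
    homogeneous (d - 2) h \<and> Poly_Mapping.single a 1 - Poly_Mapping.single b 1 = segre_quadric * h"
    using monomial_normal_form by (auto simp: monomials_def)
  then obtain N h where N: "\<And>a. a \<in> monomials d \<Longrightarrow> total_degree (N a) = d \<and> bidegree (N a) = bidegree a \<and> (cf (N a) 2 = 0 \<or> cf (N a) 3 = 0)"
    and h: "\<And>a. a \<in> monomials d \<Longrightarrow> homogeneous (d - 2) (h a)"
    "\<And>a. a \<in> monomials d \<Longrightarrow> Poly_Mapping.single a 1 - Poly_Mapping.single (N a) 1 = segre_quadric * h a"
    by metis
  have "(\<Sum>a\<in>monomials d. cpoly_scale (cf f a) (Poly_Mapping.single (N a) 1)) = 0"
  proof (rule poly_mapping_eqI)
    fix b
    have "cf (\<Sum>a\<in>monomials d. cpoly_scale (cf f a) (Poly_Mapping.single (N a) 1)) b = (\<Sum>a\<in>monomials d. if N a = b then cf f a else 0)"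
      unfolding lookup_sum by (intro sum.cong) (auto simp: lookup_single when_def)
    also have "\<dots> = (\<Sum>a\<in>{a \<in> monomials d. N a = b}. cf f a)" by (simp add: sum.inter_filter)
    also have "\<dots> = 0"
    proof (cases "\<exists>a\<in>monomials d. N a = b")
      case True
      then obtain a0 where a0: "a0 \<in> monomials d" "N a0 = b" by blast
      have "{a \<in> monomials d. N a = b} = {a \<in> monomials d. bidegree a = bidegree b}"
      proof (intro Collect_cong conj_cong refl iffI)
        fix a assume "a \<in> monomials d" "bidegree a = bidegree b"
        then show "N a = b" using N[of a] N[OF a0(1)] a0(2) by (intro normal_form_unique) auto
      qed (use N in force)
      then show ?thesis using zero[of "bidegree b"] by (simp add: restriction_def)
    next
      case False
      then have "{a \<in> monomials d. N a = b} = {}" by blast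
      then show ?thesis by (simp only: sum.empty)
    qed
    finally show "cf (\<Sum>a\<in>monomials d. cpoly_scale (cf f a) (Poly_Mapping.single (N a) 1)) b = cf 0 b" by simp
  qed
  moreover have "f - (\<Sum>a\<in>monomials d. cpoly_scale (cf f a) (Poly_Mapping.single (N a) 1)) =
      (\<Sum>a\<in>monomials d. cpoly_scale (cf f a) (Poly_Mapping.single a 1 - Poly_Mapping.single (N a) 1))"
    by (subst homogeneous_expand[OF f]) (simp add: cpoly.scale_right_diff_distrib sum_subtractf)
  ultimately have "f = (\<Sum>a\<in>monomials d. cpoly_scale (cf f a) (segre_quadric * h a))" using h(2) by simp
  also have "\<dots> = segre_quadric * (\<Sum>a\<in>monomials d. cpoly_scale (cf f a) (h a))"
    by (simp add: sum_distrib_left cpoly_scale_def mult.left_commute)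
  finally show ?thesis using h(1) by (metis (no_types, lifting) homogeneous_scale homogeneous_sum)
qed

lemma segre_kernel:
  assumes uni: "unisolvent k p UNIV ({..<Suc d} \<times> {..<Suc d} - E)"
    and f: "homogeneous d f" "\<And>i. mult_at_least (Suc k) (segre (p i)) f" and E: "\<And>ab. ab \<in> E \<Longrightarrow> restriction d f ab = 0"
  shows "\<exists>g. homogeneous (d - 2) g \<and> f = segre_quadric * g"
proof (rule divisible_by_segre_quadric[OF f(1)])
  let ?G = "{..<Suc d} \<times> {..<Suc d}"
  have "(\<Sum>ab\<in>?G - E. restriction d f ab * (P ab * mon (p i) ab)) = 0" if "polyfun exponents k P" for P i
  proof -
    have "(\<Sum>ab\<in>?G - E. restriction d f ab * (P ab * mon (p i) ab)) = (\<Sum>ab\<in>?G. restriction d f ab * (P ab * mon (p i) ab))"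
      using E by (intro sum.mono_neutral_left) auto
    then show ?thesis using restriction_vanishing[OF f(1) f(2) that] by simp
  qed
  then have "\<forall>ab\<in>?G - E. restriction d f ab = 0" using uni unfolding unisolvent_def by blast
  moreover have "restriction d f ab = 0" if "ab \<notin> ?G" for ab
  proof -
    have "{a \<in> monomials d. bidegree a = ab} = {}" using that bidegree_le by blast
    then show ?thesis unfolding restriction_def by (simp only: sum.empty)
  qed
  ultimately show "restriction d f ab = 0" for ab using E by blast
qed

lemma dim_times_le:
  assumes "W \<subseteq> (*) q ` V" "V \<subseteq> cpoly.span F" "finite F"
  shows "cpoly.dim W \<le> cpoly.dim V"
proof -
  interpret times_q: Vector_Spaces.linear cpoly_scale cpoly_scale "(*) q"
    by unfold_locales (simp_all add: distrib_left cpoly_scale_def mult.left_commute)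
  obtain B where B: "B \<subseteq> V" "cpoly.independent B" "V \<subseteq> cpoly.span B" "card B = cpoly.dim V"
    using cpoly.basis_exists by blast
  have fin: "finite B" using cpoly.card_le_dim[OF B(2,1) assms(2,3)] by blast
  have "W \<subseteq> cpoly.span ((*) q ` B)" using assms(1) B(3) by (auto simp: times_q.span_image)
  then have "cpoly.dim W \<le> card ((*) q ` B)" using fin by (intro cpoly.dim_le_card) auto
  also have "\<dots> \<le> cpoly.dim V" using card_image_le[OF fin] B(4) by metis
  finally show ?thesis .
qed

lemma dim_times_ge:
  assumes "(*) q ` V \<subseteq> W" "cpoly.subspace V" "W \<subseteq> cpoly.span F" "finite F" and q: "q \<noteq> (0 :: 4 cpoly)"
  shows "cpoly.dim V \<le> cpoly.dim W"
proof -
  interpret times_q: Vector_Spaces.linear cpoly_scale cpoly_scale "(*) q"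
    by unfold_locales (simp_all add: distrib_left cpoly_scale_def mult.left_commute)
  obtain B where B: "B \<subseteq> V" "cpoly.independent B" "V \<subseteq> cpoly.span B" "card B = cpoly.dim V"
    using cpoly.basis_exists by blast
  have inj: "inj_on ((*) q) S" for S using q by (auto simp: inj_on_def)
  have "cpoly.independent ((*) q ` B)" using B(2) inj by (rule times_q.independent_injective_image)
  then have "card ((*) q ` B) \<le> cpoly.dim W"
    using cpoly.card_le_dim[OF _ _ assms(3,4)] B(1) assms(1) by blast
  then show ?thesis using B(4) card_image[OF inj] by metis
qed

text \<open>Killing the coefficients in \<open>E\<close> costs at most \<open>card E\<close>
  dimensions. By unisolvence the rest of the restriction then vanishes too, and the quadric can be
  divided out, which lowers the multiplicity by only one because it is smooth at the points.\<close>

lemma ls_dim_segre_step: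
  fixes p :: "'s::finite \<Rightarrow> complex \<times> complex"
  assumes uni: "unisolvent k p UNIV ({..<Suc d} \<times> {..<Suc d} - E)" and "finite E"
  shows "ls_dim d (\<lambda>i. segre (p i)) (\<lambda>_. Suc k) \<le> card E + ls_dim (d - 2) (\<lambda>i. segre (p i)) (\<lambda>_. k)"
proof -
  let ?V = "linear_system d (\<lambda>i. segre (p i)) (\<lambda>_. Suc k)"
  let ?W = "{f \<in> ?V. \<forall>ab\<in>E. restriction d f ab = 0}"
  have "cpoly.dim ?V \<le> cpoly.dim ?W + card E"
    by (rule cpoly.dim_le_kernel_card[OF \<open>finite E\<close> subspace_linear_system linear_system_subset_span])
      (auto simp: restriction_def lookup_add sum.distrib sum_distrib_left)
  moreover have "?W \<subseteq> (*) segre_quadric ` linear_system (d - 2) (\<lambda>i. segre (p i)) (\<lambda>_. k)"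
  proof
    fix f assume "f \<in> ?W"
    then have f: "homogeneous d f" "\<And>i. mult_at_least (Suc k) (segre (p i)) f" "\<And>ab. ab \<in> E \<Longrightarrow> restriction d f ab = 0"
      by (auto simp: linear_system_def)
    obtain g where g: "homogeneous (d - 2) g" "f = segre_quadric * g" using segre_kernel[OF uni f] by blast
    have "mult_at_least k (segre (p i)) g" for i
      using mult_at_least_times_cancel[OF eval_segre_quadric eval_partial_segre_quadric] f(2)[of i] g(2) by blast
    then show "f \<in> (*) segre_quadric ` linear_system (d - 2) (\<lambda>i. segre (p i)) (\<lambda>_. k)"
      using g by (auto simp: linear_system_def)
  qed
  then have "cpoly.dim ?W \<le> ls_dim (d - 2) (\<lambda>i. segre (p i)) (\<lambda>_. k)"
    unfolding ls_dim_def by (rule dim_times_le[OF _ linear_system_subset_span]) simp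
  ultimately show ?thesis by (simp add: ls_dim_def)
qed

lemma ls_dim_le_card_monomials: "ls_dim d p m \<le> (d + 3) choose 3"
proof -
  have "ls_dim d p m \<le> card (monomial_forms d :: 4 cpoly set)"
    unfolding ls_dim_def by (intro cpoly.dim_le_card linear_system_subset_span) simp
  also have "\<dots> \<le> card (monomials d :: (4 \<Rightarrow>\<^sub>0 nat) set)" by (rule card_image_le) simp
  finally show ?thesis by (simp add: card_monomials_4)
qed

section \<open>Nine points\<close>

lemma choose_2_int: "2 * int (Suc n choose 2) = int n * (int n + 1)"
  by (induction n) (simp_all add: eval_nat_numeral algebra_simps)

lemma choose_3_int: "6 * int ((n + 2) choose 3) = int n * (int n + 1) * (int n + 2)"
proof (induction n)
  case (Suc n)
  have "(Suc n + 2) choose 3 = (Suc (Suc n) choose 2) + ((n + 2) choose 3)"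
    by (simp add: eval_nat_numeral)
  then show ?case using Suc choose_2_int[of "Suc n"] by (simp add: algebra_simps)
qed simp

lemma vdim_formula: "6 * vdim (2 * m + 1) (\<lambda>_ :: 9. m) = (int m + 1) * (int m + 2) * (12 - int m)"
proof -
  have "6 * int ((2 * m + 1 + 3) choose 3) = (2 * int m + 2) * (2 * int m + 3) * (2 * int m + 4)"
  proof -
    have eq: "2 * m + 1 + 3 = (2 * m + 2) + 2" by simp
    show ?thesis unfolding eq choose_3_int by (simp add: algebra_simps)
  qed
  then show ?thesis using choose_3_int[of m] unfolding vdim_def by (simp add: algebra_simps)
qed

text \<open>4 is the dimension of L(0), the linear forms, and the summand with index j is the
  expected dimension of M(j + 1). Truncated subtraction makes the sum stationary from k = 7
  on.\<close>

definition dim_bound :: "nat \<Rightarrow> nat" where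
  "dim_bound k = 4 + (\<Sum>j<k. (7 - j) * (j + 2) div 2)"

lemma dim_bound_small: "k \<le> 8 \<Longrightarrow> int (dim_bound k) = vdim (2 * k + 1) (\<lambda>_ :: 9. k)"
proof -
  assume "k \<le> 8"
  then have "k = 0 \<or> k = 1 \<or> k = 2 \<or> k = 3 \<or> k = 4 \<or> k = 5 \<or> k = 6 \<or> k = 7 \<or> k = 8" by fastforce
  then have "6 * int (dim_bound k) = (int k + 1) * (int k + 2) * (12 - int k)"
    by (elim disjE) (simp_all add: dim_bound_def lessThan_nat_numeral lessThan_Suc)
  then show ?thesis using vdim_formula[of k] by simp
qed

lemma dim_bound_large: "7 \<le> k \<Longrightarrow> dim_bound k = 60"
proof (induction k rule: dec_induct)
  case base
  show ?case by (simp add: dim_bound_def lessThan_nat_numeral lessThan_Suc)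
next
  case (step n)
  then show ?case by (simp add: dim_bound_def)
qed

lemma segre_ls_dim:
  fixes p :: "9 \<Rightarrow> complex \<times> complex"
  assumes "\<And>j. j < k \<Longrightarrow> finite (E j) \<and> card (E j) \<le> (7 - j) * (j + 2) div 2 \<and>
      unisolvent j p UNIV ({..<2 * j + 4} \<times> {..<2 * j + 4} - E j)"
  shows "ls_dim (2 * k + 1) (\<lambda>i. segre (p i)) (\<lambda>_. k) \<le> dim_bound k"
  using assms
proof (induction k)
  case 0
  show ?case using ls_dim_le_card_monomials[of 1] by (simp add: dim_bound_def eval_nat_numeral)
next
  case (Suc k)
  have eq: "2 * Suc k + 1 - 2 = 2 * k + 1" by simp
  have uni: "unisolvent k p UNIV ({..<Suc (2 * Suc k + 1)} \<times> {..<Suc (2 * Suc k + 1)} - E k)" "finite (E k)"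
    using Suc.prems[of k] by (simp_all add: eval_nat_numeral)
  have "ls_dim (2 * Suc k + 1) (\<lambda>i. segre (p i)) (\<lambda>_. Suc k) \<le>
      card (E k) + ls_dim (2 * k + 1) (\<lambda>i. segre (p i)) (\<lambda>_. k)"
    using ls_dim_segre_step[OF uni] unfolding eq .
  moreover have "card (E k) \<le> (7 - k) * (k + 2) div 2" using Suc.prems[of k] by simp
  moreover have "ls_dim (2 * k + 1) (\<lambda>i. segre (p i)) (\<lambda>_. k) \<le> dim_bound k" using Suc by simp
  moreover have "dim_bound (Suc k) = dim_bound k + (7 - k) * (k + 2) div 2" by (simp add: dim_bound_def)
  ultimately show ?case by linarith
qed

text \<open>Let \<open>h\<close> be the part of \<open>g\<close> of degree \<open>d\<close>. Then
  \<open>q * (g - h)\<close> is homogeneous of degree \<open>e + d\<close> but has no terms of that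
  degree, so it is zero. This is needed because \<open>dvd\<close> gives an arbitrary polynomial as
  quotient.\<close>

lemma homogeneous_quotient:
  fixes q :: "4 cpoly"
  assumes "q \<noteq> 0" "homogeneous e q" "homogeneous (e + d) (q * g)"
  shows "homogeneous d g"
proof -
  define h where "h = (\<Sum>a\<in>Poly_Mapping.keys g \<inter> monomials d. Poly_Mapping.single a (cf g a))"
  have h: "homogeneous d h"
    unfolding h_def by (intro homogeneous_sum homogeneous_single) (auto simp: monomials_def)
  have lookup_h: "cf h a = cf g a" if "total_degree a = d" for a
  proof -
    have "cf h a = (\<Sum>b\<in>Poly_Mapping.keys g \<inter> monomials d. if b = a then cf g b else 0)"
      unfolding h_def lookup_sum by (intro sum.cong) (auto simp: lookup_single when_def)
    then show ?thesis using that by (simp add: in_keys_iff monomials_def)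
  qed
  have "homogeneous (e + d) (q * (g - h))"
    using assms(3) homogeneous_mult[OF assms(2) h] unfolding right_diff_distrib homogeneous_alt lookup_minus
    by (metis diff_self)
  moreover have "total_degree c \<noteq> e + d" if c: "cf (q * (g - h)) c \<noteq> 0" for c
  proof -
    obtain a b where ab: "c = a + b" "cf q a \<noteq> 0" "cf (g - h) b \<noteq> 0"
      using c keys_mult[of q "g - h"] by (auto simp: in_keys_iff)
    then have "total_degree b \<noteq> d" using lookup_h by (auto simp: lookup_minus)
    then show ?thesis using ab(1,2) assms(2) by (auto simp: homogeneous_alt total_degree_add)
  qed
  ultimately have "q * (g - h) = 0" by (intro poly_mapping_eqI) (auto simp: homogeneous_alt)
  then show ?thesis using assms(1) h by simp
qed

lemma homogeneous_power: "homogeneous e q \<Longrightarrow> homogeneous (k * e) (q ^ k)"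
proof (induction k)
  case 0
  show ?case by (simp add: homogeneous_alt lookup_one when_def)
qed (simp add: homogeneous_mult)

lemma ls_dim_pos:
  assumes "f \<in> linear_system d p m" "f \<noteq> 0"
  shows "0 < ls_dim d p m"
proof -
  have "card {f} \<le> cpoly.dim (linear_system d p m)"
    using cpoly.card_le_dim[OF _ _ linear_system_subset_span, of "{f}"] assms by simp
  then show ?thesis by (simp add: ls_dim_def)
qed

lemma quadric_through_iff: "quadric_through p q \<longleftrightarrow> q \<noteq> 0 \<and> q \<in> linear_system 2 p (\<lambda>_. 1)"
  by (auto simp: quadric_through_def linear_system_def mult_at_least_Suc)

lemma unique_quadric:
  fixes p :: "9 \<Rightarrow> complex^4"
  assumes "ls_dim 2 p (\<lambda>_. 1) \<le> 1"
  shows "\<exists>q. unique_quadric_through p q"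
proof -
  let ?V = "linear_system 2 p (\<lambda>_. 1)"
  have "vdim 2 (\<lambda>_ :: 9. 1) = 1" by (simp add: vdim_def eval_nat_numeral)
  then have "1 \<le> ls_dim 2 p (\<lambda>_. 1)" using vdim_le_ls_dim[of "\<lambda>_ :: 9. 1" 2 p] by simp
  then have "\<not> ?V \<subseteq> {0}" using cpoly.dim_le_card[of ?V "{}"] by (auto simp: ls_dim_def)
  then obtain q where q: "q \<in> ?V" "q \<noteq> 0" by blast
  have "cpoly.span {q} = ?V"
  proof (rule cpoly.subspace_eq_of_dim_le[OF _ _ linear_system_subset_span])
    show "cpoly.span {q} \<subseteq> ?V" using q subspace_linear_system by (intro cpoly.span_minimal) auto
    have "cpoly.dim (cpoly.span {q}) = 1" using q by (simp add: cpoly.dim_eq_card_independent)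
    then show "cpoly.dim ?V \<le> cpoly.dim (cpoly.span {q})" using assms by (simp add: ls_dim_def)
  qed simp_all
  then have "\<exists>c. q' = cpoly_scale c q" if "q' \<in> ?V" for q' using that by (auto simp: cpoly.span_singleton)
  then show ?thesis unfolding unique_quadric_through_def quadric_through_iff using q by blast
qed

text \<open>For a single configuration, five kinds of upper bounds imply all the claims, the lower
  bounds being automatic. The points need not lie on the Segre quadric: their quadric comes from
  \<open>quadrics\<close>, and \<open>smooth\<close> excludes that it is singular at a base
  point.\<close>

lemma nine_points:
  fixes p :: "9 \<Rightarrow> complex^4"
  assumes dim_m: "ls_dim (2 * m + 1) p (\<lambda>_. m) \<le> dim_bound m"
    and dim_7: "ls_dim 15 p (\<lambda>_. 7) \<le> 60"
    and dim_6: "ls_dim 13 p (\<lambda>_. 6) \<le> 56"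
    and quadrics: "ls_dim 2 p (\<lambda>_. 1) \<le> 1"
    and smooth: "\<And>i. ls_dim 2 p (\<lambda>j. if j = i then 2 else 1) \<le> 0"
  shows "(special (2 * m + 1) p (\<lambda>_. m) \<longleftrightarrow> m \<ge> 9) \<and>
     (m \<le> 8 \<longrightarrow> int (ls_dim (2 * m + 1) p (\<lambda>_. m)) = vdim (2 * m + 1) (\<lambda>_ :: 9. m)) \<and>
     (m \<ge> 7 \<longrightarrow> ls_dim (2 * m + 1) p (\<lambda>_. m) = 60) \<and>
     (m \<ge> 8 \<longrightarrow> (\<exists>q. unique_quadric_through p q \<and>
        base_locus_mult (linear_system (2 * m + 1) p (\<lambda>_. m)) q (m - 7)))"
proof -
  let ?V = "linear_system (2 * m + 1) p (\<lambda>_. m)"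
  let ?V7 = "linear_system 15 p (\<lambda>_. 7)"
  obtain q where uq: "unique_quadric_through p q" using unique_quadric[OF quadrics] by blast
  then have q: "q \<noteq> 0" "homogeneous 2 q" "\<And>i. point_eval (p i) q = 0"
    by (auto simp: unique_quadric_through_def quadric_through_def)
  have grad: "\<exists>v. point_eval (p i) (cpoly_partial v q) \<noteq> 0" for i
  proof (rule ccontr)
    assume "\<not> ?thesis"
    then have "q \<in> linear_system 2 p (\<lambda>j. if j = i then 2 else 1)"
      using q by (auto simp: linear_system_def mult_at_least_Suc numeral_2_eq_2)
    then show False using ls_dim_pos[OF _ q(1)] smooth[of i] by fastforce
  qed
  have small: "int (ls_dim (2 * m + 1) p (\<lambda>_. m)) = vdim (2 * m + 1) (\<lambda>_ :: 9. m)" if "m \<le> 8"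
    using vdim_le_ls_dim[of "\<lambda>_ :: 9. m" "2 * m + 1" p] dim_m dim_bound_small[OF that] by simp
  have V7: "60 \<le> cpoly.dim ?V7"
  proof -
    have "vdim 15 (\<lambda>_ :: 9. 7) = 60" using vdim_formula[of 7] by simp
    then show ?thesis using vdim_le_ls_dim[of "\<lambda>_ :: 9. 7" 15 p] by (simp add: ls_dim_def)
  qed
  define W where "W = (*) (q ^ (m - 7)) ` ?V7"
  have W: "W \<subseteq> ?V" if "7 \<le> m"
  proof
    fix f assume "f \<in> W"
    then obtain h where h: "f = q ^ (m - 7) * h" "homogeneous 15 h" "\<And>i. mult_at_least 7 (p i) h"
      by (auto simp: W_def linear_system_def)
    have "homogeneous ((m - 7) * 2 + 15) f" unfolding h(1) by (intro homogeneous_mult homogeneous_power q h)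
    moreover have "(m - 7) * 2 + 15 = 2 * m + 1" using that by simp
    moreover have "mult_at_least m (p i) f" for i
      using mult_at_least_power_times[OF q(3)[of i] h(3)[of i], of "m - 7"] that h(1) by simp
    ultimately show "f \<in> ?V" by (simp add: linear_system_def)
  qed
  have dimW: "cpoly.dim ?V7 \<le> cpoly.dim W" if "7 \<le> m"
    using W[OF that] linear_system_subset_span[of "2 * m + 1" p "\<lambda>_. m"] q(1) unfolding W_def
    by (intro dim_times_ge[OF order_refl subspace_linear_system, where F = "monomial_forms (2 * m + 1)"]) auto
  have W_eq: "W = ?V" if "7 \<le> m"
  proof (rule cpoly.subspace_eq_of_dim_le[OF _ W[OF that] linear_system_subset_span])
    interpret times_q: Vector_Spaces.linear cpoly_scale cpoly_scale "(*) (q ^ (m - 7))"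
      by unfold_locales (simp_all add: distrib_left cpoly_scale_def mult.left_commute)
    show "cpoly.subspace W" unfolding W_def by (rule times_q.subspace_image[OF subspace_linear_system])
    show "cpoly.dim ?V \<le> cpoly.dim W"
      using dim_m dim_bound_large[OF that] V7 dimW[OF that] by (simp add: ls_dim_def)
  qed simp
  have large: "ls_dim (2 * m + 1) p (\<lambda>_. m) = 60" if "7 \<le> m"
    using dim_m dim_bound_large[OF that] V7 dimW[OF that] W_eq[OF that] by (simp add: ls_dim_def)
  have special: "special (2 * m + 1) p (\<lambda>_. m) \<longleftrightarrow> m \<ge> 9"
  proof (cases "m \<le> 8")
    case True
    then show ?thesis using small by (simp add: special_def edim_def)
  next
    case False
    \<comment> \<open>The bound is 6 * 60. The left side, 6 times the virtual dimension, is at most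
      0 from m = 12 on, and m = 9, 10, 11 are computed.\<close>
    have "(int m + 1) * (int m + 2) * (12 - int m) < 360"
    proof (cases "m \<ge> 12")
      case True
      then have "(int m + 1) * (int m + 2) * (12 - int m) \<le> 0" by (intro mult_nonneg_nonpos) auto
      then show ?thesis by simp
    next
      case 2: False
      then have "m = 9 \<or> m = 10 \<or> m = 11" using False by linarith
      then show ?thesis by auto
    qed
    then have "vdim (2 * m + 1) (\<lambda>_ :: 9. m) < 60" using vdim_formula[of m] by simp
    then show ?thesis using large False by (simp add: special_def edim_def)
  qed
  have "base_locus_mult ?V q (m - 7)" if "8 \<le> m"
    unfolding base_locus_mult_def
  proof (intro conjI notI)
    have "W = ?V" using W_eq that by simp
    then show "\<forall>f\<in>?V. q ^ (m - 7) dvd f" unfolding W_def by (metis (no_types) dvd_triv_left imageE)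
  next
    \<comment> \<open>One more factor \<open>q\<close> could be divided out of every member of L(7)
      as well, which would embed L(7) into L(6), against 60 > 56.\<close>
    assume all: "\<forall>f\<in>?V. q ^ Suc (m - 7) dvd f"
    have "?V7 \<subseteq> (*) q ` linear_system 13 p (\<lambda>_. 6)"
    proof
      fix h assume h: "h \<in> ?V7"
      then have "q ^ (m - 7) * h \<in> ?V" using W that by (auto simp: W_def)
      then obtain g where "q ^ (m - 7) * h = q ^ Suc (m - 7) * g" using all by (auto simp: dvd_def)
      then have "q ^ (m - 7) * h = q ^ (m - 7) * (q * g)" by (simp add: mult_ac)
      then have hg: "h = q * g" using q(1) by simp
      have "homogeneous (2 + 13) (q * g)" using h hg by (simp add: linear_system_def)
      then have "homogeneous 13 g" by (rule homogeneous_quotient[OF q(1,2)])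
      moreover have "mult_at_least 6 (p i) g" for i
      proof -
        obtain v where v: "point_eval (p i) (cpoly_partial v q) \<noteq> 0" using grad by blast
        have "mult_at_least (Suc 6) (p i) (q * g)" using h hg by (simp add: linear_system_def)
        then show ?thesis by (rule mult_at_least_times_cancel[OF q(3) v])
      qed
      ultimately show "h \<in> (*) q ` linear_system 13 p (\<lambda>_. 6)" using hg by (auto simp: linear_system_def)
    qed
    then have "cpoly.dim ?V7 \<le> cpoly.dim (linear_system 13 p (\<lambda>_. 6))"
      by (rule dim_times_le[OF _ linear_system_subset_span]) simp
    then show False using V7 dim_6 by (simp add: ls_dim_def)
  qed
  then show ?thesis using special small large uq by blast
qed

theorem theorem4p10:
  fixes m :: nat
  assumes "m > 0"
  shows "for_general_points (\<lambda>p :: 9 \<Rightarrow> complex^4.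
     (special (2 * m + 1) p (\<lambda>_. m) \<longleftrightarrow> m \<ge> 9) \<and>
     (m \<le> 8 \<longrightarrow> int (ls_dim (2 * m + 1) p (\<lambda>_. m)) = vdim (2 * m + 1) (\<lambda>_ :: 9. m)) \<and>
     (m \<ge> 7 \<longrightarrow> ls_dim (2 * m + 1) p (\<lambda>_. m) = 60) \<and>
     (m \<ge> 8 \<longrightarrow> (\<exists>q. unique_quadric_through p q \<and>
        base_locus_mult (linear_system (2 * m + 1) p (\<lambda>_. m)) q (m - 7))))"
proof -
  obtain E where E: "\<And>j. finite (E j)" "\<And>j. card (E j) \<le> (7 - j) * (j + 2) div 2"
    "\<And>j. eaten j 9 ({..<2 * j + 4} \<times> {..<2 * j + 4} - E j)"
    using grid_eaten by metis
  \<comment> \<open>\<open>None\<close> stands for the quadrics, which are cut out on the Segre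
    surface in bidegree (2, 2), and \<open>Some j\<close> for the curves of multiplicity
    \<open>j + 1\<close>.\<close>
  define D where "D = case_option ({..<3} \<times> {..<3}) (\<lambda>j. {..<2 * j + 4} \<times> {..<2 * j + 4} - E j)"
  \<comment> \<open>The levels reach 7 even for small \<open>m\<close>, because the bounds for L(6)
    and L(7) are used for every \<open>m\<close>.\<close>
  define J where "J = insert None (Some ` {..<max m 7})"
  have "\<exists>p :: 9 \<Rightarrow> complex \<times> complex. (\<forall>i. fst (p i) \<noteq> 0 \<and> snd (p i) \<noteq> 0) \<and>
      (\<forall>j\<in>J. unisolvent (case_option 0 id j) p UNIV (D j))"
    using E(3) eaten_quadrics by (intro generic_unisolvent) (auto simp: J_def D_def)
  then obtain p :: "9 \<Rightarrow> complex \<times> complex" where p: "\<And>j. j \<in> J \<Longrightarrow> unisolvent (case_option 0 id j) p UNIV (D j)"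
    by blast
  let ?p = "\<lambda>i. segre (p i)"
  have dims: "ls_dim (2 * k + 1) ?p (\<lambda>_. k) \<le> dim_bound k" if "k \<le> max m 7" for k
  proof (rule segre_ls_dim)
    fix j assume "j < k"
    then have "Some j \<in> J" using that by (auto simp: J_def)
    then show "finite (E j) \<and> card (E j) \<le> (7 - j) * (j + 2) div 2 \<and>
        unisolvent j p UNIV ({..<2 * j + 4} \<times> {..<2 * j + 4} - E j)"
      using p[of "Some j"] E by (simp add: D_def)
  qed
  have uni: "unisolvent 0 p UNIV ({..<Suc 2} \<times> {..<Suc 2} - {})"
    using p[of None] by (simp add: J_def D_def eval_nat_numeral)
  have quadrics: "ls_dim 2 ?p (\<lambda>_. 1) \<le> 1"
    using ls_dim_segre_step[OF uni] ls_dim_le_card_monomials[of 0 ?p "\<lambda>_. 0"] by simp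
  \<comment> \<open>A quadric through the nine points is a constant times the Segre quadric. If it
    is double at the point \<open>i\<close>, cancelling the Segre quadric makes the constant vanish
    there.\<close>
  have smooth: "ls_dim 2 ?p (\<lambda>j. if j = i then 2 else 1) \<le> 0" for i
  proof (rule ccontr)
    assume "\<not> ?thesis"
    then have "\<not> linear_system 2 ?p (\<lambda>j. if j = i then 2 else 1) \<subseteq> {0}"
      using cpoly.dim_le_card[of "linear_system 2 ?p (\<lambda>j. if j = i then 2 else 1)" "{}"] by (auto simp: ls_dim_def)
    then obtain f where f: "f \<noteq> 0" "homogeneous 2 f" "\<And>j. mult_at_least (if j = i then 2 else 1) (?p j) f"
      by (auto simp: linear_system_def)
    have "mult_at_least (Suc 0) (?p j) f" for j
      using f(3)[of j] by (rule mult_at_least_mono) auto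
    then obtain g where g: "homogeneous 0 g" "f = segre_quadric * g" using segre_kernel[OF uni f(2)] by auto
    have "mult_at_least (Suc 1) (?p i) (segre_quadric * g)" using f(3)[of i] g(2) by (simp add: numeral_2_eq_2)
    then have "mult_at_least 1 (?p i) g"
      by (rule mult_at_least_times_cancel[OF eval_segre_quadric eval_partial_segre_quadric])
    then have "point_eval (?p i) g = 0" by (simp add: mult_at_least_Suc)
    moreover have "g = Poly_Mapping.single 0 (cf g 0)"
    proof (rule poly_mapping_eqI)
      fix a :: "4 \<Rightarrow>\<^sub>0 nat"
      have "a = 0" if "total_degree a = 0" using that by (intro poly_mapping_eqI) (simp add: total_degree_def)
      then show "cf g a = cf (Poly_Mapping.single 0 (cf g 0)) a"
        using g(1) by (auto simp: homogeneous_alt lookup_single when_def)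
    qed
    ultimately have "g = 0" by (metis cpoly_eval_single monom_eval_0 mult.right_neutral single_zero)
    then show False using f(1) g(2) by simp
  qed
  \<comment> \<open>The finitely many bounds to be spread to general points, as triples of degree,
    multiplicities and bound; the range over \<open>i\<close> expresses smoothness at each of the
    nine points.\<close>
  define K :: "(nat \<times> (9 \<Rightarrow> nat) \<times> nat) set" where
    "K = {(2 * m + 1, \<lambda>_. m, dim_bound m), (15, \<lambda>_. 7, 60), (13, \<lambda>_. 6, 56), (2, \<lambda>_. 1, 1)} \<union>
      range (\<lambda>i. (2, \<lambda>j. if j = i then 2 else 1, 0))"
  show ?thesis
  proof (rule for_general_points_ls_dim[where K = K and d = fst and m = "\<lambda>k. fst (snd k)" and N = "\<lambda>k. snd (snd k)" and ?p0.0 = ?p])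
    show "finite K" by (simp add: K_def)
    show "segre (p i) \<noteq> 0" for i by (metis segre_nth(1) zero_index zero_neq_one)
    fix k assume "k \<in> K"
    moreover have "dim_bound 6 = 56" "dim_bound 7 = 60" by (simp_all add: dim_bound_def lessThan_nat_numeral lessThan_Suc)
    ultimately show "ls_dim (fst k) ?p (fst (snd k)) \<le> snd (snd k)"
      using dims[of m] dims[of 7] dims[of 6] quadrics smooth by (auto simp: K_def)
  next
    fix p' :: "9 \<Rightarrow> complex^4"
    assume K: "\<And>k. k \<in> K \<Longrightarrow> ls_dim (fst k) p' (fst (snd k)) \<le> snd (snd k)"
    have "ls_dim 2 p' (\<lambda>j. if j = i then 2 else 1) \<le> 0" for i
      using K[of "(2, \<lambda>j. if j = i then 2 else 1, 0)"] by (auto simp: K_def)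
    then show "(special (2 * m + 1) p' (\<lambda>_. m) \<longleftrightarrow> m \<ge> 9) \<and>
     (m \<le> 8 \<longrightarrow> int (ls_dim (2 * m + 1) p' (\<lambda>_. m)) = vdim (2 * m + 1) (\<lambda>_ :: 9. m)) \<and>
     (m \<ge> 7 \<longrightarrow> ls_dim (2 * m + 1) p' (\<lambda>_. m) = 60) \<and>
     (m \<ge> 8 \<longrightarrow> (\<exists>q. unique_quadric_through p' q \<and>
        base_locus_mult (linear_system (2 * m + 1) p' (\<lambda>_. m)) q (m - 7)))"
      using K[of "(2 * m + 1, \<lambda>_. m, dim_bound m)"] K[of "(15, \<lambda>_. 7, 60)"] K[of "(13, \<lambda>_. 6, 56)"] K[of "(2, \<lambda>_. 1, 1)"]
      by (intro nine_points) (auto simp: K_def)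
  qed
qed

end
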